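(* Let $\mathcal F=(F,<,+,\cdot,0,1,\ldots)$ be a d-minimal expansion of an ordered field. Let $E$ be a definable closed subset of $F^n$ and let $T:E \rightrightarrows F^m$ be a definable lower semi-continuous set-valued map such that $T(x)$ is nonempty, closed and convex for every $x \in E$. Then $T$ has a definable continuous selection; that is, there exists a definable continuous map $f:E \to F^m$ such that $f(x) \in T(x)$ for all $x \in E$.
   Context: Throughout, "definable" means definable in the given structure with parameters. The universe $F$ carries the order topology induced by $<$, $F^n$ carries the product topology, and subsets carry the subspace topology. An expansion $\mathcal F=(F,<,\ldots)$ of a dense linear order without endpoints is definably complete if every definable subset of $F$ has both a supremum and an infimum in $F\cup\{\pm\infty\}$. It is d-minimal if it is definably complete and every definable subset $X$ of $F$ is the union of an open set and finitely many discrete sets, where the number of discrete sets does not depend on the parameters of definition of $X$ (i.e., for each formula there is a bound on the number of discrete sets valid for all choices of parameters). A set-valued map $T:E\rightrightarrows F^m$ is a map from $E$ to the power set of $F^m$. For definable $E\subseteq F^n$, it is definable if its graph $\Gamma(T):=\bigcup_{x\in E}\{x\}\times T(x)\subseteq E\times F^m$ is definable. It is lower semi-continuous if, for any $x_0\in E$, $y_0\in T(x_0)$ and any neighborhood $V$ of $y_0$, there exists a neighborhood $U$ of $x_0$ in $E$ such that $T(x)\cap V\neq\emptyset$ for all $x\in U$. *)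

theory Defs
  imports "HOL-Analysis.Analysis" "HOL-Library.Extended" "HOL-Library.Lub_Glb"
begin

text \<open>
  First-order formulas over a language with function symbols \<open>'f\<close>, relation symbols \<open>'r\<close> and a
  distinguished binary relation symbol \<open>Less\<close>. Symbols are variadic: a symbol applied to \<open>k\<close>
  arguments acts as a \<open>k\<close>-ary symbol, so every language with fixed arities is covered
  (arities that are not wanted can be interpreted by constants). Variables are de Bruijn indices.
\<close>

datatype 'f fo_term = Var nat | Fun 'f "'f fo_term list"

datatype ('f, 'r) fo_form =
    Equal "'f fo_term" "'f fo_term"
  | Less "'f fo_term" "'f fo_term"
  | Rel 'r "'f fo_term list"
  | Neg "('f, 'r) fo_form"
  | Conj "('f, 'r) fo_form" "('f, 'r) fo_form"
  | Exists "('f, 'r) fo_form"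

text \<open>
  An expansion of the ordered set given by the type \<open>'a\<close>: the universe is the whole type, and
  \<open>Less\<close> is always interpreted by the order of \<open>'a\<close>.
\<close>

record ('a, 'f, 'r) expansion =
  fun_of :: "'f \<Rightarrow> 'a list \<Rightarrow> 'a"
  rel_of :: "'r \<Rightarrow> 'a list \<Rightarrow> bool"

primrec eval_term :: "('a, 'f, 'r) expansion \<Rightarrow> (nat \<Rightarrow> 'a) \<Rightarrow> 'f fo_term \<Rightarrow> 'a" where
  "eval_term M e (Var i) = e i"
| "eval_term M e (Fun g ts) = fun_of M g (map (eval_term M e) ts)"

primrec sat :: "('a::linorder, 'f, 'r) expansion \<Rightarrow> (nat \<Rightarrow> 'a) \<Rightarrow> ('f, 'r) fo_form \<Rightarrow> bool" where
  "sat M e (Equal s t) \<longleftrightarrow> eval_term M e s = eval_term M e t"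
| "sat M e (Less s t) \<longleftrightarrow> eval_term M e s < eval_term M e t"
| "sat M e (Rel R ts) \<longleftrightarrow> rel_of M R (map (eval_term M e) ts)"
| "sat M e (Neg p) \<longleftrightarrow> \<not> sat M e p"
| "sat M e (Conj p q) \<longleftrightarrow> sat M e p \<and> sat M e q"
| "sat M e (Exists p) \<longleftrightarrow> (\<exists>a. sat M (case_nat a e) p)"

text \<open>
  The subset of \<open>F\<close> defined by \<open>p\<close>: variable \<open>0\<close> ranges over \<open>F\<close>, and \<open>c i\<close> is the parameter
  substituted for variable \<open>i > 0\<close> (only finitely many of them occur in \<open>p\<close>).
\<close>

definition solution_set ::
    "('a::linorder, 'f, 'r) expansion \<Rightarrow> ('f, 'r) fo_form \<Rightarrow> (nat \<Rightarrow> 'a) \<Rightarrow> 'a set" where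
  "solution_set M p c = {a. sat M (c(0 := a)) p}"

text \<open>
  The points of \<open>F\<^sup>n\<close> are the functions \<open>nat \<Rightarrow> 'a\<close> that are \<open>undefined\<close> outside \<open>{..<n}\<close>; this
  set is the topological space below, of which \<open>{..<n} \<rightarrow>\<^sub>E UNIV\<close> is the underlying set.
\<close>

definition power_space :: "nat \<Rightarrow> (nat \<Rightarrow> 'a::topological_space) topology" where
  "power_space n = product_topology (\<lambda>_. euclidean) {..<n}"

text \<open>
  Definability with parameters in \<open>F\<^sup>n\<close>: the variables \<open>i < n\<close> are the coordinates, all others
  are parameters.
\<close>

definition definable ::
    "('a::linorder, 'f, 'r) expansion \<Rightarrow> nat \<Rightarrow> (nat \<Rightarrow> 'a) set \<Rightarrow> bool" where
  "definable M n X \<longleftrightarrow>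
     (\<exists>p c. X = {x \<in> {..<n} \<rightarrow>\<^sub>E UNIV. sat M (\<lambda>i. if i < n then x i else c i) p})"

definition definably_complete ::
    "('a::unbounded_dense_linorder, 'f, 'r) expansion \<Rightarrow> bool" where
  "definably_complete M \<longleftrightarrow>
     (\<forall>p c. (\<exists>s. isLub UNIV (Fin ` solution_set M p c) s) \<and>
            (\<exists>s. isGlb UNIV (Fin ` solution_set M p c) s))"

definition d_minimal ::
    "('a::{unbounded_dense_linorder, linorder_topology}, 'f, 'r) expansion \<Rightarrow> bool" where
  "d_minimal M \<longleftrightarrow>
     definably_complete M \<and>
     (\<forall>p. \<exists>N. \<forall>c. \<exists>U D. open U \<and> (\<forall>i<N. discrete (D i)) \<and>
        solution_set M p c = U \<union> (\<Union>i<N::nat. D i))"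

definition expands_ordered_field ::
    "('a::linordered_field, 'f, 'r) expansion \<Rightarrow> bool" where
  "expands_ordered_field M \<longleftrightarrow>
     (\<exists>add mul zero one.
        (\<forall>x y. fun_of M add [x, y] = x + y) \<and>
        (\<forall>x y. fun_of M mul [x, y] = x * y) \<and>
        fun_of M zero [] = 0 \<and> fun_of M one [] = 1)"

text \<open>The identification of \<open>F\<^sup>n \<times> F\<^sup>m\<close> with \<open>F\<close> to the power \<open>n + m\<close>.\<close>

definition concat_point :: "nat \<Rightarrow> nat \<Rightarrow> (nat \<Rightarrow> 'a) \<Rightarrow> (nat \<Rightarrow> 'a) \<Rightarrow> nat \<Rightarrow> 'a" where
  "concat_point n m x y = (\<lambda>i\<in>{..<n + m}. if i < n then x i else y (i - n))"

definition set_valued_graph ::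
    "nat \<Rightarrow> nat \<Rightarrow> (nat \<Rightarrow> 'a) set \<Rightarrow> ((nat \<Rightarrow> 'a) \<Rightarrow> (nat \<Rightarrow> 'a) set) \<Rightarrow> (nat \<Rightarrow> 'a) set" where
  "set_valued_graph n m E T = (\<Union>x\<in>E. concat_point n m x ` T x)"

definition definable_set_valued ::
    "('a::linorder, 'f, 'r) expansion \<Rightarrow> nat \<Rightarrow> nat \<Rightarrow> (nat \<Rightarrow> 'a) set \<Rightarrow>
      ((nat \<Rightarrow> 'a) \<Rightarrow> (nat \<Rightarrow> 'a) set) \<Rightarrow> bool" where
  "definable_set_valued M n m E T \<longleftrightarrow>
     (\<forall>x\<in>E. T x \<subseteq> {..<m} \<rightarrow>\<^sub>E UNIV) \<and> definable M (n + m) (set_valued_graph n m E T)"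

definition definable_map ::
    "('a::linorder, 'f, 'r) expansion \<Rightarrow> nat \<Rightarrow> nat \<Rightarrow> (nat \<Rightarrow> 'a) set \<Rightarrow>
      ((nat \<Rightarrow> 'a) \<Rightarrow> (nat \<Rightarrow> 'a)) \<Rightarrow> bool" where
  "definable_map M n m E f \<longleftrightarrow>
     f \<in> E \<rightarrow> ({..<m} \<rightarrow>\<^sub>E UNIV) \<and>
     definable M (n + m) {concat_point n m x (f x) | x. x \<in> E}"

definition neighbourhood :: "'b topology \<Rightarrow> 'b \<Rightarrow> 'b set \<Rightarrow> bool" where
  "neighbourhood X x V \<longleftrightarrow> V \<subseteq> topspace X \<and> (\<exists>W. openin X W \<and> x \<in> W \<and> W \<subseteq> V)"

definition lower_semicontinuous ::
    "nat \<Rightarrow> nat \<Rightarrow> (nat \<Rightarrow> 'a::topological_space) set \<Rightarrow>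
      ((nat \<Rightarrow> 'a) \<Rightarrow> (nat \<Rightarrow> 'a) set) \<Rightarrow> bool" where
  "lower_semicontinuous n m E T \<longleftrightarrow>
     (\<forall>x0\<in>E. \<forall>y0\<in>T x0. \<forall>V. neighbourhood (power_space m) y0 V \<longrightarrow>
        (\<exists>U. neighbourhood (subtopology (power_space n) E) x0 U \<and> (\<forall>x\<in>U. T x \<inter> V \<noteq> {})))"

text \<open>The constant \<open>convex\<close> of the library is restricted to real vector spaces.\<close>

definition convex_in_power :: "nat \<Rightarrow> (nat \<Rightarrow> 'a::linordered_field) set \<Rightarrow> bool" where
  "convex_in_power m S \<longleftrightarrow>
     (\<forall>x\<in>S. \<forall>y\<in>S. \<forall>t. 0 \<le> t \<and> t \<le> 1 \<longrightarrow> (\<lambda>i\<in>{..<m}. (1 - t) * x i + t * y i) \<in> S)"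

end

theory Submission
  imports Defs
begin

text \<open>
  Each \<open>T x\<close> is closed and convex, so a point \<open>G x\<close> of \<open>F\<^sup>m\<close> has a unique nearest point in \<open>T x\<close>.
  Suppose that \<open>G\<close> is continuous and consider \<open>x \<mapsto> f x\<close>, where \<open>f x\<close> is the point of \<open>T x\<close> nearest to
  \<open>G x\<close>. Lower semicontinuity says that the distance from \<open>G x\<close> to \<open>T x\<close> cannot jump up, which makes
  \<open>f\<close> continuous at two kinds of points. One kind are the \<open>x\<close> with \<open>G x \<in> T x\<close>, since the distance
  vanishes there. The other kind are the \<open>x\<close> over which the graph of \<open>T\<close> is closed: a cluster point of
  values \<open>f y\<close> with \<open>y \<rightarrow> x\<close> lies in \<open>T x\<close> and is as near to \<open>G x\<close> as \<open>f x\<close>, hence equals \<open>f x\<close>.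

  Let \<open>B\<close> be a closed set containing all \<open>x\<close> over which the graph of \<open>T\<close> is not closed. If \<open>g\<close> is a
  continuous selection over \<open>B\<close>, extend it to a continuous \<open>G\<close> on \<open>E\<close> by a definable form of Tietze's
  theorem (\<open>tietze_extension\<close>). Then \<open>G x = g x \<in> T x\<close> on \<open>B\<close>, so nearest points give a continuous
  selection over \<open>E\<close> (\<open>extend_selection\<close>). Passing from \<open>E\<close> to \<open>B\<close>, and from \<open>B\<close> to the
  corresponding subset of \<open>B\<close>, and so on, the theorem follows as soon as this process ends with the
  empty set.

  That it ends is where d-minimality enters. Call a definable subset of \<open>P\<close> thin in \<open>P\<close> if it
  contains no nonempty definable relatively open subset of \<open>P\<close>. The set \<open>B\<close> can be chosen thin in \<open>E\<close>
  (\<open>thin_gap_closure\<close>), and a descending sequence of definable sets, each thin in its predecessor,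
  reaches the empty set (\<open>thin_chain_terminates\<close>).

  Both facts rest on a covering principle for an arbitrary nonempty definable \<open>P \<subseteq> F\<^sup>n\<close> (\<open>covering\<close>):
  if \<open>P\<close> is covered by two definable sets, or by an increasing definable family, then one member of
  the cover contains a nonempty relatively open part of \<open>P\<close>. By the first case a bounded definable
  function is nearly constant, at any given scale, on some relatively open part
  (\<open>small_oscillation\<close>). Together with the second case, a Baire property, this turns pointwise choices
  into locally uniform ones (\<open>uniform_choice\<close>). The principle is proved by induction on \<open>n\<close> for all
  definable sets at once: some relatively open part of a nonempty definable subset of
  \<open>F\<^sup>n\<^sup>+\<^sup>1\<close> is either the product of a definable subset of \<open>F\<^sup>n\<close> with an interval or the graph of a
  function on a definable subset of \<open>F\<^sup>n\<close> (\<open>local_structure\<close>).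

  The induction starts from the line (\<open>interval_baire\<close>): an increasing definable family of
  nowhere dense sets cannot fill an interval. Since the number of discrete sets in the definition of
  d-minimality does not depend on the parameters, the Cantor-Bendixson ranks of the members are
  bounded, and one may pass to a family of closed discrete sets. Such a family orders the points by
  the time of their first appearance. Comparing the neighbours of a point at that time yields a
  definable set that is dense and codense, which d-minimality forbids.
\<close>

section \<open>Definable predicates, terms and sets\<close>

primrec ren_term :: "(nat \<Rightarrow> nat) \<Rightarrow> 'f fo_term \<Rightarrow> 'f fo_term" where
  "ren_term s (Var i) = Var (s i)"
| "ren_term s (Fun g ts) = Fun g (map (ren_term s) ts)"

primrec ren_form :: "(nat \<Rightarrow> nat) \<Rightarrow> ('f, 'r) fo_form \<Rightarrow> ('f, 'r) fo_form" where
  "ren_form s (Equal t u) = Equal (ren_term s t) (ren_term s u)"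
| "ren_form s (Less t u) = Less (ren_term s t) (ren_term s u)"
| "ren_form s (Rel R ts) = Rel R (map (ren_term s) ts)"
| "ren_form s (Neg p) = Neg (ren_form s p)"
| "ren_form s (Conj p q) = Conj (ren_form s p) (ren_form s q)"
| "ren_form s (Exists p) = Exists (ren_form (case_nat 0 (\<lambda>i. Suc (s i))) p)"

lemma eval_ren_term: "eval_term M e (ren_term s t) = eval_term M (\<lambda>i. e (s i)) t"
proof (induction t)
  case (Fun g ts)
  then have "map (eval_term M e \<circ> ren_term s) ts = map (eval_term M (\<lambda>i. e (s i))) ts"
    by simp
  then show ?case by (simp only: ren_term.simps eval_term.simps map_map)
qed simp

lemma sat_ren_form: "sat M e (ren_form s p) = sat M (\<lambda>i. e (s i)) p"
proof (induction p arbitrary: e s)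
  case (Exists p)
  have "(\<lambda>i. case_nat a e (case_nat 0 (\<lambda>i. Suc (s i)) i)) = case_nat a (\<lambda>i. e (s i))" for a
    by (auto simp: fun_eq_iff split: nat.splits)
  then show ?case by (simp add: Exists)
next
  case (Rel R ts)
  have "map (eval_term M e \<circ> ren_term s) ts = map (eval_term M (\<lambda>i. e (s i))) ts"
    by (simp add: eval_ren_term)
  then show ?case by (simp only: ren_form.simps sat.simps map_map)
qed (simp_all add: eval_ren_term)

text \<open>
  Predicates on infinite environments are the uniform way to treat definable sets in all powers of
  \<open>F\<close>. Even variables hold the environment and odd ones the parameters, so both supplies are infinite
  and no bound on the variables that occur in a formula has to be tracked.
\<close>

definition interleave :: "(nat \<Rightarrow> 'a) \<Rightarrow> (nat \<Rightarrow> 'a) \<Rightarrow> nat \<Rightarrow> 'a" where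
  "interleave e c = (\<lambda>i. if even i then e (i div 2) else c (i div 2))"

lemma interleave_even [simp]: "interleave e c (2 * i) = e i"
  and interleave_odd [simp]: "interleave e c (Suc (2 * i)) = c i"
  by (simp_all add: interleave_def)

abbreviation Fn :: "nat \<Rightarrow> (nat \<Rightarrow> 'a) set" where
  "Fn n \<equiv> {..<n} \<rightarrow>\<^sub>E UNIV"

lemma parity: "\<exists>j. i = 2 * j \<or> i = Suc (2 * j)" for i :: nat by presburger

lemma Fn_cong: "x \<in> Fn n \<Longrightarrow> y \<in> Fn n \<Longrightarrow> (\<And>i. i < n \<Longrightarrow> x i = y i) \<Longrightarrow> x = y"
  by (rule PiE_ext) auto

lemma Fn_upd: "x \<in> Fn n \<Longrightarrow> x(n := a) \<in> Fn (Suc n)"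
  by (auto simp: PiE_iff extensional_def)

lemma Fn_Suc_cases:
  assumes "y \<in> Fn (Suc n)" obtains x a where "x \<in> Fn n" "y = x(n := a)"
proof
  show "y(n := undefined) \<in> Fn n" using assms by (auto simp: PiE_iff extensional_def)
  show "y = (y(n := undefined))(n := y n)" by simp
qed

text \<open>
  The sum metric describes the product topology and needs neither square roots nor a case
  distinction for \<open>n = 0\<close>.
\<close>

definition dst :: "nat \<Rightarrow> (nat \<Rightarrow> 'a::linordered_field) \<Rightarrow> (nat \<Rightarrow> 'a) \<Rightarrow> 'a" where
  "dst n x y = (\<Sum>i<n. \<bar>x i - y i\<bar>)"

locale d_minimal_field =
  fixes M :: "('a::{linordered_field, linorder_topology}, 'f, 'r) expansion"
  assumes field: "expands_ordered_field M" and d_min: "d_minimal M"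
begin

text \<open>
  The letters \<open>e\<close>, \<open>X\<close>, \<open>t\<close> stand for an environment, for a point of \<open>F\<^sup>n\<close> that depends
  definably on it and for a scalar that does so. A set or relation is called definable if all its
  pullbacks along such \<open>X\<close> and \<open>t\<close> are; this makes the closure rules below applicable to nested
  quantifiers without any renaming of variables.
\<close>

definition dfn :: "((nat \<Rightarrow> 'a) \<Rightarrow> bool) \<Rightarrow> bool" where
  "dfn P \<longleftrightarrow> (\<exists>p c. \<forall>e. P e \<longleftrightarrow> sat M (interleave e c) p)"

definition dterm :: "((nat \<Rightarrow> 'a) \<Rightarrow> 'a) \<Rightarrow> bool" where
  "dterm t \<longleftrightarrow> dfn (\<lambda>e. e 0 = t (\<lambda>i. e (Suc i)))"

definition dvec :: "nat \<Rightarrow> ((nat \<Rightarrow> 'a) \<Rightarrow> nat \<Rightarrow> 'a) \<Rightarrow> bool" where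
  "dvec n X \<longleftrightarrow> (\<forall>e. X e \<in> Fn n) \<and> (\<forall>i<n. dterm (\<lambda>e. X e i))"

definition dset :: "nat \<Rightarrow> (nat \<Rightarrow> 'a) set \<Rightarrow> bool" where
  "dset n A \<longleftrightarrow> A \<subseteq> Fn n \<and> (\<forall>X. dvec n X \<longrightarrow> dfn (\<lambda>e. X e \<in> A))"

definition dfun :: "nat \<Rightarrow> ((nat \<Rightarrow> 'a) \<Rightarrow> 'a) \<Rightarrow> bool" where
  "dfun n h \<longleftrightarrow> (\<forall>X. dvec n X \<longrightarrow> dterm (\<lambda>e. h (X e)))"

definition drel :: "nat \<Rightarrow> ((nat \<Rightarrow> 'a) \<Rightarrow> 'a \<Rightarrow> bool) \<Rightarrow> bool" where
  "drel n Q \<longleftrightarrow> (\<forall>X t. dvec n X \<longrightarrow> dterm t \<longrightarrow> dfn (\<lambda>e. Q (X e) (t e)))"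

text \<open>
  Every variable assignment that picks each value from a fixed position of the interleaved
  environment, uniformly in \<open>e\<close>, comes from a renaming of variables.
\<close>

lemma dfn_formula:
  assumes "\<And>i. \<exists>j. \<forall>e. interleave e d j = v e i"
  shows "dfn (\<lambda>e. sat M (v e) p)"
proof -
  obtain s where s: "\<And>i e. interleave e d (s i) = v e i"
    using assms by metis
  have "\<forall>e. sat M (v e) p \<longleftrightarrow> sat M (interleave e d) (ren_form s p)"
    by (simp add: sat_ren_form s)
  then show ?thesis unfolding dfn_def by blast
qed

lemma dfn_reindex:
  assumes "dfn P" shows "dfn (\<lambda>e. P (\<lambda>i. e (s i)))"
proof -
  obtain p c where p: "\<And>e. P e = sat M (interleave e c) p"
    using assms unfolding dfn_def by blast
  have "\<exists>j. \<forall>e. interleave e c j = interleave (\<lambda>i. e (s i)) c i" for i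
  proof (cases "even i")
    case True
    then show ?thesis by (intro exI[of _ "2 * s (i div 2)"]) (auto simp: interleave_def)
  next
    case False
    then show ?thesis by (intro exI[of _ i]) (auto simp: interleave_def)
  qed
  then show ?thesis unfolding p by (rule dfn_formula)
qed

lemma dfn_neg: assumes "dfn P" shows "dfn (\<lambda>e. \<not> P e)"
proof -
  obtain p c where p: "\<And>e. P e = sat M (interleave e c) p"
    using assms unfolding dfn_def by blast
  then have "\<forall>e. (\<not> P e) = sat M (interleave e c) (Neg p)" by simp
  then show ?thesis unfolding dfn_def by blast
qed

lemma dfn_conj: assumes "dfn P" "dfn Q" shows "dfn (\<lambda>e. P e \<and> Q e)"
proof -
  obtain p c where p: "\<And>e. P e = sat M (interleave e c) p"
    using assms unfolding dfn_def by blast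
  obtain q d where q: "\<And>e. Q e = sat M (interleave e d) q"
    using assms unfolding dfn_def by blast
  \<comment> \<open>The parameters \<open>c\<close> and \<open>d\<close> of the two formulas are themselves interleaved.\<close>
  define s where "s = (\<lambda>i. if even i then i else Suc (4 * (i div 2)))"
  define t where "t = (\<lambda>i. if even i then i else Suc (2 * Suc (2 * (i div 2))))"
  have s: "interleave e (interleave c d) (s i) = interleave e c i" for e i
  proof -
    have "s (2 * j) = 2 * j" "s (Suc (2 * j)) = Suc (2 * (2 * j))" for j
      by (simp_all add: s_def)
    then show ?thesis
      using parity[of i] by (elim exE disjE) (simp_all only: interleave_odd interleave_even)
  qed
  have t: "interleave e (interleave c d) (t i) = interleave e d i" for e i
  proof -
    have "t (2 * j) = 2 * j" "t (Suc (2 * j)) = Suc (2 * Suc (2 * j))" for j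
      by (simp_all add: t_def)
    then show ?thesis
      using parity[of i] by (elim exE disjE) (simp_all only: interleave_odd interleave_even)
  qed
  have "\<forall>e. (P e \<and> Q e) =
      sat M (interleave e (interleave c d)) (Conj (ren_form s p) (ren_form t q))"
    by (simp add: sat_ren_form s t p q)
  then show ?thesis unfolding dfn_def by blast
qed

text \<open>
  The quantified value becomes the new variable \<open>0\<close> and the old environment moves up by one; this is
  the form in which goals about quantified predicates are decomposed.
\<close>

lemma dfn_ex:
  assumes "dfn (\<lambda>e. Q (e 0) (\<lambda>i. e (Suc i)))" shows "dfn (\<lambda>e. \<exists>a. Q a e)"
proof -
  obtain p c where p: "\<And>e. Q (e 0) (\<lambda>i. e (Suc i)) = sat M (interleave e c) p"
    using assms unfolding dfn_def by blast
  define s where "s = (\<lambda>i. if i = 0 then 0 else if even i then Suc (i - 2) else Suc i)"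
  have s: "(\<lambda>i. case_nat a (interleave e c) (s i)) = interleave (case_nat a e) c" for a e
  proof
    fix i
    obtain j where "i = 2 * j \<or> i = Suc (2 * j)" using parity by blast
    then consider "i = 0" | j where "i = 2 * Suc j" | j where "i = Suc (2 * j)"
      by (cases j) (auto simp del: mult_Suc_right)
    then show "case_nat a (interleave e c) (s i) = interleave (case_nat a e) c i"
    proof cases
      case 1
      have "interleave (case_nat a e) c (2 * 0) = a" by (simp only: interleave_even) simp
      with 1 show ?thesis by (simp add: s_def)
    next
      case (2 j)
      have "s i = Suc (2 * j)" unfolding 2 by (simp add: s_def)
      then show ?thesis unfolding 2 interleave_even by simp
    next
      case (3 j)
      have "s i = Suc (Suc (2 * j))" unfolding 3 by (simp add: s_def)
      then show ?thesis unfolding 3 interleave_odd by simp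
    qed
  qed
  have "\<forall>e. (\<exists>a. Q a e) = sat M (interleave e c) (Exists (ren_form s p))"
  proof
    fix e
    have "Q a e = sat M (interleave (case_nat a e) c) p" for a
      using p[of "case_nat a e"] by simp
    then show "(\<exists>a. Q a e) = sat M (interleave e c) (Exists (ren_form s p))"
      by (simp add: sat_ren_form s)
  qed
  then show ?thesis unfolding dfn_def by blast
qed

lemma dfn_disj: assumes "dfn P" "dfn Q" shows "dfn (\<lambda>e. P e \<or> Q e)"
  using dfn_neg[OF dfn_conj[OF dfn_neg[OF assms(1)] dfn_neg[OF assms(2)]]] by simp

lemma dfn_imp: assumes "dfn P" "dfn Q" shows "dfn (\<lambda>e. P e \<longrightarrow> Q e)"
  using dfn_disj[OF dfn_neg[OF assms(1)] assms(2)] by simp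

lemma dfn_iff: assumes "dfn P" "dfn Q" shows "dfn (\<lambda>e. P e \<longleftrightarrow> Q e)"
proof -
  have "(\<lambda>e. P e \<longleftrightarrow> Q e) = (\<lambda>e. (P e \<longrightarrow> Q e) \<and> (Q e \<longrightarrow> P e))" by auto
  then show ?thesis using dfn_conj[OF dfn_imp[OF assms] dfn_imp[OF assms(2,1)]] by simp
qed

lemma dfn_all:
  assumes "dfn (\<lambda>e. Q (e 0) (\<lambda>i. e (Suc i)))" shows "dfn (\<lambda>e. \<forall>a. Q a e)"
  using dfn_neg[OF dfn_ex[of "\<lambda>a e. \<not> Q a e", OF dfn_neg[OF assms]]] by simp

lemma dfn_const: "dfn (\<lambda>e. b)"
proof -
  have "dfn (\<lambda>e. \<exists>a. interleave e e 0 = interleave e e 0)"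
    unfolding dfn_def by (rule exI[of _ "Equal (Var 0) (Var 0)"]) simp
  then have "dfn (\<lambda>e. True)" by simp
  then show ?thesis using dfn_neg[of "\<lambda>e. True"] by (cases b) simp_all
qed

lemma dfn_sat: "dfn (\<lambda>e. sat M e p)"
proof (rule dfn_formula[of undefined])
  show "\<exists>j. \<forall>e. interleave e undefined j = e i" for i
    by (rule exI[of _ "2 * i"]) simp
qed

lemma dfn_eq_var: "dfn (\<lambda>e. e i = e j)"
  using dfn_sat[of "Equal (Var i) (Var j)"] by simp

lemma dfn_less_var: "dfn (\<lambda>e. e i < e j)"
  using dfn_sat[of "Less (Var i) (Var j)"] by simp

lemma dfn_eq_const: "dfn (\<lambda>e. e i = k)"
proof -
  have "\<forall>e. (e i = k) = sat M (interleave e (\<lambda>_. k)) (Equal (Var (2 * i)) (Var (Suc (2 * 0))))"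
    by (simp only: sat.simps eval_term.simps interleave_even interleave_odd) simp
  then show ?thesis unfolding dfn_def by blast
qed

lemma dfn_add_var: "dfn (\<lambda>e. e i = e j + e k)"
proof -
  obtain add where "\<And>x y. fun_of M add [x, y] = x + y"
    using field unfolding expands_ordered_field_def by metis
  then show ?thesis
    using dfn_sat[of "Equal (Var i) (Fun add [Var j, Var k])"] by simp
qed

lemma dfn_mult_var: "dfn (\<lambda>e. e i = e j * e k)"
proof -
  obtain mul where "\<And>x y. fun_of M mul [x, y] = x * y"
    using field unfolding expands_ordered_field_def by metis
  then show ?thesis
    using dfn_sat[of "Equal (Var i) (Fun mul [Var j, Var k])"] by simp
qed

lemma dterm_graph: "dterm t \<Longrightarrow> dfn (\<lambda>e. e i = t (\<lambda>j. e (s j)))"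
  unfolding dterm_def by (drule dfn_reindex[of _ "case_nat i s"]) simp

lemma dterm_var: "dterm (\<lambda>e. e i)"
  unfolding dterm_def by (rule dfn_eq_var)

lemma dterm_const: "dterm (\<lambda>e. k)"
  unfolding dterm_def by (rule dfn_eq_const)

lemma dterm_reindex: "dterm t \<Longrightarrow> dterm (\<lambda>e. t (\<lambda>i. e (s i)))"
  unfolding dterm_def by (drule dfn_reindex[of _ "case_nat 0 (\<lambda>i. Suc (s i))"]) simp

lemma dterm_unique:
  assumes "dfn (\<lambda>e. Q (e 0) (\<lambda>i. e (Suc i)))" and "\<And>e a. a = t e \<longleftrightarrow> Q a e"
  shows "dterm t"
  unfolding dterm_def using assms by simp

lemma dfn_subst2:
  assumes "dfn (\<lambda>e. Q (e 0) (e 1) (\<lambda>i. e (Suc (Suc i))))" "dterm t" "dterm u"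
  shows "dfn (\<lambda>e. Q (t e) (u e) e)"
proof -
  have "dfn (\<lambda>e. \<exists>a b. (b = t e \<and> a = u e) \<and> Q b a e)"
    using assms(1)
    by (intro dfn_ex dfn_conj dterm_graph[OF assms(2)] dterm_graph[OF assms(3)]) simp
  then show ?thesis by simp
qed

lemma dfn_subst:
  assumes "dfn (\<lambda>e. Q (e 0) (\<lambda>i. e (Suc i)))" "dterm t"
  shows "dfn (\<lambda>e. Q (t e) e)"
proof -
  have "dfn (\<lambda>e. \<exists>b. b = t e \<and> Q b e)"
    using assms(1) by (intro dfn_ex dfn_conj dterm_graph[OF assms(2)])
  then show ?thesis by simp
qed

lemma dfn_less: "dterm t \<Longrightarrow> dterm u \<Longrightarrow> dfn (\<lambda>e. t e < u e)"
  by (rule dfn_subst2[where Q = "\<lambda>a b e. a < b"]) (rule dfn_less_var)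

lemma dfn_eq: "dterm t \<Longrightarrow> dterm u \<Longrightarrow> dfn (\<lambda>e. t e = u e)"
  by (rule dfn_subst2[where Q = "\<lambda>a b e. a = b"]) (rule dfn_eq_var)

lemma dfn_le: "dterm t \<Longrightarrow> dterm u \<Longrightarrow> dfn (\<lambda>e. t e \<le> u e)"
  using dfn_neg[OF dfn_less[of u t]] by (simp add: not_less)

lemma dterm_subst2:
  assumes "dfn (\<lambda>e. e 0 = f (e 1) (e 2))" "dterm t" "dterm u"
  shows "dterm (\<lambda>e. f (t e) (u e))"
  unfolding dterm_def
proof (rule dfn_subst2[where Q = "\<lambda>a b e. e 0 = f a b"])
  show "dfn (\<lambda>e. e (Suc (Suc 0)) = f (e 0) (e 1))"
    using dfn_reindex[OF assms(1), of "\<lambda>i. if i = 0 then 2 else if i = 1 then 0 else 1"]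
    by (simp add: numeral_2_eq_2)
qed (intro dterm_reindex[OF assms(2)] dterm_reindex[OF assms(3)])+

lemma dterm_add: "dterm t \<Longrightarrow> dterm u \<Longrightarrow> dterm (\<lambda>e. t e + u e)"
  by (rule dterm_subst2[where f = "(+)"]) (rule dfn_add_var)

lemma dterm_mult: "dterm t \<Longrightarrow> dterm u \<Longrightarrow> dterm (\<lambda>e. t e * u e)"
  by (rule dterm_subst2[where f = "(*)"]) (rule dfn_mult_var)

lemma dterm_uminus: "dterm t \<Longrightarrow> dterm (\<lambda>e. - t e)"
  using dterm_mult[OF dterm_const[of "-1"]] by simp

lemma dterm_diff: "dterm t \<Longrightarrow> dterm u \<Longrightarrow> dterm (\<lambda>e. t e - u e)"
  using dterm_add[OF _ dterm_uminus] by simp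

lemma dterm_if:
  assumes "dfn P" "dterm t" "dterm u" shows "dterm (\<lambda>e. if P e then t e else u e)"
proof (rule dterm_unique[where Q = "\<lambda>a e. (P e \<longrightarrow> a = t e) \<and> (\<not> P e \<longrightarrow> a = u e)"])
  show "dfn (\<lambda>e. (P (\<lambda>i. e (Suc i)) \<longrightarrow> e 0 = t (\<lambda>i. e (Suc i))) \<and>
      (\<not> P (\<lambda>i. e (Suc i)) \<longrightarrow> e 0 = u (\<lambda>i. e (Suc i))))"
    by (intro dfn_conj dfn_imp dfn_neg dterm_graph[OF assms(2)] dterm_graph[OF assms(3)]
        dfn_reindex[OF assms(1)])
qed auto

lemma dterm_divide:
  assumes "dterm t" "dterm u" shows "dterm (\<lambda>e. t e / u e)"
proof (rule dterm_unique[where Q = "\<lambda>a e. (u e = 0 \<longrightarrow> a = 0) \<and> (\<not> u e = 0 \<longrightarrow> a * u e = t e)"])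
  show "dfn (\<lambda>e. (u (\<lambda>i. e (Suc i)) = 0 \<longrightarrow> e 0 = 0) \<and>
      (\<not> u (\<lambda>i. e (Suc i)) = 0 \<longrightarrow> e 0 * u (\<lambda>i. e (Suc i)) = t (\<lambda>i. e (Suc i))))"
    by (intro dfn_conj dfn_imp dfn_neg dfn_eq dterm_mult dterm_reindex[OF assms(1)]
        dterm_reindex[OF assms(2)] dterm_var dterm_const)
qed (auto simp: field_simps)

lemma dterm_abs: assumes "dterm t" shows "dterm (\<lambda>e. \<bar>t e\<bar>)"
  unfolding abs_if by (intro dterm_if dterm_uminus dfn_less dterm_const assms)

lemma dterm_max: assumes "dterm t" "dterm u" shows "dterm (\<lambda>e. max (t e) (u e))"
  unfolding max_def by (intro dterm_if dfn_le assms)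

lemma dterm_sum: "(\<And>i. i < n \<Longrightarrow> dterm (t i)) \<Longrightarrow> dterm (\<lambda>e. \<Sum>i<(n::nat). t i e)"
  by (induction n) (auto intro: dterm_const dterm_add)

lemma dfn_ball_nat: "(\<And>i. i < n \<Longrightarrow> dfn (P i)) \<Longrightarrow> dfn (\<lambda>e. \<forall>i<(n::nat). P i e)"
proof (induction n)
  case (Suc n)
  have "(\<forall>i<Suc n. P i e) \<longleftrightarrow> (\<forall>i<n. P i e) \<and> P n e" for e
    by (auto simp: less_Suc_eq)
  then show ?case using dfn_conj[of "\<lambda>e. \<forall>i<n. P i e" "P n"] Suc by simp
qed (simp add: dfn_const)

lemma dvec_restrict: "(\<And>i. i < n \<Longrightarrow> dterm (t i)) \<Longrightarrow> dvec n (\<lambda>e. \<lambda>i\<in>{..<n}. t i e)"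
  unfolding dvec_def by auto

lemma dvec_var: "dvec n (\<lambda>e. \<lambda>i\<in>{..<n}. e (s i))"
  by (intro dvec_restrict dterm_var)

lemma dvec_var_id: "dvec n (\<lambda>e. \<lambda>i\<in>{..<n}. e i)"
  using dvec_var[of n "\<lambda>i. i"] .

lemma dvec_const: "x \<in> Fn n \<Longrightarrow> dvec n (\<lambda>e. x)"
  unfolding dvec_def by (auto intro: dterm_const)

lemma dvec_reindex: "dvec n X \<Longrightarrow> dvec n (\<lambda>e. X (\<lambda>i. e (s i)))"
  unfolding dvec_def by (auto intro: dterm_reindex)

lemma dvec_upd: "dvec n X \<Longrightarrow> dterm t \<Longrightarrow> dvec (Suc n) (\<lambda>e. (X e)(n := t e))"
  unfolding dvec_def by (auto simp: PiE_iff extensional_def less_Suc_eq)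

lemma dvec_comp: "dvec n X \<Longrightarrow> i < n \<Longrightarrow> dterm (\<lambda>e. X e i)"
  unfolding dvec_def by auto

lemma dterm_dst: "dvec n X \<Longrightarrow> dvec n Y \<Longrightarrow> dterm (\<lambda>e. dst n (X e) (Y e))"
  unfolding dst_def by (intro dterm_sum dterm_abs dterm_diff dvec_comp) auto

lemma dfn_set: "dset n A \<Longrightarrow> dvec n X \<Longrightarrow> dfn (\<lambda>e. X e \<in> A)"
  unfolding dset_def by blast

lemma dset_subset: "dset n A \<Longrightarrow> x \<in> A \<Longrightarrow> x \<in> Fn n"
  unfolding dset_def by blast

lemma dfn_rel: "drel n Q \<Longrightarrow> dvec n X \<Longrightarrow> dterm t \<Longrightarrow> dfn (\<lambda>e. Q (X e) (t e))"
  unfolding drel_def by blast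

lemma dterm_fun: "dfun n h \<Longrightarrow> dvec n X \<Longrightarrow> dterm (\<lambda>e. h (X e))"
  unfolding dfun_def by blast

text \<open>
  A quantifier over \<open>F\<^sup>n\<close> is a block of \<open>n\<close> scalar quantifiers; the last coordinate is split off.
\<close>

lemma dfn_ex_vec:
  assumes "dfn (\<lambda>e. Q (\<lambda>i\<in>{..<n}. e i) (\<lambda>i. e (n + i)))"
  shows "dfn (\<lambda>e. \<exists>x\<in>Fn n. Q x e)"
  using assms
proof (induction n arbitrary: Q)
  case 0
  then show ?case by simp
next
  case (Suc n)
  define s where "s = (\<lambda>i. if i < n then Suc i else if i = n then 0 else i)"
  have s: "(\<lambda>i\<in>{..<Suc n}. e (s i)) = (\<lambda>i\<in>{..<n}. e (Suc i))(n := e 0)"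
    "(\<lambda>i. e (s (Suc n + i))) = (\<lambda>i. e (Suc (n + i)))" for e :: "nat \<Rightarrow> 'a"
    by (auto simp: s_def fun_eq_iff)
  have "dfn (\<lambda>e. \<exists>x\<in>Fn n. \<exists>a. Q (x(n := a)) e)"
    using dfn_reindex[OF Suc.prems, of s] unfolding s by (intro Suc.IH dfn_ex)
  moreover have "(\<exists>x\<in>Fn (Suc n). Q x e) \<longleftrightarrow> (\<exists>x\<in>Fn n. \<exists>a. Q (x(n := a)) e)" for e
  proof
    assume "\<exists>x\<in>Fn (Suc n). Q x e"
    then obtain y where y: "y \<in> Fn (Suc n)" "Q y e" by blast
    from y(1) obtain x a where "x \<in> Fn n" "y = x(n := a)" by (rule Fn_Suc_cases)
    then show "\<exists>x\<in>Fn n. \<exists>a. Q (x(n := a)) e" using y(2) by blast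
  next
    assume "\<exists>x\<in>Fn n. \<exists>a. Q (x(n := a)) e"
    then show "\<exists>x\<in>Fn (Suc n). Q x e" by (elim bexE exE) (rule bexI[OF _ Fn_upd])
  qed
  ultimately show ?case by simp
qed

lemma dfn_all_vec:
  assumes "dfn (\<lambda>e. Q (\<lambda>i\<in>{..<n}. e i) (\<lambda>i. e (n + i)))"
  shows "dfn (\<lambda>e. \<forall>x\<in>Fn n. Q x e)"
proof -
  have "dfn (\<lambda>e. \<not> (\<exists>x\<in>Fn n. \<not> Q x e))"
    by (intro dfn_neg dfn_ex_vec assms)
  then show ?thesis by simp
qed

lemma dfn_ex_set:
  assumes "dset n A" "dfn (\<lambda>e. Q (\<lambda>i\<in>{..<n}. e i) (\<lambda>i. e (n + i)))"
  shows "dfn (\<lambda>e. \<exists>x\<in>A. Q x e)"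
proof -
  have "dfn (\<lambda>e. \<exists>x\<in>Fn n. x \<in> A \<and> Q x e)"
    by (intro dfn_ex_vec dfn_conj dfn_set[OF assms(1)] dvec_var_id assms(2))
  moreover have "(\<exists>x\<in>Fn n. x \<in> A \<and> Q x e) = (\<exists>x\<in>A. Q x e)" for e
    using assms(1) dset_subset by blast
  ultimately show ?thesis by simp
qed

lemma dfn_eq_vec:
  assumes "dvec n X" "dvec n Y" shows "dfn (\<lambda>e. X e = Y e)"
proof -
  have "dfn (\<lambda>e. \<forall>i<n. X e i = Y e i)"
    by (intro dfn_ball_nat dfn_eq dvec_comp[OF assms(1)] dvec_comp[OF assms(2)])
  moreover have "(\<forall>i<n. X e i = Y e i) \<longleftrightarrow> X e = Y e" for e
    using assms Fn_cong[of "X e" n "Y e"] by (auto simp: dvec_def)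
  ultimately show ?thesis by simp
qed

lemma dfn_subst_vec:
  assumes "dvec n X" "dfn (\<lambda>e. Q (\<lambda>i\<in>{..<n}. e i) (\<lambda>i. e (n + i)))"
  shows "dfn (\<lambda>e. Q (X e) e)"
proof -
  have "dfn (\<lambda>e. \<exists>x\<in>Fn n. x = X e \<and> Q x e)"
    by (intro dfn_ex_vec dfn_conj dfn_eq_vec[of n] dvec_var_id dvec_reindex[OF assms(1)] assms(2))
  moreover have "X e \<in> Fn n" for e using assms(1) by (simp add: dvec_def)
  ultimately show ?thesis by simp
qed

lemma dsetI:
  assumes "dfn (\<lambda>e. Q (\<lambda>i\<in>{..<n}. e i))" shows "dset n {x\<in>Fn n. Q x}"
  unfolding dset_def
proof (intro conjI allI impI)
  fix X assume X: "dvec n X"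
  have "dfn (\<lambda>e. Q (X e))" by (rule dfn_subst_vec[OF X]) (rule assms)
  moreover have "X e \<in> Fn n" for e using X by (simp add: dvec_def)
  ultimately show "dfn (\<lambda>e. X e \<in> {x \<in> Fn n. Q x})" by simp
qed auto

lemma dset_Collect:
  assumes "dset n A" "dfn (\<lambda>e. Q (\<lambda>i\<in>{..<n}. e i))" shows "dset n {x\<in>A. Q x}"
proof -
  have "{x\<in>A. Q x} = {x\<in>Fn n. x \<in> A \<and> Q x}" using assms(1) dset_subset by blast
  moreover have "dset n {x\<in>Fn n. x \<in> A \<and> Q x}"
    by (intro dsetI dfn_conj dfn_set[OF assms(1)] dvec_var_id assms(2))
  ultimately show ?thesis by simp
qed

lemma drelI:
  assumes "dfn (\<lambda>e. Q (\<lambda>i\<in>{..<n}. e (Suc i)) (e 0))" shows "drel n Q"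
  unfolding drel_def
proof (intro allI impI)
  fix X t assume X: "dvec n X" "dterm t"
  have "dfn (\<lambda>e. Q (\<lambda>i\<in>{..<n}. e i) (e n))"
    using dfn_reindex[OF assms, of "\<lambda>i. if i = 0 then n else i - 1"] by simp
  then have "dfn (\<lambda>e. Q (X (\<lambda>i. e (Suc i))) (e 0))"
    by (rule dfn_subst_vec[where Q = "\<lambda>x e. Q x (e 0)", OF dvec_reindex[OF X(1), of Suc], simplified])
  then show "dfn (\<lambda>e. Q (X e) (t e))"
    by (rule dfn_subst[where Q = "\<lambda>a e. Q (X e) a", OF _ X(2)])
qed

lemma dfunI:
  assumes "dterm (\<lambda>e. h (\<lambda>i\<in>{..<n}. e i))" shows "dfun n h"
proof -
  have "dfn (\<lambda>e. e 0 = h (\<lambda>i\<in>{..<n}. e (Suc i)))"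
    using assms unfolding dterm_def .
  then have "drel n (\<lambda>x a. a = h x)" by (rule drelI)
  then show ?thesis unfolding dfun_def dterm_def
    using dfn_rel[of n "\<lambda>x a. a = h x" "\<lambda>e. _ (\<lambda>i. e (Suc i))" "\<lambda>e. e 0"] dterm_var dvec_reindex[of n _ Suc]
    by blast
qed

lemmas dfn_rules = dfn_conj dfn_disj dfn_imp dfn_iff dfn_neg dfn_ex_vec dfn_all_vec dfn_ex dfn_all
  dfn_less dfn_le dfn_eq dterm_var dterm_const dterm_add dterm_diff dterm_mult dterm_uminus
  dterm_divide dterm_abs dterm_max dterm_if dterm_dst dvec_var dvec_var_id dvec_upd

lemma dset_definable:
  assumes "definable M n A" shows "dset n A"
proof -
  obtain p c where A: "A = {x \<in> Fn n. sat M (\<lambda>i. if i < n then x i else c i) p}"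
    using assms unfolding definable_def by blast
  show ?thesis unfolding A
  proof (rule dsetI, rule dfn_formula[where d = c])
    fix i
    show "\<exists>j. \<forall>e. interleave e c j = (if i < n then (\<lambda>i\<in>{..<n}. e i) i else c i)"
    proof (cases "i < n")
      case True
      then show ?thesis by (intro exI[of _ "2 * i"]) simp
    next
      case False
      then show ?thesis by (intro exI[of _ "Suc (2 * i)"]) simp
    qed
  qed
qed

lemma definable_dset:
  assumes "dset n A" shows "definable M n A"
proof -
  have "dfn (\<lambda>e. (\<lambda>i\<in>{..<n}. e i) \<in> A)" by (rule dfn_set[OF assms dvec_var_id])
  then obtain p c where p: "\<And>e. (\<lambda>i\<in>{..<n}. e i) \<in> A \<longleftrightarrow> sat M (interleave e c) p"
    unfolding dfn_def by blast
  \<comment> \<open>The value of a point of \<open>F\<^sup>n\<close> beyond \<open>n\<close> is \<open>undefined\<close>, so it is passed as a parameter.\<close>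
  define s where "s = (\<lambda>i. if even i \<and> i div 2 < n then i div 2 else n + i)"
  define d where "d = (\<lambda>i. interleave (\<lambda>_. undefined) c (i - n))"
  have "x \<in> A \<longleftrightarrow> sat M (\<lambda>i. if i < n then x i else d i) (ren_form s p)" if x: "x \<in> Fn n" for x
  proof -
    have "(\<lambda>i. if s i < n then x (s i) else d (s i)) = interleave x c"
      using x by (auto simp: fun_eq_iff s_def d_def interleave_def PiE_iff extensional_def)
    moreover have "(\<lambda>i\<in>{..<n}. x i) = x"
      using x by (auto simp: fun_eq_iff PiE_iff extensional_def)
    ultimately show ?thesis using p[of x] by (simp add: sat_ren_form)
  qed
  then have "A = {x \<in> Fn n. sat M (\<lambda>i. if i < n then x i else d i) (ren_form s p)}"
    using assms dset_subset by blast
  then show ?thesis unfolding definable_def by blast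
qed

end

section \<open>Definable subsets of the line\<close>

definition isolated_pt :: "'a::linordered_field set \<Rightarrow> 'a \<Rightarrow> bool" where
  "isolated_pt S a \<longleftrightarrow> a \<in> S \<and> (\<exists>s>0. \<forall>b. b \<in> S \<longrightarrow> \<bar>b - a\<bar> < s \<longrightarrow> b = a)"

definition inner_pt :: "'a::linordered_field set \<Rightarrow> 'a \<Rightarrow> bool" where
  "inner_pt S a \<longleftrightarrow> (\<exists>s>0. \<forall>b. \<bar>b - a\<bar> < s \<longrightarrow> b \<in> S)"

text \<open>
  The Cantor-Bendixson derivative relative to \<open>S\<close>, for sets that need not be closed.
\<close>

definition Der :: "'a::linordered_field set \<Rightarrow> 'a set" where
  "Der S = {a \<in> S. \<not> isolated_pt S a}"

lemma Der_subset: "Der S \<subseteq> S"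
  by (auto simp: Der_def)

lemma Der_mono: "S \<subseteq> T \<Longrightarrow> Der S \<subseteq> Der T"
  unfolding Der_def isolated_pt_def by blast

lemma Der_funpow_mono: "S \<subseteq> T \<Longrightarrow> (Der ^^ k) S \<subseteq> (Der ^^ k) T"
  by (induction k) (auto dest: Der_mono)

lemma Der_funpow_subset: "(Der ^^ k) S \<subseteq> S"
  by (induction k) (simp, use Der_subset in fastforce)

lemma inner_pt_interval:
  fixes a :: "'a::linordered_field"
  shows "l < a \<Longrightarrow> a < r \<Longrightarrow> inner_pt {l<..<r} a"
  unfolding inner_pt_def by (intro exI[of _ "min (a - l) (r - a)"]) auto

lemma inner_pt_mono: "inner_pt S a \<Longrightarrow> S \<subseteq> T \<Longrightarrow> inner_pt T a"
  unfolding inner_pt_def by blast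

lemma Der_Int_open:
  assumes "\<And>a. a \<in> W \<Longrightarrow> inner_pt W a" shows "Der (S \<inter> W) = Der S \<inter> W"
proof -
  have "isolated_pt (S \<inter> W) a \<longleftrightarrow> isolated_pt S a" if aW: "a \<in> W" for a
  proof
    assume "isolated_pt (S \<inter> W) a"
    then obtain s where s: "a \<in> S" "0 < s" "\<And>b. b \<in> S \<inter> W \<Longrightarrow> \<bar>b - a\<bar> < s \<Longrightarrow> b = a"
      unfolding isolated_pt_def by auto
    obtain t where t: "0 < t" "\<And>b. \<bar>b - a\<bar> < t \<Longrightarrow> b \<in> W"
      using assms[OF aW] unfolding inner_pt_def by auto
    show "isolated_pt S a" unfolding isolated_pt_def
      using s t by (intro conjI exI[of _ "min s t"]) auto
  qed (use aW in \<open>auto simp: isolated_pt_def\<close>)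
  then show ?thesis unfolding Der_def by auto
qed

lemma Der_funpow_Int_open:
  assumes "\<And>a. a \<in> W \<Longrightarrow> inner_pt W a" shows "(Der ^^ k) (S \<inter> W) = (Der ^^ k) S \<inter> W"
  using Der_Int_open[OF assms] by (induction k) auto

text \<open>
  Near a point \<open>x\<close> of the discrete set \<open>D j\<close> the other points of \<open>S\<close> lie in the remaining \<open>N\<close>
  discrete sets, so the \<open>N\<close>-th derivative has no further point near \<open>x\<close>.
\<close>

lemma Der_finite_union_discrete:
  assumes "finite I" "card I = N" "\<And>i x. i \<in> I \<Longrightarrow> x \<in> D i \<Longrightarrow> isolated_pt (D i) x"
    "S \<subseteq> (\<Union>i\<in>I. D i)"
  shows "(Der ^^ N) S = {}"
  using assms
proof (induction N arbitrary: I S)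
  case (Suc N)
  have "isolated_pt ((Der ^^ N) S) x" if x: "x \<in> (Der ^^ N) S" for x
  proof -
    have "x \<in> S" using x Der_funpow_subset by blast
    then obtain j where j: "j \<in> I" "x \<in> D j" using Suc.prems by blast
    then obtain s where s: "0 < s" "\<And>b. b \<in> D j \<Longrightarrow> \<bar>b - x\<bar> < s \<Longrightarrow> b = x"
      using Suc.prems(3) unfolding isolated_pt_def by metis
    define W where "W = {b. 0 < \<bar>b - x\<bar> \<and> \<bar>b - x\<bar> < s}"
    have W: "inner_pt W a" if "a \<in> W" for a
      unfolding inner_pt_def
      by (rule exI[of _ "min \<bar>a - x\<bar> (s - \<bar>a - x\<bar>)"])
        (use that in \<open>auto simp: W_def abs_if split: if_splits\<close>)
    have "(Der ^^ N) (S \<inter> W) = {}"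
    proof (rule Suc.IH)
      show "finite (I - {j})" "card (I - {j}) = N" using Suc.prems j by auto
      have "b \<notin> D j" if "b \<in> W" for b using s(2)[of b] that by (auto simp: W_def)
      then show "S \<inter> W \<subseteq> (\<Union>i\<in>I - {j}. D i)" using Suc.prems(4) by blast
    qed (use Suc.prems in auto)
    then have "(Der ^^ N) S \<inter> W = {}" using Der_funpow_Int_open[of W N S] W by simp
    then show ?thesis unfolding isolated_pt_def
      using x s(1) by (intro conjI exI[of _ s]) (auto simp: W_def)
  qed
  then have "Der ((Der ^^ N) S) = {}" unfolding Der_def[of "(Der ^^ N) S"] by blast
  then show ?case by simp
qed simp

text \<open>
  A set that meets every subinterval of \<open>(l, r)\<close> has no isolated point there and hence equals its
  derivative there.
\<close>

lemma Der_empty_nowhere_dense: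
  fixes S :: "'a::linordered_field set"
  assumes "(Der ^^ N) S = {}" "l < r"
  shows "\<exists>l' r'. l \<le> l' \<and> l' < r' \<and> r' \<le> r \<and> {l'<..<r'} \<inter> S = {}"
proof (rule ccontr)
  assume "\<not> ?thesis"
  then have dense: "{l'<..<r'} \<inter> S \<noteq> {}" if "l \<le> l'" "l' < r'" "r' \<le> r" for l' r'
    using that by blast
  have "\<not> isolated_pt S a" if a: "l < a" "a < r" for a
  proof
    assume "isolated_pt S a"
    then obtain s where s: "0 < s" "\<And>b. b \<in> S \<Longrightarrow> \<bar>b - a\<bar> < s \<Longrightarrow> b = a"
      unfolding isolated_pt_def by blast
    have "{a<..<min r (a + s)} \<inter> S \<noteq> {}"
      using a s(1) by (intro dense) auto
    then obtain b where "b \<in> S" "b \<in> {a<..<min r (a + s)}" by blast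
    then show False using s(2)[of b] by auto
  qed
  then have "Der S \<inter> {l<..<r} = S \<inter> {l<..<r}" by (auto simp: Der_def)
  then have "Der (S \<inter> {l<..<r}) = S \<inter> {l<..<r}"
    by (subst Der_Int_open) (auto intro: inner_pt_interval)
  then have "(Der ^^ k) (S \<inter> {l<..<r}) = S \<inter> {l<..<r}" for k by (induction k) auto
  then have "S \<inter> {l<..<r} = {}" using Der_funpow_mono[of "S \<inter> {l<..<r}" S N] assms(1) by auto
  then show False using dense[of l r] assms(2) by auto
qed

lemma open_inner_pt:
  fixes U :: "'a::{linordered_field, linorder_topology} set"
  assumes "open U" "a \<in> U" shows "inner_pt U a"
proof -
  obtain b where b: "a < b" "{a..<b} \<subseteq> U" using open_right[OF assms, of "a + 1"] by auto
  obtain c where c: "c < a" "{c<..a} \<subseteq> U" using open_left[OF assms, of "a - 1"] by auto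
  have "inner_pt {c<..<b} a" by (rule inner_pt_interval[OF c(1) b(1)])
  moreover have "{c<..<b} \<subseteq> U" using b c by (auto simp: subset_iff) (metis linear)
  ultimately show ?thesis by (rule inner_pt_mono)
qed

lemma discrete_isolated_pt:
  fixes D :: "'a::{linordered_field, linorder_topology} set"
  assumes "discrete D" "a \<in> D" shows "isolated_pt D a"
proof -
  obtain T where "open T" "T \<inter> D = {a}"
    using assms unfolding discrete_def isolated_in_def by blast
  then show ?thesis using open_inner_pt[of T a] assms(2)
    unfolding isolated_pt_def inner_pt_def by blast
qed

definition reflect :: "('a::linordered_field \<Rightarrow> 'a \<Rightarrow> bool) \<Rightarrow> 'a \<Rightarrow> 'a \<Rightarrow> bool" where
  "reflect L x y = L (- x) (- y)"

context d_minimal_field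
begin

definition dset1 :: "'a set \<Rightarrow> bool" where
  "dset1 S \<longleftrightarrow> dfn (\<lambda>e. e 0 \<in> S)"

text \<open>
  The members of a definable family are the solution sets of one formula; d-minimality then bounds
  them all by the same number.
\<close>

lemma dfn_solution_set:
  assumes "dfn (\<lambda>e. Q (e 0) (\<lambda>i. e (Suc i)))"
  shows "\<exists>p c. \<forall>e. {a. Q a e} = solution_set M p (interleave (case_nat undefined e) c)"
proof -
  obtain p c where p: "\<And>e. Q (e 0) (\<lambda>i. e (Suc i)) = sat M (interleave e c) p"
    using assms unfolding dfn_def by blast
  have "(interleave (case_nat b e) c)(0 := a) = interleave (case_nat a e) c" for a b e
    by (auto simp: fun_eq_iff interleave_def split: nat.splits)
  then have "{a. Q a e} = solution_set M p (interleave (case_nat undefined e) c)" for e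
    using p[of "case_nat _ e"] unfolding solution_set_def by simp
  then show ?thesis by blast
qed

lemma dset1_solution_set:
  assumes "dset1 S" shows "\<exists>p c. S = solution_set M p c"
proof -
  have "dfn (\<lambda>e. e 0 \<in> S)" using assms unfolding dset1_def .
  from dfn_solution_set[of "\<lambda>a e. a \<in> S", OF this] show ?thesis by auto
qed

lemma lub_exists:
  assumes "dset1 S" "S \<noteq> {}" "\<And>a. a \<in> S \<Longrightarrow> a \<le> b"
  shows "\<exists>s. \<forall>u. s \<le> u \<longleftrightarrow> (\<forall>a\<in>S. a \<le> u)"
proof -
  obtain p c where S: "S = solution_set M p c" using dset1_solution_set[OF assms(1)] by blast
  obtain s where s: "isLub UNIV (Fin ` S) s"
    using d_min unfolding d_minimal_def definably_complete_def S by blast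
  then have up: "a \<in> S \<Longrightarrow> Fin a \<le> s" and least: "(\<And>a. a \<in> S \<Longrightarrow> Fin a \<le> u) \<Longrightarrow> s \<le> u" for a u
    unfolding isLub_def leastP_def isUb_def setle_def setge_def by auto
  have "s \<le> Fin b" using assms(3) by (intro least) auto
  moreover obtain a where "a \<in> S" using assms(2) by blast
  then have "Fin a \<le> s" by (rule up)
  ultimately obtain s' where "s = Fin s'" by (cases s) auto
  then have "s' \<le> u \<longleftrightarrow> (\<forall>a\<in>S. a \<le> u)" for u
    using up least[of "Fin u"] by (auto intro: order_trans)
  then show ?thesis by blast
qed

lemma dset1_uminus:
  assumes "dset1 S" shows "dset1 (uminus ` S)"
proof -
  have "dfn (\<lambda>e. \<exists>a. a \<in> S \<and> e 0 = - a)"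
    using assms unfolding dset1_def by (intro dfn_rules)
  moreover have "(\<exists>a. a \<in> S \<and> b = - a) \<longleftrightarrow> b \<in> uminus ` S" for b by auto
  ultimately show ?thesis unfolding dset1_def by simp
qed

lemma glb_exists:
  assumes "dset1 S" "S \<noteq> {}" "\<And>a. a \<in> S \<Longrightarrow> b \<le> a"
  shows "\<exists>s. \<forall>u. u \<le> s \<longleftrightarrow> (\<forall>a\<in>S. u \<le> a)"
proof -
  obtain s where s: "\<And>u. s \<le> u \<longleftrightarrow> (\<forall>a\<in>uminus ` S. a \<le> u)"
  proof -
    have "uminus ` S \<noteq> {}" "\<And>a. a \<in> uminus ` S \<Longrightarrow> a \<le> - b" using assms(2,3) by auto
    then show thesis using lub_exists[OF dset1_uminus[OF assms(1)]] that by blast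
  qed
  have "u \<le> - s \<longleftrightarrow> (\<forall>a\<in>S. u \<le> a)" for u using s[of "- u"] by auto
  then show ?thesis by blast
qed

text \<open>
  The open part of a definable set without inner points is empty, so only the discrete sets remain.
  The order of the quantifiers matters: \<open>N\<close> serves the whole family.
\<close>

lemma Der_uniform:
  assumes "dfn (\<lambda>e. Q (e 0) (\<lambda>i. e (Suc i)))"
  shows "\<exists>N. \<forall>e. (\<forall>a. \<not> inner_pt {a. Q a e} a) \<longrightarrow> (Der ^^ N) {a. Q a e} = {}"
proof -
  obtain p c where p: "\<And>e. {a. Q a e} = solution_set M p (interleave (case_nat undefined e) c)"
    using dfn_solution_set[OF assms] by blast
  obtain N where N: "\<And>c. \<exists>U D. open U \<and> (\<forall>i<N. discrete (D i)) \<and>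
      solution_set M p c = U \<union> (\<Union>i<N::nat. D i)"
    using d_min unfolding d_minimal_def by meson
  have "(Der ^^ N) {a. Q a e} = {}" if no: "\<forall>a. \<not> inner_pt {a. Q a e} a" for e
  proof -
    obtain U D where U: "open U" "\<forall>i<N. discrete (D i)" "{a. Q a e} = U \<union> (\<Union>i<N::nat. D i)"
      using N[of "interleave (case_nat undefined e) c"] unfolding p by metis
    have "a \<notin> U" for a
    proof
      assume "a \<in> U"
      then have "inner_pt {a. Q a e} a"
        by (rule inner_pt_mono[OF open_inner_pt[OF U(1)]]) (simp add: U(3))
      then show False using no by blast
    qed
    then have sub: "{a. Q a e} \<subseteq> (\<Union>i\<in>{..<N}. D i)" using U(3) by blast
    show ?thesis
    proof (rule Der_finite_union_discrete[OF _ _ _ sub])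
      show "isolated_pt (D i) x" if "i \<in> {..<N}" "x \<in> D i" for i x
        using U(2) that by (intro discrete_isolated_pt) auto
    qed auto
  qed
  then show ?thesis by blast
qed

text \<open>
  This is the form in which d-minimality is used on the line: a definable set without inner points
  in an interval misses a subinterval, so no definable set is dense and codense.
\<close>

lemma dset1_gap:
  assumes "dset1 S" "l < r" "\<And>a. l < a \<Longrightarrow> a < r \<Longrightarrow> \<not> inner_pt S a"
  shows "\<exists>l' r'. l \<le> l' \<and> l' < r' \<and> r' \<le> r \<and> {l'<..<r'} \<inter> S = {}"
proof -
  let ?S = "S \<inter> {l<..<r}"
  have "dfn (\<lambda>e. e 0 \<in> S \<and> l < e 0 \<and> e 0 < r)"
    using assms(1) unfolding dset1_def by (intro dfn_rules)
  from Der_uniform[of "\<lambda>a e. a \<in> S \<and> l < a \<and> a < r", OF this]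
  obtain N where "(\<forall>a. \<not> inner_pt {a. a \<in> S \<and> l < a \<and> a < r} a) \<longrightarrow>
      (Der ^^ N) {a. a \<in> S \<and> l < a \<and> a < r} = {}" by auto
  moreover have "{a. a \<in> S \<and> l < a \<and> a < r} = ?S" by auto
  moreover have "\<not> inner_pt ?S a" for a
  proof
    assume "inner_pt ?S a"
    moreover from this have "a \<in> ?S" unfolding inner_pt_def by auto
    ultimately show False using assms(3)[of a] inner_pt_mono[of ?S a S] by auto
  qed
  ultimately have "(Der ^^ N) ?S = {}" by simp
  from Der_empty_nowhere_dense[OF this assms(2)] obtain l' r' where
    "l \<le> l'" "l' < r'" "r' \<le> r" "{l'<..<r'} \<inter> ?S = {}" by blast
  then show ?thesis by (intro exI[of _ l'] exI[of _ r']) auto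
qed

lemma dset1_interior_or_isolated:
  assumes "dset1 S" "S \<noteq> {}" shows "\<exists>a\<in>S. inner_pt S a \<or> isolated_pt S a"
proof (rule ccontr)
  assume no: "\<not> ?thesis"
  have "dfn (\<lambda>e. e 0 \<in> S)" using assms(1) unfolding dset1_def .
  from Der_uniform[of "\<lambda>a e. a \<in> S", OF this] obtain N where
    "(\<forall>a. \<not> inner_pt S a) \<longrightarrow> (Der ^^ N) S = {}" by auto
  moreover have "\<not> inner_pt S a" for a
  proof
    assume a: "inner_pt S a"
    then have "a \<in> S" unfolding inner_pt_def by auto
    then show False using no a by blast
  qed
  moreover have "Der S = S" using no by (auto simp: Der_def)
  then have "(Der ^^ N) S = S" by (induction N) auto
  ultimately show False using assms(2) by blast
qed

section \<open>The Baire property of intervals\<close>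

text \<open>
  In the application \<open>L x y\<close> means that \<open>y\<close> appears no later than \<open>x\<close> in an increasing family of
  closed discrete sets. Among the points present when \<open>y\<close> appears, let \<open>u\<close> and \<open>v\<close> be the neighbours of
  \<open>y\<close>; the condition says that \<open>v\<close> is newer than \<open>u\<close>.
\<close>

definition right_newer :: "('a \<Rightarrow> 'a \<Rightarrow> bool) \<Rightarrow> 'a \<Rightarrow> 'a \<Rightarrow> 'a \<Rightarrow> bool" where
  "right_newer L l r y \<longleftrightarrow> (\<exists>u v. l < u \<and> u < y \<and> y < v \<and> v < r \<and> L y u \<and> L y v \<and> \<not> L u v \<and>
     (\<forall>w. u < w \<longrightarrow> w < v \<longrightarrow> L y w \<longrightarrow> w = y))"

end

text \<open>
  The assumptions say that \<open>L\<close> is a total preorder on \<open>(l, r)\<close> all of whose initial segments are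
  closed and discrete in \<open>(l, r)\<close>. No such preorder exists on a nonempty interval, see
  \<open>empty_interval\<close>.
\<close>

locale appearance_order = d_minimal_field M
  for M :: "('a::{linordered_field, linorder_topology}, 'f, 'r) expansion" +
  fixes L :: "'a \<Rightarrow> 'a \<Rightarrow> bool" and l r :: 'a
  assumes L_dfn: "dfn (\<lambda>e. L (e 0) (e 1))"
    and total: "\<lbrakk>x \<in> {l<..<r}; y \<in> {l<..<r}\<rbrakk> \<Longrightarrow> L x y \<or> L y x"
    and trans: "\<lbrakk>x \<in> {l<..<r}; y \<in> {l<..<r}; z \<in> {l<..<r}; L x y; L y z\<rbrakk> \<Longrightarrow> L x z"
    and isolated: "\<lbrakk>x \<in> {l<..<r}; y \<in> {l<..<r}; L x y\<rbrakk> \<Longrightarrow>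
      \<exists>s>0. \<forall>z\<in>{l<..<r}. L x z \<longrightarrow> \<bar>z - y\<bar> < s \<longrightarrow> z = y"
    and closed: "\<lbrakk>x \<in> {l<..<r}; y \<in> {l<..<r};
      \<And>s. 0 < s \<Longrightarrow> \<exists>z\<in>{l<..<r}. L x z \<and> \<bar>z - y\<bar> < s\<rbrakk> \<Longrightarrow> L x y"
begin

lemma L_dfn_var: "dfn (\<lambda>e. L (e i) (e j))"
  using dfn_reindex[OF L_dfn, of "\<lambda>k. if k = 0 then i else j"] by simp

text \<open>
  The infimum of the later elements of a closed discrete set is attained.
\<close>

lemma next_element:
  assumes I: "c \<in> {l<..<r}" "x \<in> {l<..<r}" "z \<in> {l<..<r}"
    and xz: "x < z" "L c x" "L c z"
  shows "\<exists>y. x < y \<and> y \<le> z \<and> L c y \<and> (\<forall>w. x < w \<longrightarrow> w < y \<longrightarrow> \<not> L c w)"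
proof -
  define S where "S = {w. x < w \<and> w \<le> z \<and> L c w}"
  have Lc: "dfn (\<lambda>e. L c (e 0))"
    by (rule dfn_subst[of "\<lambda>a e. L a (e 0)" "\<lambda>e. c", OF L_dfn_var dterm_const])
  have "dset1 S" unfolding dset1_def S_def mem_Collect_eq
    by (intro dfn_rules Lc)
  moreover have "S \<noteq> {}" using xz by (auto simp: S_def)
  ultimately obtain y where y: "\<And>u. u \<le> y \<longleftrightarrow> (\<forall>a\<in>S. u \<le> a)"
    using glb_exists[of S x] by (auto simp: S_def)
  have "x \<le> y" using y by (auto simp: S_def)
  have "y \<le> z" using y[of y] xz by (auto simp: S_def)
  have yI: "y \<in> {l<..<r}" using I \<open>x \<le> y\<close> \<open>y \<le> z\<close> by auto
  have near: "\<exists>a\<in>S. a < y + s" if "0 < s" for s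
    using y[of "y + s"] that by (auto simp: not_le)
  have "L c y"
  proof -
    have "\<exists>w\<in>{l<..<r}. L c w \<and> \<bar>w - y\<bar> < s" if s: "0 < s" for s
    proof -
      obtain a where a: "a \<in> S" "a < y + s" using near[OF s] by blast
      moreover have "y \<le> a" using y a by blast
      ultimately show ?thesis using I by (intro bexI[of _ a]) (auto simp: S_def)
    qed
    then show ?thesis by (rule closed[OF I(1) yI])
  qed
  moreover have "x < y"
  proof (rule ccontr)
    assume "\<not> x < y"
    with \<open>x \<le> y\<close> have "x = y" by simp
    obtain s where s: "0 < s" "\<And>w. w \<in> {l<..<r} \<Longrightarrow> L c w \<Longrightarrow> \<bar>w - x\<bar> < s \<Longrightarrow> w = x"
      using isolated[OF I(1,2) xz(2)] by blast
    obtain a where a: "a \<in> S" "a < y + s" using near[OF s(1)] by blast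
    then have "x < a" "a \<in> {l<..<r}" "L c a" "\<bar>a - x\<bar> < s" using \<open>x = y\<close> I by (auto simp: S_def)
    then show False using s(2)[of a] by auto
  qed
  moreover have "\<not> L c w" if "x < w" "w < y" for w
    using y[of y] that \<open>y \<le> z\<close> by (force simp: S_def)
  ultimately show ?thesis using \<open>y \<le> z\<close> by blast
qed

text \<open>
  Fix \<open>x\<close>. All other points near \<open>x\<close> are newer than \<open>x\<close>. Let \<open>y\<close> be the first point to the right of \<open>x\<close>
  that is present when some \<open>z\<close> near \<open>x\<close> appears, and repeat this with some \<open>z'\<close> between \<open>x\<close> and \<open>y\<close> to
  obtain \<open>y'\<close>. When \<open>y'\<close> appears, its left neighbour is \<open>x\<close>, and its right neighbour is at most \<open>y\<close>,
  hence newer than \<open>x\<close>.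
\<close>

lemma right_newer_dense:
  assumes pq: "l \<le> p" "p < q" "q \<le> r"
  shows "\<exists>y. p < y \<and> y < q \<and> right_newer L l r y"
proof -
  let ?I = "{l<..<r}"
  obtain x where x: "p < x" "x < q" using dense[OF pq(2)] by blast
  then have xI: "x \<in> ?I" using pq by auto
  have "L x x" using total xI by blast
  then obtain s where s: "0 < s" "\<And>w. w \<in> ?I \<Longrightarrow> L x w \<Longrightarrow> \<bar>w - x\<bar> < s \<Longrightarrow> w = x"
    using isolated[OF xI xI] by blast
  obtain z where z: "x < z" "z < min q (x + s)"
    using dense[of x "min q (x + s)"] x s(1) by auto
  have later: "w \<in> ?I" "\<not> L x w" "L w x" if "x < w" "w \<le> z" for w
  proof -
    show wI: "w \<in> ?I" using that z x pq by auto
    show n: "\<not> L x w" using s(2)[OF wI] that z by auto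
    show "L w x" using total[OF wI xI] n by blast
  qed
  have zI: "z \<in> ?I" using later z by auto
  obtain y where y: "x < y" "y \<le> z" "L z y" "\<And>w. x < w \<Longrightarrow> w < y \<Longrightarrow> \<not> L z w"
    using next_element[OF zI xI zI z(1)] later[of z] z total[OF zI zI] by blast
  note yI = later(1)[OF y(1,2)]
  obtain z' where z': "x < z'" "z' < y" using dense[OF y(1)] by blast
  have z'I: "z' \<in> ?I" using later z' y by auto
  obtain y' where y': "x < y'" "y' \<le> z'" "L z' y'" "\<And>w. x < w \<Longrightarrow> w < y' \<Longrightarrow> \<not> L z' w"
    using next_element[OF z'I xI z'I z'(1)] later[of z'] z' y total[OF z'I z'I] by fastforce
  have y'I: "y' \<in> ?I" using later y' z' y by auto
  have "\<not> L y y'" using trans[OF zI yI y'I y(3)] y(4)[of y'] y' z' by auto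
  then have "L y' y" using total[OF yI y'I] by blast
  obtain v where v: "y' < v" "v \<le> y" "L y' v" "\<And>w. y' < w \<Longrightarrow> w < v \<Longrightarrow> \<not> L y' w"
    using next_element[OF y'I y'I yI _ _ \<open>L y' y\<close>] total[OF y'I y'I] y' z' by auto
  have "\<not> L y' w" if "x < w" "w < y'" for w
  proof
    assume "L y' w"
    moreover have "w \<in> ?I" using that later y' z' y by auto
    ultimately show False using trans[OF z'I y'I _ y'(3)] y'(4)[OF that] by blast
  qed
  then have "right_newer L l r y'" unfolding right_newer_def
    using xI yI y'(1) v later[of y'] later[of v] y' z' y by (intro exI[of _ x] exI[of _ v]) (auto, metis linorder_neqE)
  then show ?thesis using x y' z' y z by (intro exI[of _ y']) auto
qed

lemma reflected: "appearance_order M (reflect L) (- r) (- l)"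
proof (intro appearance_order.intro appearance_order_axioms.intro d_minimal_field_axioms)
  let ?I = "{- r<..<- l}"
  have I: "- x \<in> {l<..<r}" if "x \<in> ?I" for x using that by auto
  have ab: "\<bar>- x - y\<bar> = \<bar>x - - y\<bar>" for x y :: 'a by (simp add: abs_if)
  show "dfn (\<lambda>e. reflect L (e 0) (e 1))" unfolding reflect_def
    by (rule dfn_subst2[where Q = "\<lambda>a b e. L a b"]) (intro L_dfn dterm_uminus dterm_var)+
  fix x y assume xy: "x \<in> ?I" "y \<in> ?I"
  show "reflect L x y \<or> reflect L y x"
    unfolding reflect_def by (rule total[OF I[OF xy(1)] I[OF xy(2)]])
  show "reflect L x z" if "z \<in> ?I" "reflect L x y" "reflect L y z" for z
    using trans[OF I[OF xy(1)] I[OF xy(2)] I[OF that(1)]] that(2,3) unfolding reflect_def by blast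
  show "\<exists>s>0. \<forall>z\<in>?I. reflect L x z \<longrightarrow> \<bar>z - y\<bar> < s \<longrightarrow> z = y" if L: "reflect L x y"
  proof -
    obtain s where s: "0 < s" "\<And>z. z \<in> {l<..<r} \<Longrightarrow> L (- x) z \<Longrightarrow> \<bar>z - - y\<bar> < s \<Longrightarrow> z = - y"
      using isolated[OF I[OF xy(1)] I[OF xy(2)]] L unfolding reflect_def by blast
    have "z = y" if "z \<in> ?I" "reflect L x z" "\<bar>z - y\<bar> < s" for z
      using s(2)[OF I[OF that(1)]] that(2,3) unfolding reflect_def ab by simp
    then show ?thesis using s(1) by blast
  qed
  show "reflect L x y" if lim: "\<And>s. 0 < s \<Longrightarrow> \<exists>z\<in>?I. reflect L x z \<and> \<bar>z - y\<bar> < s"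
    unfolding reflect_def
  proof (rule closed[OF I[OF xy(1)] I[OF xy(2)]])
    fix s :: 'a assume "0 < s"
    then obtain z where z: "z \<in> ?I" "reflect L x z" "\<bar>z - y\<bar> < s" using lim by blast
    then show "\<exists>z\<in>{l<..<r}. L (- x) z \<and> \<bar>z - - y\<bar> < s"
      using I[OF z(1)] unfolding reflect_def by (intro bexI[of _ "- z"]) (auto simp: ab)
  qed
qed

text \<open>
  The points whose right neighbour is the newer one are dense; by reflection so are those whose left
  neighbour is the newer one. The two sets are disjoint since neighbours are unique and \<open>L\<close> is total.
  Thus a definable set would be dense and codense.
\<close>

lemma empty_interval: "\<not> l < r"
proof
  assume lr: "l < r"
  have X: "dset1 {y. right_newer L l r y}"
    unfolding dset1_def right_newer_def mem_Collect_eq by (intro dfn_rules L_dfn_var)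
  have disj: "\<not> right_newer (reflect L) (- r) (- l) (- y)" if newer: "right_newer L l r y" for y
  proof
    assume "right_newer (reflect L) (- r) (- l) (- y)"
    then obtain u' v' where "- r < u'" "u' < - y" "- y < v'" "v' < - l" "L y (- u')" "L y (- v')"
      "\<not> L (- u') (- v')" "\<And>w. u' < w \<Longrightarrow> w < v' \<Longrightarrow> L y (- w) \<Longrightarrow> w = - y"
      unfolding right_newer_def reflect_def by auto
    then obtain u1 v1 where 1: "l < u1" "u1 < y" "y < v1" "v1 < r" "L y u1" "L y v1" "\<not> L v1 u1"
      "\<And>w. u1 < w \<Longrightarrow> w < v1 \<Longrightarrow> L y w \<Longrightarrow> w = y"
      by (smt (verit, del_insts) minus_minus minus_less_iff less_minus_iff)
    obtain u v where 2: "l < u" "u < y" "y < v" "v < r" "L y u" "L y v" "\<not> L u v"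
      "\<And>w. u < w \<Longrightarrow> w < v \<Longrightarrow> L y w \<Longrightarrow> w = y"
      using newer unfolding right_newer_def by blast
    have "u = u1"
    proof (rule linorder_cases[of u u1])
      assume "u < u1" then show ?thesis using 2(8)[of u1] 1 2(3) by auto
    next
      assume "u1 < u" then show ?thesis using 1(8)[of u] 2 1(3) by auto
    qed
    moreover have "v = v1"
    proof (rule linorder_cases[of v v1])
      assume "v < v1" then show ?thesis using 1(8)[of v] 2 1(2) by auto
    next
      assume "v1 < v" then show ?thesis using 2(8)[of v1] 1 2(2) by auto
    qed
    ultimately show False using total[of u v] 1 2 by auto
  qed
  have dense2: "\<exists>y. p < y \<and> y < q \<and> right_newer (reflect L) (- r) (- l) (- y)"
    if pq: "l \<le> p" "p < q" "q \<le> r" for p q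
  proof -
    obtain y where "- q < y" "y < - p" "right_newer (reflect L) (- r) (- l) y"
      using appearance_order.right_newer_dense[OF reflected, of "- q" "- p"] pq by auto
    then show ?thesis by (intro exI[of _ "- y"]) (auto simp: minus_less_iff less_minus_iff)
  qed
  show False
  proof (cases "\<exists>a. l < a \<and> a < r \<and> inner_pt {y. right_newer L l r y} a")
    case True
    then obtain a where a: "l < a" "a < r" "inner_pt {y. right_newer L l r y} a" by blast
    then obtain s where s: "0 < s" "\<And>b. \<bar>b - a\<bar> < s \<Longrightarrow> right_newer L l r b"
      unfolding inner_pt_def by auto
    obtain y where "a < y" "y < min r (a + s)" "right_newer (reflect L) (- r) (- l) (- y)"
      using dense2[of a "min r (a + s)"] a s(1) by auto
    then show False using disj s(2)[of y] by auto
  next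
    case False
    then obtain l' r' where "l \<le> l'" "l' < r'" "r' \<le> r" "{l'<..<r'} \<inter> {y. right_newer L l r y} = {}"
      using dset1_gap[OF X lr] by blast
    then show False using right_newer_dense[of l' r'] by auto
  qed
qed

end

context d_minimal_field
begin

text \<open>
  Assume that no member has an inner point. The closures \<open>K t\<close> then have none either, so their \<open>N\<close>-th
  derivatives vanish for a common \<open>N\<close>. Take the last \<open>k\<close> for which the union of the \<open>k\<close>-th derivatives
  \<open>D k t\<close> still contains an interval, and inside it an interval that misses all the next derivatives.
  There the sets \<open>D k t\<close> are closed and discrete and increase to the whole interval, so their order of
  appearance contradicts \<open>empty_interval\<close>.
\<close>

lemma interval_baire:
  assumes A: "dfn (\<lambda>e. e 1 \<in> A (e 0))" and mono: "\<And>t u. t \<le> u \<Longrightarrow> A t \<subseteq> A u"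
    and lr: "l < r" and cover: "\<And>a. l < a \<Longrightarrow> a < r \<Longrightarrow> \<exists>t. a \<in> A t"
  shows "\<exists>t a. l < a \<and> a < r \<and> inner_pt (A t) a"
proof (rule ccontr)
  assume no: "\<not> ?thesis"
  let ?I = "{l<..<r}"
  define K where "K = (\<lambda>t. {y. l < y \<and> y < r \<and> (\<forall>s. 0 < s \<longrightarrow> (\<exists>z. z \<in> A t \<and> \<bar>z - y\<bar> < s))})"
  define D where "D = (\<lambda>k t. (Der ^^ k) (K t))"
  have Ad: "dfn (\<lambda>e. e i \<in> A (e j))" for i j
    using dfn_reindex[OF A, of "\<lambda>k. if k = 0 then j else i"] by simp
  have Kd: "dfn (\<lambda>e. e i \<in> K (e j))" for i j
    unfolding K_def mem_Collect_eq by (intro dfn_rules Ad)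
  have Dd: "dfn (\<lambda>e. e i \<in> D k (e j))" for i j k
  proof (induction k arbitrary: i j)
    case 0
    then show ?case using Kd by (simp add: D_def)
  next
    case (Suc k)
    have "D (Suc k) t = {a. a \<in> D k t \<and> \<not> (a \<in> D k t \<and>
        (\<exists>s. 0 < s \<and> (\<forall>b. b \<in> D k t \<longrightarrow> \<bar>b - a\<bar> < s \<longrightarrow> b = a)))}" for t
      by (auto simp: D_def Der_def isolated_pt_def)
    then show ?case by (simp only: mem_Collect_eq) (intro dfn_rules Suc)
  qed
  have KI: "K t \<subseteq> ?I" for t by (auto simp: K_def)
  have AK: "a \<in> K t" if "a \<in> A t" "l < a" "a < r" for a t
    using that by (auto simp: K_def intro!: exI[of _ a])
  have "K t \<subseteq> K u" if "t \<le> u" for t u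
    using mono[OF that] by (auto simp: K_def) blast
  then have Dmono: "D k t \<subseteq> D k u" if "t \<le> u" for k t u
    unfolding D_def using that by (intro Der_funpow_mono)
  have Dclosed: "y \<in> D k t" if "l < y" "y < r" "\<And>s. 0 < s \<Longrightarrow> \<exists>z. z \<in> D k t \<and> \<bar>z - y\<bar> < s" for y k t
    using that(3)
  proof (induction k)
    case 0
    show ?case unfolding D_def funpow_0 K_def mem_Collect_eq
    proof (intro conjI allI impI that(1,2))
      fix s :: 'a assume "0 < s"
      then obtain z where z: "z \<in> K t" "\<bar>z - y\<bar> < s / 2" using 0[of "s / 2"] by (auto simp: D_def)
      then obtain w where "w \<in> A t" "\<bar>w - z\<bar> < s / 2"
        using \<open>0 < s\<close> unfolding K_def by (auto dest!: spec[of _ "s / 2"])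
      then show "\<exists>z. z \<in> A t \<and> \<bar>z - y\<bar> < s" using z(2)
        by (intro exI[of _ w]) (auto simp: abs_if field_simps split: if_splits)
    qed
  next
    case (Suc k)
    have sub: "D (Suc k) t \<subseteq> D k t" by (auto simp: D_def Der_def)
    then have y: "y \<in> D k t" using Suc by blast
    have "\<not> isolated_pt (D k t) y"
    proof
      assume "isolated_pt (D k t) y"
      then obtain s where s: "0 < s" "\<And>b. b \<in> D k t \<Longrightarrow> \<bar>b - y\<bar> < s \<Longrightarrow> b = y"
        unfolding isolated_pt_def by blast
      then obtain z where "z \<in> D (Suc k) t" "\<bar>z - y\<bar> < s" using Suc.prems by blast
      then have "y \<in> D (Suc k) t" using s(2) sub by blast
      then show False using \<open>isolated_pt (D k t) y\<close> by (simp add: D_def Der_def)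
    qed
    then show ?case using y by (simp add: D_def Der_def)
  qed
  have noK: "\<not> inner_pt (K t) a" for t a
  proof
    assume a: "inner_pt (K t) a"
    then have "a \<in> ?I" using KI unfolding inner_pt_def by force
    obtain s where s: "0 < s" "\<And>b. \<bar>b - a\<bar> < s \<Longrightarrow> b \<in> K t" using a unfolding inner_pt_def by auto
    have "dset1 (A t)" unfolding dset1_def
      using dfn_subst[of "\<lambda>a e. e 0 \<in> A a" "\<lambda>e. t"] Ad[of 1 0] dterm_const by simp
    moreover have "a < min r (a + s)" using s \<open>a \<in> ?I\<close> by auto
    moreover have "\<not> inner_pt (A t) b" if "a < b" "b < min r (a + s)" for b
      using no that \<open>a \<in> ?I\<close> by auto
    ultimately obtain l' r' where g: "a \<le> l'" "l' < r'" "r' \<le> min r (a + s)" "{l'<..<r'} \<inter> A t = {}"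
      using dset1_gap[of "A t" a "min r (a + s)"] by blast
    obtain m where m: "l' < m" "m < r'" using dense[OF g(2)] by blast
    then have "m \<in> K t" using s(2)[of m] g by auto
    obtain w where w: "0 < w" "\<And>b. \<bar>b - m\<bar> < w \<Longrightarrow> b \<in> {l'<..<r'}"
      using inner_pt_interval[OF m] unfolding inner_pt_def by auto
    then show False using \<open>m \<in> K t\<close> g(4) unfolding K_def by blast
  qed
  have "\<exists>N. \<forall>t. D N t = {}"
  proof -
    have "dfn (\<lambda>e. e 0 \<in> K (e (Suc 0)))" by (rule Kd)
    from Der_uniform[of "\<lambda>a e. a \<in> K (e 0)", OF this] obtain N where
      "\<And>e. (\<forall>a. \<not> inner_pt {a. a \<in> K (e 0)} a) \<longrightarrow> (Der ^^ N) {a. a \<in> K (e (0::nat))} = {}" by blast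
    from this[of "\<lambda>_. _"] show ?thesis using noK unfolding D_def by auto
  qed
  then obtain N where N: "\<And>t. D N t = {}" by blast
  define W where "W = (\<lambda>k. \<Union>t. D k t)"
  have Wd: "dset1 (W k)" for k
  proof -
    have "dfn (\<lambda>e. \<exists>t. e 0 \<in> D k t)" by (intro dfn_ex Dd)
    then show ?thesis unfolding dset1_def W_def by simp
  qed
  define G where "G = (\<lambda>k. \<exists>l' r'. l \<le> l' \<and> l' < r' \<and> r' \<le> r \<and> {l'<..<r'} \<subseteq> W k)"
  have "G 0"
  proof -
    have "?I \<subseteq> W 0" using cover AK by (force simp: W_def D_def)
    then show ?thesis using lr unfolding G_def by blast
  qed
  moreover have "\<not> G N"
  proof
    assume "G N"
    then obtain l' r' where "l' < r'" "{l'<..<r'} \<subseteq> W N" unfolding G_def by blast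
    moreover have "W N = {}" using N by (simp add: W_def)
    ultimately show False using dense[of l' r'] by auto
  qed
  ultimately obtain k where k: "G k" "\<not> G (Suc k)"
    by (metis nat_induct)
  then obtain l1 r1 where 1: "l \<le> l1" "l1 < r1" "r1 \<le> r" "{l1<..<r1} \<subseteq> W k" unfolding G_def by blast
  have "\<not> inner_pt (W (Suc k)) a" if "l1 < a" "a < r1" for a
  proof
    assume "inner_pt (W (Suc k)) a"
    then obtain s where s: "0 < s" "\<And>b. \<bar>b - a\<bar> < s \<Longrightarrow> b \<in> W (Suc k)" unfolding inner_pt_def by auto
    have "{a<..<min r1 (a + s)} \<subseteq> W (Suc k)" using s by auto
    then have "G (Suc k)" unfolding G_def
      using 1 that s(1) by (intro exI[of _ a] exI[of _ "min r1 (a + s)"]) auto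
    then show False using k by blast
  qed
  then obtain l2 r2 where 2: "l1 \<le> l2" "l2 < r2" "r2 \<le> r1" "{l2<..<r2} \<inter> W (Suc k) = {}"
    using dset1_gap[OF Wd 1(2)] by blast
  define L where "L = (\<lambda>x y. \<forall>t. x \<in> D k t \<longrightarrow> y \<in> D k t)"
  have "appearance_order M L l2 r2"
  proof (intro appearance_order.intro appearance_order_axioms.intro d_minimal_field_axioms)
    show "dfn (\<lambda>e. L (e 0) (e 1))" unfolding L_def by (intro dfn_rules Dd)
    show "L x y \<or> L y x" for x y
      unfolding L_def using Dmono by (meson linear subsetD)
    show "L x z" if "L x y" "L y z" for x y z using that unfolding L_def by blast
    show "\<exists>s>0. \<forall>z\<in>{l2<..<r2}. L x z \<longrightarrow> \<bar>z - y\<bar> < s \<longrightarrow> z = y"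
      if xy: "x \<in> {l2<..<r2}" "y \<in> {l2<..<r2}" "L x y" for x y
    proof -
      have "x \<in> W k" using xy(1) 1 2 by auto
      then obtain t where t: "x \<in> D k t" by (auto simp: W_def)
      then have "y \<in> D k t" using xy by (auto simp: L_def)
      moreover have "y \<notin> W (Suc k)" using 2(4) xy(2) by blast
      then have "y \<notin> D (Suc k) t" by (auto simp: W_def)
      ultimately have "isolated_pt (D k t) y" by (auto simp: D_def Der_def)
      then obtain s where "0 < s" "\<And>b. b \<in> D k t \<Longrightarrow> \<bar>b - y\<bar> < s \<Longrightarrow> b = y"
        unfolding isolated_pt_def by blast
      then show ?thesis using t by (intro exI[of _ s]) (auto simp: L_def)
    qed
    show "L x y" if xy: "x \<in> {l2<..<r2}" "y \<in> {l2<..<r2}"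
      and lim: "\<And>s. 0 < s \<Longrightarrow> \<exists>z\<in>{l2<..<r2}. L x z \<and> \<bar>z - y\<bar> < s" for x y
      unfolding L_def
    proof (intro allI impI Dclosed)
      fix t s assume "x \<in> D k t" and "(0::'a) < s"
      then show "\<exists>z. z \<in> D k t \<and> \<bar>z - y\<bar> < s" using lim[of s] unfolding L_def by blast
    qed (use xy 1 2 in auto)
  qed
  from appearance_order.empty_interval[OF this] show False using 2(2) by blast
qed

end

section \<open>The covering principle\<close>

lemma dst_nonneg [simp]: "0 \<le> dst n x y"
  unfolding dst_def by (intro sum_nonneg) auto

lemma dst_self [simp]: "dst n x x = 0"
  by (simp add: dst_def)

lemma dst_commute: "dst n x y = dst n y x"
  by (simp add: dst_def abs_minus_commute)

lemma dst_triangle: "dst n x z \<le> dst n x y + dst n y z"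
proof -
  have "dst n x z \<le> (\<Sum>i<n. \<bar>x i - y i\<bar> + \<bar>y i - z i\<bar>)"
    unfolding dst_def by (intro sum_mono) (auto simp: abs_if)
  then show ?thesis by (simp add: dst_def sum.distrib)
qed

lemma dst_Suc: "dst (Suc n) x y = dst n x y + \<bar>x n - y n\<bar>"
  by (simp add: dst_def)

lemma dst_upd [simp]: "dst n (x(n := a)) y = dst n x y" "dst n x (y(n := a)) = dst n x y"
  by (simp_all add: dst_def)

lemma dst_coord: "i < n \<Longrightarrow> \<bar>x i - y i\<bar> \<le> dst n x y"
  unfolding dst_def by (rule member_le_sum) auto

definition proj :: "nat \<Rightarrow> (nat \<Rightarrow> 'a) set \<Rightarrow> (nat \<Rightarrow> 'a) set" where
  "proj n A = {x \<in> Fn n. \<exists>a. x(n := a) \<in> A}"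

text \<open>
  Two kinds of covers share one induction: increasing families, and covers by the two sets \<open>B 0\<close> and
  \<open>B 1\<close>, indexed by \<open>F\<close> like the others.
\<close>

definition admissible_cover :: "('a::linordered_field \<Rightarrow> 'b set) \<Rightarrow> bool" where
  "admissible_cover B \<longleftrightarrow> (\<forall>t u. t \<le> u \<longrightarrow> B t \<subseteq> B u) \<or> (\<forall>t. t \<noteq> 0 \<longrightarrow> t \<noteq> 1 \<longrightarrow> B t = {})"

lemma admissible_cover_image:
  assumes "admissible_cover B" "\<And>t. C t = f (B t)" "\<And>S S'. S \<subseteq> S' \<Longrightarrow> f S \<subseteq> f S'" "f {} = {}"
  shows "admissible_cover C"
  using assms(1) unfolding admissible_cover_def assms(2)
proof (elim disjE)
  assume "\<forall>t u. t \<le> u \<longrightarrow> B t \<subseteq> B u"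
  then show "(\<forall>t u. t \<le> u \<longrightarrow> f (B t) \<subseteq> f (B u)) \<or> (\<forall>t. t \<noteq> 0 \<longrightarrow> t \<noteq> 1 \<longrightarrow> f (B t) = {})"
    using assms(3) by blast
next
  assume "\<forall>t. t \<noteq> 0 \<longrightarrow> t \<noteq> 1 \<longrightarrow> B t = {}"
  then show "(\<forall>t u. t \<le> u \<longrightarrow> f (B t) \<subseteq> f (B u)) \<or> (\<forall>t. t \<noteq> 0 \<longrightarrow> t \<noteq> 1 \<longrightarrow> f (B t) = {})"
    using assms(4) by simp
qed

text \<open>
  The infimum as a total function whose defining property is a formula: where no infimum exists, the
  value is \<open>0\<close>.
\<close>

definition isglb :: "'a::linorder set \<Rightarrow> 'a \<Rightarrow> bool" where
  "isglb S g \<longleftrightarrow> (\<forall>u. u \<le> g \<longleftrightarrow> (\<forall>a. a \<in> S \<longrightarrow> u \<le> a))"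

definition glb :: "'a::linordered_field set \<Rightarrow> 'a" where
  "glb S = (if \<exists>g. isglb S g then THE g. isglb S g else 0)"

lemma isglb_unique: assumes "isglb S g" "isglb S h" shows "g = h"
proof (rule antisym)
  have "u \<le> g \<longleftrightarrow> u \<le> h" for u using assms unfolding isglb_def by blast
  then show "g \<le> h" "h \<le> g" by blast+
qed

lemma glb_isglb: assumes "isglb S g" shows "glb S = g"
proof -
  have "(THE g. isglb S g) = g" using assms isglb_unique by blast
  then show ?thesis using assms unfolding glb_def by auto
qed

lemma glb_char: "a = glb S \<longleftrightarrow> isglb S a \<or> (\<not> (\<exists>g. isglb S g) \<and> a = 0)"
  using glb_isglb[of S] by (metis glb_def)

context d_minimal_field
begin

definition drel2 :: "nat \<Rightarrow> ((nat \<Rightarrow> 'a) \<Rightarrow> 'a \<Rightarrow> 'a \<Rightarrow> bool) \<Rightarrow> bool" where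
  "drel2 n R \<longleftrightarrow> (\<forall>X t u. dvec n X \<longrightarrow> dterm t \<longrightarrow> dterm u \<longrightarrow> dfn (\<lambda>e. R (X e) (t e) (u e)))"

lemma dfn_rel2: "drel2 n R \<Longrightarrow> dvec n X \<Longrightarrow> dterm t \<Longrightarrow> dterm u \<Longrightarrow> dfn (\<lambda>e. R (X e) (t e) (u e))"
  unfolding drel2_def by blast

lemma drel2I:
  assumes "dfn (\<lambda>e. R (\<lambda>i\<in>{..<n}. e (Suc (Suc i))) (e 1) (e 0))" shows "drel2 n R"
  unfolding drel2_def
proof (intro allI impI)
  fix X t u assume X: "dvec n X" "dterm t" "dterm u"
  have "dfn (\<lambda>e. R (\<lambda>i\<in>{..<n}. e i) (e (n + 1)) (e (n + 0)))"
    using dfn_reindex[OF assms, of "\<lambda>i. if i = 0 then n + 0 else if i = 1 then n + 1 else i - 2"]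
    by simp
  then have "dfn (\<lambda>e. R (X (\<lambda>i. e (Suc (Suc i)))) (e 1) (e 0))"
    by (rule dfn_subst_vec[where Q = "\<lambda>x e. R x (e 1) (e 0)",
          OF dvec_reindex[OF X(1), of "\<lambda>i. Suc (Suc i)"], rotated])
  then show "dfn (\<lambda>e. R (X e) (t e) (u e))"
    by (rule dfn_subst2[where Q = "\<lambda>b a e. R (X e) a b" and t = u and u = t, OF _ X(3,2)])
qed

lemma dset1_rel: "drel n Q \<Longrightarrow> x \<in> Fn n \<Longrightarrow> dset1 {a. Q x a}"
  unfolding dset1_def mem_Collect_eq by (intro dfn_rel[of n] dvec_const dterm_var)

lemma dset1_fiber: "dset (Suc n) A \<Longrightarrow> x \<in> Fn n \<Longrightarrow> dset1 {a. x(n := a) \<in> A}"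
  unfolding dset1_def mem_Collect_eq by (intro dfn_set[of "Suc n"] dvec_upd dvec_const dterm_var)

lemma drel_fiber: "dset (Suc n) A \<Longrightarrow> drel n (\<lambda>x a. x(n := a) \<in> A)"
  by (intro drelI dfn_set[of "Suc n"] dvec_upd dvec_var dterm_var)

lemma dset_proj: "dset (Suc n) A \<Longrightarrow> dset n (proj n A)"
  unfolding proj_def by (intro dsetI dfn_ex dfn_set[of "Suc n"] dvec_upd dvec_var dterm_var)

lemma dfun_glb:
  assumes "drel n Q" shows "dfun n (\<lambda>x. glb {a. Q x a})"
proof (rule dfunI, rule dterm_unique)
  let ?x = "\<lambda>e. \<lambda>i\<in>{..<n}. e i"
  show "a = glb {a. Q (?x e) a} \<longleftrightarrow> (\<forall>u. u \<le> a \<longleftrightarrow> (\<forall>b. Q (?x e) b \<longrightarrow> u \<le> b)) \<or>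
      (\<not> (\<exists>g. \<forall>u. u \<le> g \<longleftrightarrow> (\<forall>b. Q (?x e) b \<longrightarrow> u \<le> b)) \<and> a = 0)" for e a
    unfolding glb_char isglb_def mem_Collect_eq ..
  show "dfn (\<lambda>e. (\<forall>u. u \<le> e 0 \<longleftrightarrow> (\<forall>b. Q (\<lambda>i\<in>{..<n}. e (Suc i)) b \<longrightarrow> u \<le> b)) \<or>
      (\<not> (\<exists>g. \<forall>u. u \<le> g \<longleftrightarrow> (\<forall>b. Q (\<lambda>i\<in>{..<n}. e (Suc i)) b \<longrightarrow> u \<le> b)) \<and> e 0 = 0))"
    by (intro dfn_rules dfn_rel[OF assms])
qed

lemma isglb_exists:
  assumes "dset1 S" "S \<noteq> {}" "\<And>a. a \<in> S \<Longrightarrow> b \<le> a" shows "isglb S (glb S)"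
proof -
  obtain g where "isglb S g" using glb_exists[OF assms] unfolding isglb_def by blast
  then show ?thesis using glb_isglb by metis
qed

lemma interval_covering:
  assumes B: "dfn (\<lambda>e. e 1 \<in> B (e 0))" and adm: "admissible_cover B"
    and lr: "l < r" and cover: "\<And>a. l < a \<Longrightarrow> a < r \<Longrightarrow> \<exists>t. a \<in> B t"
  shows "\<exists>t a. l < a \<and> a < r \<and> inner_pt (B t) a"
  using adm unfolding admissible_cover_def
proof (elim disjE)
  assume "\<forall>t u. t \<le> u \<longrightarrow> B t \<subseteq> B u"
  then show ?thesis using interval_baire[OF B _ lr cover] by blast
next
  assume two: "\<forall>t. t \<noteq> 0 \<longrightarrow> t \<noteq> 1 \<longrightarrow> B t = {}"
  show ?thesis
  proof (rule ccontr)
    assume no: "\<not> ?thesis"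
    have "dfn (\<lambda>e. e (Suc 0) \<in> B (e 0))" using B by simp
    from dfn_subst[of "\<lambda>b e. e 0 \<in> B b" "\<lambda>e. 0", OF this dterm_const]
    have "dset1 (B 0)" unfolding dset1_def .
    then obtain l' r' where g: "l \<le> l'" "l' < r'" "r' \<le> r" "{l'<..<r'} \<inter> B 0 = {}"
      using dset1_gap[OF _ lr] no by blast
    obtain m where m: "l' < m" "m < r'" using dense[OF g(2)] by blast
    have "{l'<..<r'} \<subseteq> B 1"
    proof
      fix a assume a: "a \<in> {l'<..<r'}"
      then obtain t where t: "a \<in> B t" using cover[of a] g by auto
      then have "t = 1" using two a g(4) by (cases "t = 0") auto
      then show "a \<in> B 1" using t by simp
    qed
    then have "inner_pt (B 1) m" by (rule inner_pt_mono[OF inner_pt_interval[OF m]])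
    moreover have "l < m" "m < r" using m g by auto
    ultimately show False using no by blast
  qed
qed

definition open_part :: "nat \<Rightarrow> (nat \<Rightarrow> 'a) set \<Rightarrow> (nat \<Rightarrow> 'a) set \<Rightarrow> bool" where
  "open_part n P V \<longleftrightarrow> dset n V \<and> V \<noteq> {} \<and> V \<subseteq> P \<and>
     (\<forall>x\<in>V. \<exists>s>0. \<forall>y\<in>P. dst n x y < s \<longrightarrow> y \<in> V)"

lemma open_partD:
  assumes "open_part n P V"
  shows "dset n V" "V \<noteq> {}" "V \<subseteq> P" "\<And>x. x \<in> V \<Longrightarrow> \<exists>s>0. \<forall>y\<in>P. dst n x y < s \<longrightarrow> y \<in> V"
  using assms unfolding open_part_def by blast+

lemma open_part_trans:
  assumes V: "open_part n P V" and W: "open_part n V W" shows "open_part n P W"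
  unfolding open_part_def
proof (intro conjI ballI open_partD(1,2)[OF W])
  show "W \<subseteq> P" using open_partD(3)[OF V] open_partD(3)[OF W] by blast
  fix x assume x: "x \<in> W"
  then have "x \<in> V" using open_partD(3)[OF W] by blast
  obtain s where s: "0 < s" "\<forall>y\<in>V. dst n x y < s \<longrightarrow> y \<in> W" using open_partD(4)[OF W x] by blast
  obtain t where t: "0 < t" "\<forall>y\<in>P. dst n x y < t \<longrightarrow> y \<in> V" using open_partD(4)[OF V \<open>x \<in> V\<close>] by blast
  show "\<exists>s>0. \<forall>y\<in>P. dst n x y < s \<longrightarrow> y \<in> W" by (rule exI[of _ "min s t"]) (use s t in auto)
qed

lemma open_part_ball:
  assumes P: "dset n P" and x: "x \<in> P" "0 < d" shows "open_part n P {y\<in>P. dst n x y < d}"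
  unfolding open_part_def
proof (intro conjI ballI)
  show "dset n {y\<in>P. dst n x y < d}"
    by (intro dset_Collect[OF P] dfn_rules dvec_const dset_subset[OF P x(1)])
  show "{y\<in>P. dst n x y < d} \<noteq> {}" using x by auto
  fix y assume y: "y \<in> {y\<in>P. dst n x y < d}"
  have "dst n x z < d" if "dst n y z < d - dst n x y" for z
    using dst_triangle[of n x z y] that by linarith
  then show "\<exists>s>0. \<forall>z\<in>P. dst n y z < s \<longrightarrow> z \<in> {y\<in>P. dst n x y < d}"
    using y by (intro exI[of _ "d - dst n x y"]) auto
qed auto

lemma open_part_self: "dset n P \<Longrightarrow> P \<noteq> {} \<Longrightarrow> open_part n P P"
  unfolding open_part_def by (auto intro: exI[of _ 1])

text \<open>
  The witness consists of the points of \<open>A\<close> that lie over \<open>V\<close> and have last coordinate within \<open>s\<close> of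
  \<open>a0\<close>.
\<close>

lemma open_part_cylinder:
  assumes A: "dset (Suc n) A" and V: "open_part n (proj n A) V"
    and ne: "x1 \<in> V" "\<bar>a1 - a0\<bar> < s" "x1(n := a1) \<in> A"
    and B: "\<And>x a. x \<in> V \<Longrightarrow> \<bar>a - a0\<bar> < s \<Longrightarrow> x(n := a) \<in> A \<Longrightarrow> x(n := a) \<in> B"
  shows "\<exists>W. open_part (Suc n) A W \<and> W \<subseteq> B"
proof (intro exI conjI)
  let ?W = "{z\<in>A. \<exists>x\<in>V. \<exists>a. \<bar>a - a0\<bar> < s \<and> z = x(n := a)}"
  show "?W \<subseteq> B" using B by auto
  show "open_part (Suc n) A ?W" unfolding open_part_def
  proof (intro conjI ballI)
    show "dset (Suc n) ?W"
      by (intro dset_Collect[OF A] dfn_ex_set[OF open_partD(1)[OF V]] dfn_rules dfn_eq_vec[of "Suc n"])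
    show "?W \<noteq> {}" using ne by blast
    fix z assume "z \<in> ?W"
    then obtain x a where z: "x \<in> V" "\<bar>a - a0\<bar> < s" "z = x(n := a)" by auto
    obtain d where d: "0 < d" "\<And>y. y \<in> proj n A \<Longrightarrow> dst n x y < d \<Longrightarrow> y \<in> V"
      using open_partD(4)[OF V z(1)] by blast
    have "y \<in> ?W" if y: "y \<in> A" "dst (Suc n) z y < min d (s - \<bar>a - a0\<bar>)" for y
    proof -
      have "y \<in> Fn (Suc n)" by (rule dset_subset[OF A y(1)])
      then obtain x' a' where xa: "x' \<in> Fn n" "y = x'(n := a')" by (rule Fn_Suc_cases)
      then have "x' \<in> proj n A" using y(1) by (auto simp: proj_def)
      have "dst n x x' + \<bar>a - a'\<bar> < min d (s - \<bar>a - a0\<bar>)"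
        using y(2) by (simp add: xa(2) z(3) dst_Suc)
      moreover have "0 \<le> dst n x x'" by simp
      ultimately have "dst n x x' < d" "\<bar>a - a'\<bar> < s - \<bar>a - a0\<bar>" by linarith+
      then have "x' \<in> V" "\<bar>a' - a0\<bar> < s"
        using d(2) \<open>x' \<in> proj n A\<close> by (auto simp: abs_if split: if_splits)
      then show ?thesis using y(1) xa(2) by blast
    qed
    then show "\<exists>t>0. \<forall>y\<in>A. dst (Suc n) z y < t \<longrightarrow> y \<in> ?W"
      using d(1) z(2) by (intro exI[of _ "min d (s - \<bar>a - a0\<bar>)"]) auto
  qed auto
qed

definition covering :: "nat \<Rightarrow> bool" where
  "covering n \<longleftrightarrow> (\<forall>P B. dset n P \<longrightarrow> P \<noteq> {} \<longrightarrow> drel n (\<lambda>x t. x \<in> B t) \<longrightarrow>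
     admissible_cover B \<longrightarrow> (\<forall>x\<in>P. \<exists>t. x \<in> B t) \<longrightarrow> (\<exists>t V. open_part n P V \<and> V \<subseteq> B t))"

lemma coveringD:
  assumes "covering n" "dset n P" "P \<noteq> {}" "drel n (\<lambda>x t. x \<in> B t)" "admissible_cover B"
    "\<And>x. x \<in> P \<Longrightarrow> \<exists>t. x \<in> B t"
  shows "\<exists>t V. open_part n P V \<and> V \<subseteq> B t"
  using assms unfolding covering_def by meson

text \<open>
  Cover \<open>P\<close> by \<open>B\<close> and its complement. Consequently a definable property either holds throughout or
  fails throughout some nonempty relatively open part.
\<close>

lemma dichotomy:
  assumes cov: "covering n" and P: "dset n P" "P \<noteq> {}" and B: "dset n B"
  obtains V where "open_part n P V" "V \<subseteq> B" | V where "open_part n P V" "V \<inter> B = {}"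
proof -
  define C where "C = (\<lambda>t::'a. {x\<in>P. (t = 0 \<and> x \<in> B) \<or> (t = 1 \<and> \<not> x \<in> B)})"
  have "drel n (\<lambda>x t. x \<in> C t)" unfolding C_def mem_Collect_eq
    by (intro drelI dfn_rules dfn_set[OF P(1)] dfn_set[OF B])
  moreover have "admissible_cover C" by (auto simp: admissible_cover_def C_def)
  moreover have "\<exists>t. x \<in> C t" if "x \<in> P" for x using that by (auto simp: C_def)
  ultimately obtain t V where V: "open_part n P V" "V \<subseteq> C t" using coveringD[OF cov P] by blast
  show thesis
  proof (cases "t = 0")
    case True
    have "V \<subseteq> B" using V(2) True by (auto simp: C_def)
    then show thesis by (rule that(1)[OF V(1)])
  next
    case False
    have "V \<inter> B = {}" using V(2) False by (auto simp: C_def)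
    then show thesis by (rule that(2)[OF V(1)])
  qed
qed

lemma no_uniform_increase:
  assumes V: "dset n V" "V \<noteq> {}" and h: "dfun n h" and s: "0 < s"
    and bd: "\<And>y. y \<in> V \<Longrightarrow> h y \<le> t" and jump: "\<And>z. z \<in> V \<Longrightarrow> \<exists>y\<in>V. h z + s \<le> h y"
  shows False
proof -
  define S where "S = {a. \<exists>y\<in>V. a = h y}"
  have "dset1 S" unfolding dset1_def S_def mem_Collect_eq
    by (intro dfn_ex_set[OF V(1)] dfn_rules dterm_fun[OF h])
  moreover have "S \<noteq> {}" using V(2) by (auto simp: S_def)
  moreover have "a \<le> t" if "a \<in> S" for a using that bd by (auto simp: S_def)
  ultimately obtain g where g: "\<And>u. g \<le> u \<longleftrightarrow> (\<forall>a\<in>S. a \<le> u)" using lub_exists[of S t] by blast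
  have "\<not> g \<le> g - s" using s by simp
  then obtain z where z: "z \<in> V" "g - s < h z" using g[of "g - s"] by (auto simp: not_le S_def)
  then obtain y where y: "y \<in> V" "h z + s \<le> h y" using jump by blast
  have "h y \<in> S" using y(1) by (auto simp: S_def)
  then have "h y \<le> g" using g[of g] by blast
  then show False using z(2) y(2) by linarith
qed

text \<open>
  If the claim fails, every point has, arbitrarily near, points where \<open>h\<close> differs by at least \<open>s\<close>. By
  \<open>dichotomy\<close> there is a relatively open part from every point of which \<open>h\<close> can climb by \<open>s\<close>, or one
  from every point of which it can fall by \<open>s\<close>, to another point of the same part. A bounded definable
  function can do neither.
\<close>

lemma small_oscillation:
  assumes cov: "covering n" and P: "dset n P" "P \<noteq> {}" and h: "dfun n h"
    and bd: "\<And>x. x \<in> P \<Longrightarrow> \<bar>h x\<bar> \<le> t" and s: "0 < s"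
  shows "\<exists>V c. open_part n P V \<and> (\<forall>y\<in>V. \<bar>h y - c\<bar> < s)"
proof (rule ccontr)
  assume no: "\<not> ?thesis"
  have osc: "\<exists>y\<in>P. dst n x y < d \<and> s \<le> \<bar>h y - h x\<bar>" if x: "x \<in> P" "0 < d" for x d
  proof (rule ccontr)
    assume "\<not> ?thesis"
    then have "\<forall>y\<in>{y\<in>P. dst n x y < d}. \<bar>h y - h x\<bar> < s" by (auto simp: not_le)
    then show False using no open_part_ball[OF P(1) x] by blast
  qed
  define B where "B = {x\<in>P. \<forall>d. 0 < d \<longrightarrow> (\<exists>y\<in>P. dst n x y < d \<and> h x + s \<le> h y)}"
  have "dset n B" unfolding B_def
    by (intro dset_Collect[OF P(1)] dfn_ex_set[OF P(1)] dfn_rules dterm_fun[OF h])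
  then consider V where "open_part n P V" "V \<subseteq> B" | V where "open_part n P V" "V \<inter> B = {}"
    using dichotomy[OF cov P] by blast
  then show False
  proof cases
    case 1
    note V = open_partD[OF 1(1)]
    show False
    proof (rule no_uniform_increase[OF V(1,2) h s, of t])
      show "h y \<le> t" if "y \<in> V" for y using bd[of y] V(3) that by auto
      show "\<exists>y\<in>V. h z + s \<le> h y" if "z \<in> V" for z
        using V(4)[OF that] that 1(2) unfolding B_def by blast
    qed
  next
    case 2
    note V = open_partD[OF 2(1)]
    have h': "dfun n (\<lambda>x. - h x)" using h unfolding dfun_def by (auto intro: dterm_uminus)
    show False
    proof (rule no_uniform_increase[OF V(1,2) h' s, of t])
      show "- h y \<le> t" if "y \<in> V" for y using bd[of y] V(3) that by auto
      show "\<exists>y\<in>V. - h z + s \<le> - h y" if z: "z \<in> V" for z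
      proof -
        have zP: "z \<in> P" using z V(3) by blast
        obtain d where d: "0 < d" "\<forall>y\<in>P. dst n z y < d \<longrightarrow> y \<in> V" using V(4)[OF z] by blast
        have "z \<notin> B" using 2(2) z by blast
        then obtain e where e: "0 < e" "\<And>y. y \<in> P \<Longrightarrow> dst n z y < e \<Longrightarrow> h y < h z + s"
          using zP unfolding B_def by (auto simp: not_le)
        obtain y where y: "y \<in> P" "dst n z y < min d e" "s \<le> \<bar>h y - h z\<bar>"
          using osc[OF zP, of "min d e"] d(1) e(1) by auto
        have "h y < h z + s" "y \<in> V" using e(2) d(2) y(1,2) by auto
        then show ?thesis using y(3) by (intro bexI[of _ y]) (auto simp: abs_if split: if_splits)
      qed
    qed
  qed
qed

text \<open>
  The number \<open>s\<close> should be thought of as a radius for which the choice \<open>a\<close> at \<open>x\<close> is good. Increasing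
  covers fix \<open>s\<close> and a bound on \<open>a\<close> on a relatively open part; then the least good \<open>a\<close> oscillates little
  on a smaller part. So the choices at all points can be taken close to one \<open>a0\<close>, close even in
  comparison with \<open>s\<close>. This replaces continuity of a definable choice function.
\<close>

lemma uniform_choice:
  assumes cov: "covering n" and P: "dset n P" "P \<noteq> {}" and R: "drel2 n R"
    and ex: "\<And>x. x \<in> P \<Longrightarrow> \<exists>a s. 0 < s \<and> R x a s"
    and mono: "\<And>x a s s'. R x a s \<Longrightarrow> 0 < s' \<Longrightarrow> s' \<le> s \<Longrightarrow> R x a s'"
  obtains V s a0 where "open_part n P V" "0 < s" "\<forall>x\<in>V. \<exists>a. R x a s \<and> \<bar>a - a0\<bar> < s / 4"
proof -
  define A where "A = (\<lambda>t. {x \<in> P. 0 < t \<and> (\<exists>a. \<bar>a\<bar> \<le> t \<and> R x a (1 / t))})"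
  have Ad: "drel n (\<lambda>x t. x \<in> A t)" unfolding A_def mem_Collect_eq
    by (intro drelI dfn_rules dfn_set[OF P(1)] dfn_rel2[OF R])
  have "A t \<subseteq> A u" if "t \<le> u" for t u
  proof
    fix x assume "x \<in> A t"
    then obtain a where a: "x \<in> P" "0 < t" "\<bar>a\<bar> \<le> t" "R x a (1 / t)" by (auto simp: A_def)
    have "R x a (1 / u)" using mono[OF a(4), of "1 / u"] a(2) that by (simp add: frac_le)
    moreover have "0 < u" "\<bar>a\<bar> \<le> u" using a that by auto
    ultimately show "x \<in> A u" unfolding A_def using a(1) by blast
  qed
  then have adm: "admissible_cover A" unfolding admissible_cover_def by blast
  have Aex: "\<exists>t. x \<in> A t" if x: "x \<in> P" for x
  proof -
    obtain a s where as: "0 < s" "R x a s" using ex[OF x] by blast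
    define t where "t = max \<bar>a\<bar> (1 / s)"
    have t: "0 < t" "\<bar>a\<bar> \<le> t" "1 / s \<le> t" using as(1) by (auto simp: t_def less_max_iff_disj)
    then have "1 / t \<le> s" using as(1) by (simp add: field_simps)
    then have "R x a (1 / t)" using mono[OF as(2)] t(1) by simp
    then show ?thesis using t x by (auto simp: A_def)
  qed
  obtain t V where V: "open_part n P V" "V \<subseteq> A t" using coveringD[OF cov P Ad adm Aex] by blast
  note VD = open_partD[OF V(1)]
  have "0 < t" using V(2) VD(2) by (auto simp: A_def)
  define s where "s = 1 / t"
  have s: "0 < s" using \<open>0 < t\<close> by (simp add: s_def)
  define Q where "Q = (\<lambda>x a. \<bar>a\<bar> \<le> t \<and> R x a s)"
  \<comment> \<open>The infimum need not be good itself, but good choices exist within \<open>s / 8\<close> of it.\<close>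
  define h where "h = (\<lambda>x. glb {a. Q x a})"
  have Qd: "drel n Q" unfolding Q_def by (intro drelI dfn_rules dfn_rel2[OF R])
  then have hd: "dfun n h" unfolding h_def by (rule dfun_glb)
  have hg: "isglb {a. Q x a} (h x)" and Qne: "\<exists>a. Q x a" if x: "x \<in> V" for x
  proof -
    show ne: "\<exists>a. Q x a" using V(2) x by (auto simp: A_def Q_def s_def)
    show "isglb {a. Q x a} (h x)" unfolding h_def
    proof (rule isglb_exists[where b = "- t"])
      show "dset1 {a. Q x a}" by (rule dset1_rel[OF Qd dset_subset[OF VD(1) x]])
      show "- t \<le> a" if "a \<in> {a. Q x a}" for a using that by (auto simp: Q_def)
    qed (use ne in auto)
  qed
  have hb: "\<bar>h x\<bar> \<le> t" if x: "x \<in> V" for x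
  proof -
    obtain a where a: "Q x a" using Qne[OF x] by blast
    have "h x \<le> a" using hg[OF x] a unfolding isglb_def by blast
    moreover have "- t \<le> h x" using hg[OF x] unfolding isglb_def by (auto simp: Q_def)
    ultimately show ?thesis using a by (auto simp: Q_def)
  qed
  obtain W c where W: "open_part n V W" "\<forall>y\<in>W. \<bar>h y - c\<bar> < s / 8"
    using small_oscillation[OF cov VD(1,2) hd hb, of "s / 8"] s by auto
  have "\<forall>x\<in>W. \<exists>a. R x a s \<and> \<bar>a - c\<bar> < s / 4"
  proof
    fix x assume x: "x \<in> W"
    then have xV: "x \<in> V" using open_partD(3)[OF W(1)] by blast
    have close: "\<bar>h x - c\<bar> < s / 8" using W(2) x by blast
    have "\<not> h x + s / 8 \<le> h x" using s by simp
    then obtain a where a: "Q x a" "a < h x + s / 8"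
      using hg[OF xV] unfolding isglb_def by (auto simp: not_le)
    have "h x \<le> a" using hg[OF xV] a(1) unfolding isglb_def by blast
    then have "\<bar>a - c\<bar> < s / 8 + s / 8" using a(2) close by (auto simp: abs_if split: if_splits)
    then show "\<exists>a. R x a s \<and> \<bar>a - c\<bar> < s / 4"
      using a(1) by (intro exI[of _ a]) (simp add: Q_def)
  qed
  then show thesis by (rule that[OF open_part_trans[OF V(1) W(1)] s])
qed

lemma quarter_dist:
  fixes s :: 'a
  assumes "\<bar>a - c\<bar> < s / 4" "\<bar>b - c\<bar> < s / 4" shows "\<bar>a - b\<bar> < s"
proof -
  have "0 < s / 4" using assms(1) abs_ge_zero[of "a - c"] by linarith
  then have "s / 4 + s / 4 < s" by simp
  moreover have "\<bar>a - b\<bar> < s / 4 + s / 4" using assms by (auto simp: abs_if split: if_splits)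
  ultimately show ?thesis by linarith
qed

lemma uniform_box:
  assumes cov: "covering n" and P: "dset n P" "P \<noteq> {}" and C: "drel n C"
    and ex: "\<And>x. x \<in> P \<Longrightarrow> \<exists>a. inner_pt {a. C x a} a"
  obtains V s a0 where "open_part n P V" "0 < s" "\<forall>x\<in>V. \<forall>a. \<bar>a - a0\<bar> < s \<longrightarrow> C x a"
proof -
  define R where "R = (\<lambda>x a s. \<forall>b. \<bar>b - a\<bar> < s \<longrightarrow> C x b)"
  have Rd: "drel2 n R" unfolding R_def by (intro drel2I dfn_rules dfn_rel[OF C])
  have Rex: "\<exists>a s. 0 < s \<and> R x a s" if "x \<in> P" for x
    using ex[OF that] unfolding R_def inner_pt_def by auto
  have Rmono: "R x a s'" if "R x a s" "0 < s'" "s' \<le> s" for x a s s'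
    using that unfolding R_def by auto
  obtain V s a0 where V: "open_part n P V" "0 < s" "\<forall>x\<in>V. \<exists>a. R x a s \<and> \<bar>a - a0\<bar> < s / 4"
    by (rule uniform_choice[OF cov P Rd Rex Rmono])
  have "\<forall>x\<in>V. \<forall>a. \<bar>a - a0\<bar> < s / 4 \<longrightarrow> C x a"
    using V(3) quarter_dist[of _ a0 s] unfolding R_def by blast
  then show thesis by (rule that[OF V(1), rotated]) (use V(2) in simp)
qed

text \<open>
  Over a relatively open part of the projection either all fibres have inner points or none has. In
  the first case intervals inside the fibres can be chosen uniformly; in the second the fibres have
  isolated points, and one is selected with a uniform radius of isolation.
\<close>

lemma local_structure:
  assumes cov: "covering n" and A: "dset (Suc n) A" "A \<noteq> {}"
  obtains (box) V s a0 where "open_part n (proj n A) V" "0 < s"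
      "\<And>x a. x \<in> V \<Longrightarrow> \<bar>a - a0\<bar> < s \<Longrightarrow> x(n := a) \<in> A"
    | (graph) V s a0 where "open_part n (proj n A) V" "0 < s"
      "\<And>x. x \<in> V \<Longrightarrow> \<exists>!a. \<bar>a - a0\<bar> < s \<and> x(n := a) \<in> A"
proof -
  let ?P = "proj n A"
  have Pd: "dset n ?P" by (rule dset_proj[OF A(1)])
  note C = drel_fiber[OF A(1)]
  obtain y where "y \<in> A" using A(2) by blast
  then have "y \<in> Fn (Suc n)" by (rule dset_subset[OF A(1)])
  then obtain x a where "x \<in> Fn n" "y = x(n := a)" by (rule Fn_Suc_cases)
  then have "x \<in> ?P" using \<open>y \<in> A\<close> unfolding proj_def by blast
  then have Pne: "?P \<noteq> {}" by blast
  define I where "I = {x \<in> ?P. \<exists>a. inner_pt {a. x(n := a) \<in> A} a}"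
  have Id: "dset n I" unfolding I_def inner_pt_def mem_Collect_eq
    by (intro dset_Collect[OF Pd] dfn_rules dfn_rel[OF C])
  consider V where "open_part n ?P V" "V \<subseteq> I" | V where "open_part n ?P V" "V \<inter> I = {}"
    by (rule dichotomy[OF cov Pd Pne Id])
  then show thesis
  proof cases
    case 1
    note V = open_partD[OF 1(1)]
    have ex: "\<exists>a. inner_pt {a. x(n := a) \<in> A} a" if "x \<in> V" for x using 1(2) that by (auto simp: I_def)
    obtain W s a0 where W: "open_part n V W" "0 < s"
      "\<forall>x\<in>W. \<forall>a. \<bar>a - a0\<bar> < s \<longrightarrow> x(n := a) \<in> A" by (rule uniform_box[OF cov V(1,2) C ex])
    show thesis using W(3) by (intro box[OF open_part_trans[OF 1(1) W(1)] W(2)]) blast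
  next
    case 2
    note V = open_partD[OF 2(1)]
    define R where "R = (\<lambda>x a s. x(n := a) \<in> A \<and> (\<forall>b. x(n := b) \<in> A \<longrightarrow> \<bar>b - a\<bar> < s \<longrightarrow> b = a))"
    have Rd: "drel2 n R" unfolding R_def by (intro drel2I dfn_rules dfn_rel[OF C])
    have Rex: "\<exists>a s. 0 < s \<and> R y a s" if y: "y \<in> V" for y
    proof -
      have yP: "y \<in> ?P" "y \<notin> I" using 2(2) V(3) y by blast+
      then obtain a where "inner_pt {a. y(n := a) \<in> A} a \<or> isolated_pt {a. y(n := a) \<in> A} a"
        using dset1_interior_or_isolated[OF dset1_fiber[OF A(1)], of y] by (auto simp: proj_def)
      then have "isolated_pt {a. y(n := a) \<in> A} a" using yP unfolding I_def by blast
      then show ?thesis unfolding isolated_pt_def R_def by auto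
    qed
    have Rmono: "R x a s'" if "R x a s" "0 < s'" "s' \<le> s" for x a s s'
      using that unfolding R_def by auto
    obtain W s a0 where W: "open_part n V W" "0 < s" "\<forall>x\<in>W. \<exists>a. R x a s \<and> \<bar>a - a0\<bar> < s / 4"
      by (rule uniform_choice[OF cov V(1,2) Rd Rex Rmono])
    show thesis
    proof (rule graph[OF open_part_trans[OF 2(1) W(1)]])
      show "0 < s / 4" using W(2) by simp
      show "\<exists>!a. \<bar>a - a0\<bar> < s / 4 \<and> y(n := a) \<in> A" if y: "y \<in> W" for y
      proof -
        obtain a where a: "R y a s" "\<bar>a - a0\<bar> < s / 4" using W(3) y by blast
        then show ?thesis using quarter_dist[of _ a0 s a] unfolding R_def by (intro ex1I[of _ a]) auto
      qed
    qed
  qed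
qed

text \<open>
  Over a box, the members of the cover whose fibre has an inner point cover the base, by the
  principle on the line; over a graph the cover may simply be viewed on the base. In both cases the
  principle in dimension \<open>n\<close> selects one member for a relatively open part of the base.
\<close>

lemma covering_Suc:
  assumes cov: "covering n" shows "covering (Suc n)"
  unfolding covering_def
proof (intro allI impI)
  fix A :: "(nat \<Rightarrow> 'a) set" and B :: "'a \<Rightarrow> (nat \<Rightarrow> 'a) set"
  assume A: "dset (Suc n) A" "A \<noteq> {}" and B: "drel (Suc n) (\<lambda>x t. x \<in> B t)"
    and adm: "admissible_cover B" and cover: "\<forall>x\<in>A. \<exists>t. x \<in> B t"
  note AC = drel_fiber[OF A(1)]
  show "\<exists>t W. open_part (Suc n) A W \<and> W \<subseteq> B t"
  proof (cases rule: local_structure[OF cov A, case_names box graph])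
    case (box V s a0)
    note V = open_partD[OF box(1)]
    define B' where "B' = (\<lambda>t. {x\<in>V. \<exists>a. inner_pt {a. \<bar>a - a0\<bar> < s \<and> x(n := a) \<in> B t} a})"
    have B'd: "drel n (\<lambda>x t. x \<in> B' t)" unfolding B'_def inner_pt_def mem_Collect_eq
      by (intro drelI dfn_rules dfn_set[OF V(1)] dfn_rel[OF B])
    have B'adm: "admissible_cover B'"
    proof (rule admissible_cover_image[OF adm])
      let ?f = "\<lambda>S. {x\<in>V. \<exists>a. inner_pt {a. \<bar>a - a0\<bar> < s \<and> x(n := a) \<in> S} a}"
      show "B' t = ?f (B t)" for t by (simp add: B'_def)
      show "?f S \<subseteq> ?f S'" if "S \<subseteq> S'" for S S' using that unfolding inner_pt_def by blast
      have "\<not> inner_pt {} a" for a :: 'a unfolding inner_pt_def by (auto intro: exI[of _ a])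
      then show "?f {} = {}" by simp
    qed
    have B'cover: "\<exists>t. x \<in> B' t" if x: "x \<in> V" for x
    proof -
      have xF: "x \<in> Fn n" by (rule dset_subset[OF V(1) x])
      have "\<exists>t a. a0 - s < a \<and> a < a0 + s \<and> inner_pt {a. \<bar>a - a0\<bar> < s \<and> x(n := a) \<in> B t} a"
      proof (rule interval_covering)
        show "dfn (\<lambda>e. e 1 \<in> {a. \<bar>a - a0\<bar> < s \<and> x(n := a) \<in> B (e 0)})" unfolding mem_Collect_eq
          by (intro dfn_rules dfn_rel[OF B] dvec_const[OF xF])
        show "admissible_cover (\<lambda>t. {a. \<bar>a - a0\<bar> < s \<and> x(n := a) \<in> B t})"
          by (rule admissible_cover_image[OF adm, where f = "\<lambda>S. {a. \<bar>a - a0\<bar> < s \<and> x(n := a) \<in> S}"]) auto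
        show "\<exists>t. a \<in> {a. \<bar>a - a0\<bar> < s \<and> x(n := a) \<in> B t}" if "a0 - s < a" "a < a0 + s" for a
        proof -
          have "\<bar>a - a0\<bar> < s" using that by (auto simp: abs_if)
          then show ?thesis using cover box(3)[OF x, of a] by auto
        qed
      qed (use box(2) in simp)
      then show ?thesis using x by (auto simp: B'_def)
    qed
    obtain t W where W: "open_part n V W" "W \<subseteq> B' t"
      using coveringD[OF cov V(1,2) B'd B'adm B'cover] by blast
    note WD = open_partD[OF W(1)]
    have Cd: "drel n (\<lambda>x a. \<bar>a - a0\<bar> < s \<and> x(n := a) \<in> B t)"
      by (intro drelI dfn_rules dfn_rel[OF B])
    have ex: "\<exists>a. inner_pt {a. \<bar>a - a0\<bar> < s \<and> x(n := a) \<in> B t} a" if "x \<in> W" for x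
      using W(2) that by (auto simp: B'_def)
    obtain V' r c where V': "open_part n W V'" "0 < r"
      "\<forall>x\<in>V'. \<forall>a. \<bar>a - c\<bar> < r \<longrightarrow> \<bar>a - a0\<bar> < s \<and> x(n := a) \<in> B t"
      by (rule uniform_box[OF cov WD(1,2) Cd ex])
    obtain x where x: "x \<in> V'" using open_partD(2)[OF V'(1)] by blast
    have xV: "x \<in> V" using x open_partD(3)[OF V'(1)] WD(3) by blast
    have xc: "x(n := c) \<in> A" using V'(2,3) x by (intro box(3)[OF xV]) auto
    have "\<exists>W. open_part (Suc n) A W \<and> W \<subseteq> B t"
      using V'(2,3) open_part_trans[OF box(1) open_part_trans[OF W(1) V'(1)]]
      by (intro open_part_cylinder[OF A(1) _ x _ xc, of c r]) auto
    then show ?thesis by blast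
  next
    case (graph V s a0)
    note V = open_partD[OF graph(1)]
    define B' where "B' = (\<lambda>t. {x\<in>V. \<exists>a. \<bar>a - a0\<bar> < s \<and> x(n := a) \<in> A \<and> x(n := a) \<in> B t})"
    have B'd: "drel n (\<lambda>x t. x \<in> B' t)" unfolding B'_def mem_Collect_eq
      by (intro drelI dfn_rules dfn_set[OF V(1)] dfn_rel[OF B] dfn_rel[OF AC])
    have B'adm: "admissible_cover B'"
      by (rule admissible_cover_image[OF adm,
            where f = "\<lambda>S. {x\<in>V. \<exists>a. \<bar>a - a0\<bar> < s \<and> x(n := a) \<in> A \<and> x(n := a) \<in> S}"])
        (auto simp: B'_def)
    have B'cover: "\<exists>t. x \<in> B' t" if x: "x \<in> V" for x
      using graph(3)[OF x] cover x unfolding B'_def by blast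
    obtain t W where W: "open_part n V W" "W \<subseteq> B' t"
      using coveringD[OF cov V(1,2) B'd B'adm B'cover] by blast
    obtain x where x: "x \<in> W" using open_partD(2)[OF W(1)] by blast
    then obtain a where a: "\<bar>a - a0\<bar> < s" "x(n := a) \<in> A" using W(2) by (auto simp: B'_def)
    have "\<exists>W. open_part (Suc n) A W \<and> W \<subseteq> B t"
    proof (rule open_part_cylinder[OF A(1) open_part_trans[OF graph(1) W(1)] x a])
      fix y b assume y: "y \<in> W" "\<bar>b - a0\<bar> < s" "y(n := b) \<in> A"
      then obtain b' where "\<bar>b' - a0\<bar> < s" "y(n := b') \<in> A" "y(n := b') \<in> B t" "y \<in> V"
        using W(2) by (auto simp: B'_def)
      then show "y(n := b) \<in> B t" using graph(3)[of y] y by blast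
    qed
    then show ?thesis by blast
  qed
qed

lemma covering: "covering n"
proof (induction n)
  case 0
  show ?case unfolding covering_def
  proof (intro allI impI)
    fix P and B :: "'a \<Rightarrow> (nat \<Rightarrow> 'a) set"
    assume P: "dset 0 P" "P \<noteq> {}" and "\<forall>x\<in>P. \<exists>t. x \<in> B t"
    then obtain x t where x: "x \<in> P" "x \<in> B t" by blast
    have "y = x" if "y \<in> P" for y
      by (rule Fn_cong[OF dset_subset[OF P(1) that] dset_subset[OF P(1) x(1)]]) simp
    then have "P \<subseteq> B t" using x(2) by blast
    then show "\<exists>t V. open_part 0 P V \<and> V \<subseteq> B t" using open_part_self[OF P] by blast
  qed
qed (rule covering_Suc)

end

section \<open>Thin sets, uniform choice of vectors and definable compactness\<close>

lemma of_nat_Suc_pos: "(0::'a::linordered_field) < of_nat (Suc m)"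
  by (rule of_nat_0_less_iff[THEN iffD2]) simp

lemma dst_less:
  assumes "\<And>i. i < m \<Longrightarrow> \<bar>x i - y i\<bar> \<le> s / of_nat (Suc m)" "0 < s"
  shows "dst m x y < s"
proof -
  have "dst m x y \<le> of_nat (card {..<m}) * (s / of_nat (Suc m))"
    unfolding dst_def by (rule sum_bounded_above) (use assms(1) in auto)
  also have "\<dots> = of_nat m * s / of_nat (Suc m)" by simp
  also have "\<dots> < s"
    unfolding pos_divide_less_eq[OF of_nat_Suc_pos] using assms(2) by (simp add: algebra_simps)
  finally show ?thesis .
qed

context d_minimal_field
begin

definition thin :: "nat \<Rightarrow> (nat \<Rightarrow> 'a) set \<Rightarrow> (nat \<Rightarrow> 'a) set \<Rightarrow> bool" where
  "thin n P B \<longleftrightarrow> (\<forall>V. open_part n P V \<longrightarrow> \<not> V \<subseteq> B)"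

lemma thinD: "thin n P B \<Longrightarrow> open_part n P V \<Longrightarrow> V \<subseteq> B \<Longrightarrow> R"
  unfolding thin_def by blast

lemma thin_mono: "thin n P B \<Longrightarrow> C \<subseteq> B \<Longrightarrow> thin n P C"
  unfolding thin_def by blast

text \<open>
  A relatively open part of \<open>P\<close> that lies in \<open>B\<close>, hence in \<open>Q\<close>, is relatively open in \<open>Q\<close>.
\<close>

lemma thin_larger_base:
  assumes "thin n Q B" "B \<subseteq> Q" "Q \<subseteq> P" shows "thin n P B"
  unfolding thin_def
proof (intro allI impI notI)
  fix V assume V: "open_part n P V" "V \<subseteq> B"
  have "\<exists>s>0. \<forall>y\<in>Q. dst n x y < s \<longrightarrow> y \<in> V" if "x \<in> V" for x
    using open_partD(4)[OF V(1) that] assms(3) by blast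
  then have "open_part n Q V"
    using open_partD(1,2)[OF V(1)] V(2) assms(2) unfolding open_part_def by blast
  then show False by (rule thinD[OF assms(1) _ V(2)])
qed

lemma thin_Un:
  assumes Z: "dset n Z" "thin n P Z" and Y: "thin n P Y" shows "thin n P (Z \<union> Y)"
  unfolding thin_def
proof (intro allI impI notI)
  fix V assume V: "open_part n P V" "V \<subseteq> Z \<union> Y"
  consider W where "open_part n V W" "W \<subseteq> Z" | W where "open_part n V W" "W \<inter> Z = {}"
    by (rule dichotomy[OF covering open_partD(1,2)[OF V(1)] Z(1)])
  then show False
  proof cases
    case 1
    show False by (rule thinD[OF Z(2) open_part_trans[OF V(1) 1(1)] 1(2)])
  next
    case 2
    have "W \<subseteq> Y" using 2(2) open_partD(3)[OF 2(1)] V(2) by blast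
    then show False by (rule thinD[OF Y open_part_trans[OF V(1) 2(1)]])
  qed
qed

lemma thin_UN:
  assumes "\<And>i. i < N \<Longrightarrow> dset n (Z i) \<and> thin n P (Z i)"
  shows "thin n P (\<Union>i<(N::nat). Z i)"
  using assms
proof (induction N)
  case 0
  then show ?case by (auto simp: thin_def dest: open_partD(2))
next
  case (Suc N)
  have "(\<Union>i<Suc N. Z i) = Z N \<union> (\<Union>i<N. Z i)" by (auto simp: less_Suc_eq)
  then show ?case using thin_Un[of n "Z N"] Suc by simp
qed

text \<open>
  Compare the fibres \<open>F i x\<close> of \<open>A i\<close> over a point \<open>x\<close>. Outside a thin set, \<open>F 1 x\<close> has no inner point,
  since otherwise \<open>A 1\<close> would contain a relatively open box of \<open>A 0\<close>. Again outside a thin set, no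
  isolated point of \<open>F i x\<close> belongs to \<open>F (i + 1) x\<close>, since otherwise \<open>A (i + 1)\<close> would contain a
  relatively open graph of \<open>A i\<close>. So each step removes at least the isolated points, and the uniform
  bound \<open>N\<close> on the rank of \<open>F 1 x\<close> makes the fibre empty after \<open>N\<close> further steps.
\<close>

lemma thin_chain_proj:
  assumes A: "\<And>i. dset (Suc n) (A i)" and dec: "\<And>i. A (Suc i) \<subseteq> A i"
    and thinA: "\<And>i. thin (Suc n) (A i) (A (Suc i))"
  shows "\<exists>K>0. thin n (proj n (A 0)) (proj n (A K))"
proof -
  define P where "P = (\<lambda>i. proj n (A i))"
  define F where "F = (\<lambda>i x. {a. x(n := a) \<in> A i})"
  have Pd: "dset n (P i)" for i unfolding P_def by (rule dset_proj[OF A])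
  have PF: "x \<in> Fn n" if "x \<in> P i" for x i using that by (simp add: P_def proj_def)
  have Ad: "drel n (\<lambda>x a. x(n := a) \<in> A i)" for i by (rule drel_fiber[OF A])
  have "antimono A" using dec by (rule antimonoI[OF lift_Suc_antimono_le])
  then have P_anti: "P j \<subseteq> P i" if "i \<le> j" for i j
    using that unfolding P_def proj_def antimono_def by blast
  have "dfn (\<lambda>e. (\<lambda>i\<in>{..<n}. e (Suc i))(n := e 0) \<in> A 1)"
    by (intro dfn_rel[OF Ad] dvec_var dterm_var)
  from Der_uniform[of "\<lambda>a e. (\<lambda>i\<in>{..<n}. e i)(n := a) \<in> A 1", OF this]
  obtain N where N: "\<And>e. (\<forall>a. \<not> inner_pt {a. (\<lambda>i\<in>{..<n}. e i)(n := a) \<in> A 1} a) \<Longrightarrow>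
      (Der ^^ N) {a. (\<lambda>i\<in>{..<n}. e i)(n := a) \<in> A 1} = {}" by blast
  have N: "(Der ^^ N) (F 1 x) = {}" if "x \<in> Fn n" "\<And>a. \<not> inner_pt (F 1 x) a" for x
  proof -
    have "(\<lambda>i\<in>{..<n}. x i) = x" using that(1) by (auto simp: fun_eq_iff PiE_iff extensional_def)
    then show ?thesis using N[of x] that(2) by (simp add: F_def)
  qed
  define Z0 where "Z0 = {x \<in> P 0. \<exists>a. inner_pt (F 1 x) a}"
  define Z where "Z = (\<lambda>i. {x \<in> P (Suc i). \<exists>a. a \<in> F (Suc (Suc i)) x \<and> isolated_pt (F (Suc i) x) a})"
  have Z0: "dset n Z0" unfolding Z0_def inner_pt_def F_def mem_Collect_eq
    by (intro dset_Collect[OF Pd] dfn_rules dfn_rel[OF Ad])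
  have Zd: "dset n (Z i)" for i unfolding Z_def isolated_pt_def F_def mem_Collect_eq
    by (intro dset_Collect[OF Pd] dfn_rules dfn_rel[OF Ad])
  have thin0: "thin n (P 0) Z0" unfolding thin_def
  proof (intro allI impI notI)
    fix V assume V: "open_part n (P 0) V" "V \<subseteq> Z0"
    note VD = open_partD[OF V(1)]
    have ex: "\<exists>a. inner_pt {a. y(n := a) \<in> A 1} a" if "y \<in> V" for y
      using that V(2) by (auto simp: Z0_def F_def)
    obtain W s a0 where W: "open_part n V W" "0 < s" "\<forall>x\<in>W. \<forall>a. \<bar>a - a0\<bar> < s \<longrightarrow> x(n := a) \<in> A 1"
      by (rule uniform_box[OF covering VD(1,2) Ad ex])
    obtain x where x: "x \<in> W" using open_partD(2)[OF W(1)] by blast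
    have PW: "open_part n (proj n (A 0)) W" using open_part_trans[OF V(1) W(1)] by (simp add: P_def)
    have x0: "x(n := a0) \<in> A 0" using W(2,3) x dec[of 0] by auto
    have "\<exists>W'. open_part (Suc n) (A 0) W' \<and> W' \<subseteq> A 1"
      using W(2,3) by (intro open_part_cylinder[OF A PW x _ x0, of a0 s]) auto
    then show False using thinA[of 0] unfolding thin_def by auto
  qed
  have thinZ: "thin n (P (Suc i)) (Z i)" for i unfolding thin_def
  proof (intro allI impI notI)
    fix V assume V: "open_part n (P (Suc i)) V" "V \<subseteq> Z i"
    note VD = open_partD[OF V(1)]
    define R where "R = (\<lambda>x a s. x(n := a) \<in> A (Suc (Suc i)) \<and>
      (\<forall>b. x(n := b) \<in> A (Suc i) \<longrightarrow> \<bar>b - a\<bar> < s \<longrightarrow> b = a))"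
    have Rd: "drel2 n R" unfolding R_def by (intro drel2I dfn_rules dfn_rel[OF Ad])
    have Rex: "\<exists>a s. 0 < s \<and> R y a s" if "y \<in> V" for y
      using subsetD[OF V(2) that] unfolding Z_def isolated_pt_def F_def R_def by auto
    have Rmono: "R x a s'" if "R x a s" "0 < s'" "s' \<le> s" for x a s s'
      using that unfolding R_def by auto
    obtain W s a0 where W: "open_part n V W" "0 < s" "\<forall>x\<in>W. \<exists>a. R x a s \<and> \<bar>a - a0\<bar> < s / 4"
      by (rule uniform_choice[OF covering VD(1,2) Rd Rex Rmono])
    obtain x where x: "x \<in> W" using open_partD(2)[OF W(1)] by blast
    obtain a1 where a1: "R x a1 s" "\<bar>a1 - a0\<bar> < s / 4" using W(3) x by blast
    have PW: "open_part n (proj n (A (Suc i))) W" using open_part_trans[OF V(1) W(1)] by (simp add: P_def)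
    have xA: "x(n := a1) \<in> A (Suc i)" using a1(1) dec[of "Suc i"] unfolding R_def by blast
    have "\<exists>W'. open_part (Suc n) (A (Suc i)) W' \<and> W' \<subseteq> A (Suc (Suc i))"
    proof (rule open_part_cylinder[OF A PW x a1(2) xA])
      fix y c assume y: "y \<in> W" "\<bar>c - a0\<bar> < s / 4" "y(n := c) \<in> A (Suc i)"
      then obtain a where a: "R y a s" "\<bar>a - a0\<bar> < s / 4" using W(3) by blast
      then have "c = a" using quarter_dist[OF y(2) a(2)] y(3) unfolding R_def by blast
      then show "y(n := c) \<in> A (Suc (Suc i))" using a(1) unfolding R_def by blast
    qed
    then show False using thinA[of "Suc i"] unfolding thin_def by blast
  qed
  have cover: "P (Suc N) \<subseteq> Z0 \<union> (\<Union>i<N. Z i)"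
  proof (rule subsetI, rule ccontr)
    fix x assume x: "x \<in> P (Suc N)" and "x \<notin> Z0 \<union> (\<Union>i<N. Z i)"
    then have no: "x \<notin> Z0" "\<And>i. i < N \<Longrightarrow> x \<notin> Z i" by auto
    have xP: "x \<in> P i" if "i \<le> Suc N" for i using P_anti[OF that] x by blast
    have "F (Suc k) x \<subseteq> (Der ^^ k) (F 1 x)" if "k \<le> N" for k
      using that
    proof (induction k)
      case (Suc k)
      have "F (Suc (Suc k)) x \<subseteq> Der (F (Suc k) x)"
        using no(2)[of k] xP[of "Suc k"] Suc.prems dec[of "Suc k"] by (auto simp: Z_def Der_def F_def)
      also have "\<dots> \<subseteq> Der ((Der ^^ k) (F 1 x))" using Suc by (intro Der_mono) auto
      finally show ?case by simp
    qed simp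
    moreover have "(Der ^^ N) (F 1 x) = {}"
      using no(1) xP[of 0] by (intro N PF[OF x]) (auto simp: Z0_def)
    ultimately have "F (Suc N) x = {}" by blast
    then show False using x by (auto simp: F_def P_def proj_def)
  qed
  have "thin n (P 0) (\<Union>i<N. Z i)"
  proof (rule thin_UN, intro conjI Zd)
    show "thin n (P 0) (Z i)" for i
      by (rule thin_larger_base[OF thinZ]) (use P_anti in \<open>auto simp: Z_def\<close>)
  qed
  then have "thin n (P 0) (Z0 \<union> (\<Union>i<N. Z i))" by (rule thin_Un[OF Z0 thin0])
  then have "thin n (P 0) (P (Suc N))" by (rule thin_mono) (use cover in blast)
  then show ?thesis unfolding P_def by blast
qed

text \<open>
  By the preceding lemma a subsequence of the projections satisfies the same hypotheses in one
  dimension less.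
\<close>

lemma thin_chain_terminates:
  assumes "\<And>i. dset n (A i)" and "\<And>i. A (Suc i) \<subseteq> A i" and "\<And>i. thin n (A i) (A (Suc i))"
  shows "\<exists>k. A k = {}"
  using assms
proof (induction n arbitrary: A)
  case 0
  have "A 1 = {}"
  proof (rule ccontr)
    assume "A 1 \<noteq> {}"
    then obtain x where x: "x \<in> A 1" by blast
    have x0: "x \<in> A 0" using 0(2)[of 0] x by auto
    have "y = x" if "y \<in> A 0" for y
      by (rule Fn_cong[OF dset_subset[OF 0(1) that] dset_subset[OF 0(1) x0]]) simp
    then have "A 0 \<subseteq> A (Suc 0)" using x by auto
    moreover have "open_part 0 (A 0) (A 0)" using x0 by (intro open_part_self 0(1)) blast
    ultimately show False using thinD[OF 0(3)[of 0]] by blast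
  qed
  then show ?case by blast
next
  case (Suc n)
  have "\<exists>k>0. thin n (proj n (A i)) (proj n (A (i + k)))" for i
    using thin_chain_proj[of n "\<lambda>j. A (i + j)"] Suc.prems by simp
  then obtain K where K: "\<And>i. thin n (proj n (A i)) (proj n (A (i + K i)))" by metis
  \<comment> \<open>The indices of that subsequence.\<close>
  define j where "j = rec_nat 0 (\<lambda>_ i. i + K i)"
  have j: "j (Suc r) = j r + K (j r)" for r by (simp add: j_def)
  have "antimono A" using Suc.prems(2) by (rule antimonoI[OF lift_Suc_antimono_le])
  then have anti: "proj n (A (i + k)) \<subseteq> proj n (A i)" for i k
    using le_add1[of i k] unfolding proj_def antimono_def by blast
  have "\<exists>r. proj n (A (j r)) = {}"
    by (rule Suc.IH) (auto simp: j K intro: dset_proj Suc.prems subsetD[OF anti])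
  then obtain r where r: "proj n (A (j r)) = {}" by blast
  have "y \<notin> A (j r)" for y
  proof
    assume y: "y \<in> A (j r)"
    then have "y \<in> Fn (Suc n)" by (rule dset_subset[OF Suc.prems(1)])
    then obtain x a where "x \<in> Fn n" "y = x(n := a)" by (rule Fn_Suc_cases)
    then show False using r y unfolding proj_def by blast
  qed
  then show ?case by blast
qed

text \<open>
  First fix the radius \<open>s\<close> on a relatively open part; then confine one coordinate after another to a
  window so small that the \<open>m\<close> deviations add up to less than \<open>s / 4\<close>, shrinking the part each time.
\<close>

lemma uniform_vector_choice:
  assumes P: "dset n P" "P \<noteq> {}"
    and R: "\<And>X Y t. dvec n X \<Longrightarrow> dvec m Y \<Longrightarrow> dterm t \<Longrightarrow> dfn (\<lambda>e. R (X e) (Y e) (t e))"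
    and ex: "\<And>x. x \<in> P \<Longrightarrow> \<exists>y\<in>Fn m. \<exists>s>0. R x y s"
    and mono: "\<And>x y s s'. R x y s \<Longrightarrow> 0 < s' \<Longrightarrow> s' \<le> s \<Longrightarrow> R x y s'"
  obtains V s y0 where "open_part n P V" "0 < s"
    "\<forall>x\<in>V. \<exists>y\<in>Fn m. R x y s \<and> dst m y y0 < s / 4"
proof -
  define R0 where "R0 = (\<lambda>x (a::'a) s. \<exists>y\<in>Fn m. R x y s)"
  have R0d: "drel2 n R0" unfolding R0_def by (intro drel2I dfn_rules R)
  have R0ex: "\<exists>a s. 0 < s \<and> R0 x a s" if "x \<in> P" for x using ex[OF that] by (auto simp: R0_def)
  have R0mono: "R0 x a s'" if "R0 x a s" "0 < s'" "s' \<le> s" for x a s s'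
    using mono that unfolding R0_def by blast
  obtain V0 s a1 where 1: "open_part n P V0" "0 < s" "\<forall>y\<in>V0. \<exists>a. R0 y a s \<and> \<bar>a - a1\<bar> < s / 4"
    by (rule uniform_choice[OF covering P R0d R0ex R0mono])
  define w where "w = s / 4 / of_nat (Suc m)"
  have w: "0 < w" unfolding w_def using 1(2) by (intro divide_pos_pos of_nat_Suc_pos) simp_all
  have "\<exists>V y0. open_part n P V \<and> (\<forall>x\<in>V. \<exists>y\<in>Fn m. R x y s \<and> (\<forall>i<k. \<bar>y i - y0 i\<bar> < w))"
    if "k \<le> m" for k
    using that
  proof (induction k)
    case 0
    then show ?case using 1 unfolding R0_def by blast
  next
    case (Suc k)
    then obtain V y2 where V: "open_part n P V"
      "\<forall>x\<in>V. \<exists>y\<in>Fn m. R x y s \<and> (\<forall>i<k. \<bar>y i - y2 i\<bar> < w)" by auto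
    note VD = open_partD[OF V(1)]
    define Q where "Q = (\<lambda>x a s'. s' \<le> w \<and> (\<exists>y\<in>Fn m. R x y s \<and> (\<forall>i<k. \<bar>y i - y2 i\<bar> < w) \<and> y k = a))"
    have comp: "dterm (\<lambda>e. (\<lambda>i\<in>{..<m}. e i) i)" if "i < m" for i
      by (rule dvec_comp[OF dvec_var_id that])
    have Qd: "drel2 n Q" unfolding Q_def using Suc.prems
      by (intro drel2I dfn_rules R dfn_ball_nat comp) auto
    have Qex: "\<exists>a s'. 0 < s' \<and> Q x a s'" if "x \<in> V" for x
      using V(2) that w unfolding Q_def by blast
    have Qmono: "Q x a s'" if "Q x a s''" "0 < s'" "s' \<le> s''" for x a s'' s'
      using that unfolding Q_def by auto
    obtain W s3 a3 where W: "open_part n V W" "0 < s3" "\<forall>y\<in>W. \<exists>a. Q y a s3 \<and> \<bar>a - a3\<bar> < s3 / 4"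
      by (rule uniform_choice[OF covering VD(1,2) Qd Qex Qmono])
    have "\<exists>y\<in>Fn m. R x y s \<and> (\<forall>i<Suc k. \<bar>y i - (y2(k := a3)) i\<bar> < w)" if x: "x \<in> W" for x
    proof -
      obtain y where y: "s3 \<le> w" "y \<in> Fn m" "R x y s" "\<forall>i<k. \<bar>y i - y2 i\<bar> < w" "\<bar>y k - a3\<bar> < s3 / 4"
        using W(3) x unfolding Q_def by blast
      have "s3 / 4 \<le> s3" using W(2) by simp
      then have "\<bar>y k - a3\<bar> < w" using y(1,5) by linarith
      then show ?thesis using y by (intro bexI[of _ y]) (auto simp: less_Suc_eq)
    qed
    then show ?case using open_part_trans[OF V(1) W(1)] by blast
  qed
  from this[of m] obtain V y0 where V: "open_part n P V"
    "\<forall>x\<in>V. \<exists>y\<in>Fn m. R x y s \<and> (\<forall>i<m. \<bar>y i - y0 i\<bar> < w)" by auto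
  show thesis
  proof (rule that[OF V(1) 1(2)], intro ballI)
    fix x assume "x \<in> V"
    then obtain y where y: "y \<in> Fn m" "R x y s" "\<forall>i<m. \<bar>y i - y0 i\<bar> < w" using V(2) by blast
    have "dst m y y0 < s / 4"
      by (rule dst_less) (use y(3) 1(2) in \<open>auto simp: w_def intro: less_imp_le\<close>)
    then show "\<exists>y\<in>Fn m. R x y s \<and> dst m y y0 < s / 4" using y by blast
  qed
qed

text \<open>
  Definable compactness of closed boxes. The coordinates of the cluster point are chosen one after
  another; the next one is the lower limit, as \<open>t\<close> tends to \<open>0\<close>, of that coordinate on the points of
  \<open>C t\<close> whose previous coordinates are already within \<open>t\<close>.
\<close>

lemma definable_cluster_point:
  assumes C: "drel m (\<lambda>y t. y \<in> C t)" and CF: "\<And>t. C t \<subseteq> Fn m"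
    and ne: "\<And>t. 0 < t \<Longrightarrow> C t \<noteq> {}" and mono: "\<And>t u. t \<le> u \<Longrightarrow> C t \<subseteq> C u"
    and bd: "0 < t1" "\<And>y i. y \<in> C t1 \<Longrightarrow> i < m \<Longrightarrow> \<bar>y i\<bar> \<le> b"
  shows "\<exists>p\<in>Fn m. \<forall>t>0. \<exists>y\<in>C t. dst m y p < t"
proof -
  have "\<exists>p\<in>Fn m. \<forall>t>0. \<exists>y\<in>C t. \<forall>i<k. \<bar>y i - p i\<bar> \<le> t" if "k \<le> m" for k
    using that
  proof (induction k)
    case 0
    have "(\<lambda>i\<in>{..<m}. 0) \<in> Fn m" by auto
    then show ?case using ne by blast
  next
    case (Suc k)
    then obtain p where p: "p \<in> Fn m" "\<And>t. 0 < t \<Longrightarrow> \<exists>y\<in>C t. \<forall>i<k. \<bar>y i - p i\<bar> \<le> t" by auto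
    have km: "k < m" using Suc.prems by simp
    define D where "D = (\<lambda>t. {y \<in> C t. \<forall>i<k. \<bar>y i - p i\<bar> \<le> t})"
    have Dne: "\<exists>y. y \<in> D t" if "0 < t" for t using p(2)[OF that] by (auto simp: D_def)
    have Dmono: "D t \<subseteq> D u" if "t \<le> u" for t u
      using mono[OF that] that by (force simp: D_def)
    define S where "S = {a. \<exists>t. 0 < t \<and> (\<forall>y\<in>Fn m. y \<in> C t \<and> (\<forall>i<k. \<bar>y i - p i\<bar> \<le> t) \<longrightarrow> a \<le> y k)}"
    have S: "a \<in> S \<longleftrightarrow> (\<exists>t>0. \<forall>y\<in>D t. a \<le> y k)" for a
    proof -
      have "(\<forall>y\<in>Fn m. y \<in> C t \<and> (\<forall>i<k. \<bar>y i - p i\<bar> \<le> t) \<longrightarrow> a \<le> y k) \<longleftrightarrow> (\<forall>y\<in>D t. a \<le> y k)" for t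
        unfolding D_def mem_Collect_eq Ball_def using CF[of t] by blast
      then show ?thesis unfolding S_def by (simp only: mem_Collect_eq)
    qed
    have comp_id: "dterm (\<lambda>e. (\<lambda>i\<in>{..<m}. e i) i)" if "i < m" for i
      by (rule dvec_comp[OF dvec_var_id that])
    have "dset1 S" unfolding dset1_def S_def mem_Collect_eq using km
      by (intro dfn_rules dfn_rel[OF C] dfn_ball_nat comp_id) auto
    moreover have "- b \<in> S" unfolding S
    proof (intro exI conjI ballI)
      show "0 < t1" by (rule bd(1))
      fix y assume "y \<in> D t1"
      then have "\<bar>y k\<bar> \<le> b" using bd(2)[OF _ km] by (auto simp: D_def)
      then show "- b \<le> y k" by simp
    qed
    then have "S \<noteq> {}" by blast
    moreover have "a \<le> b" if "a \<in> S" for a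
    proof -
      obtain t where t: "0 < t" "\<forall>y\<in>D t. a \<le> y k" using \<open>a \<in> S\<close> unfolding S by blast
      obtain y where y: "y \<in> D (min t t1)" using Dne[of "min t t1"] t(1) bd(1) by auto
      have "y \<in> D t" "y \<in> D t1" using Dmono[of "min t t1" t] Dmono[of "min t t1" t1] y by auto
      then have "a \<le> y k" "\<bar>y k\<bar> \<le> b" using t(2) bd(2)[OF _ km] by (auto simp: D_def)
      then show ?thesis by simp
    qed
    ultimately obtain g where g: "\<And>u. g \<le> u \<longleftrightarrow> (\<forall>a\<in>S. a \<le> u)" using lub_exists[of S b] by blast
    have close: "\<exists>y\<in>D t. \<bar>y k - g\<bar> \<le> t" if t: "0 < t" for t
    proof (rule ccontr)
      assume no: "\<not> ?thesis"
      have "\<not> g \<le> g - t" using t by simp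
      then obtain a where a: "a \<in> S" "g - t < a" using g[of "g - t"] by (auto simp: not_le)
      then obtain u where u: "0 < u" "\<forall>y\<in>D u. a \<le> y k" unfolding S by blast
      have "g + t \<in> S" unfolding S
      proof (intro exI conjI ballI)
        show "0 < min t u" using t u by simp
        fix y assume y: "y \<in> D (min t u)"
        have "y \<in> D t" "y \<in> D u" using Dmono[of "min t u" t] Dmono[of "min t u" u] y by auto
        then have "\<not> \<bar>y k - g\<bar> \<le> t" "g - t < y k" using no u(2) a(2) by auto
        then show "g + t \<le> y k" by (auto simp: abs_if split: if_splits)
      qed
      then have "g + t \<le> g" using g[of g] by blast
      then show False using t by simp
    qed
    show ?case
    proof (rule bexI[of _ "p(k := g)"], intro allI impI)
      show "p(k := g) \<in> Fn m" using p(1) km by (auto simp: PiE_iff extensional_def)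
      fix t :: 'a assume "0 < t"
      then obtain y where "y \<in> D t" "\<bar>y k - g\<bar> \<le> t" using close by blast
      then show "\<exists>y\<in>C t. \<forall>i<Suc k. \<bar>y i - (p(k := g)) i\<bar> \<le> t"
        by (intro bexI[of _ y]) (auto simp: D_def less_Suc_eq)
    qed
  qed
  from this[of m] obtain p where p: "p \<in> Fn m" "\<And>t. 0 < t \<Longrightarrow> \<exists>y\<in>C t. \<forall>i<m. \<bar>y i - p i\<bar> \<le> t"
    by auto
  show ?thesis
  proof (rule bexI[OF _ p(1)], intro allI impI)
    fix t :: 'a assume t: "0 < t"
    define u where "u = t / of_nat (Suc m)"
    have u: "0 < u" unfolding u_def by (intro divide_pos_pos t of_nat_Suc_pos)
    have "u \<le> t" unfolding u_def pos_divide_le_eq[OF of_nat_Suc_pos] using t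
      by (simp add: algebra_simps)
    obtain y where y: "y \<in> C u" "\<forall>i<m. \<bar>y i - p i\<bar> \<le> u" using p(2)[OF u] by blast
    have "dst m y p < t" by (rule dst_less) (use y t in \<open>auto simp: u_def\<close>)
    then show "\<exists>y\<in>C t. dst m y p < t" using mono[OF \<open>u \<le> t\<close>] y(1) by blast
  qed
qed

end

section \<open>Continuous extension from closed definable sets\<close>

definition cont_at :: "nat \<Rightarrow> (nat \<Rightarrow> 'a::linordered_field) set \<Rightarrow> ((nat \<Rightarrow> 'a) \<Rightarrow> 'a) \<Rightarrow> (nat \<Rightarrow> 'a) \<Rightarrow> bool" where
  "cont_at n S h x \<longleftrightarrow> (\<forall>s>0. \<exists>d>0. \<forall>y\<in>S. dst n x y < d \<longrightarrow> \<bar>h y - h x\<bar> < s)"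

definition closed_in_Fn :: "nat \<Rightarrow> (nat \<Rightarrow> 'a::linordered_field) set \<Rightarrow> bool" where
  "closed_in_Fn n S \<longleftrightarrow> (\<forall>x\<in>Fn n. (\<forall>s>0. \<exists>y\<in>S. dst n x y < s) \<longrightarrow> x \<in> S)"

lemma cont_atD:
  assumes "cont_at n S h x" "0 < s"
  obtains d where "0 < d" "\<And>y. y \<in> S \<Longrightarrow> dst n x y < d \<Longrightarrow> \<bar>h y - h x\<bar> < s"
  using assms unfolding cont_at_def by blast

lemma cont_at_const: "cont_at n S (\<lambda>_. c) x"
  unfolding cont_at_def by (auto intro: exI[of _ 1])

lemma cont_at_subset: "cont_at n S h x \<Longrightarrow> R \<subseteq> S \<Longrightarrow> cont_at n R h x"
  unfolding cont_at_def by blast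

lemma cont_at_eventually_eq:
  assumes "cont_at n S h x" "0 < d" "\<And>y. y \<in> S \<Longrightarrow> dst n x y < d \<Longrightarrow> k y = h y" "k x = h x"
  shows "cont_at n S k x"
  unfolding cont_at_def
proof (intro allI impI)
  fix s :: 'a assume "0 < s"
  then obtain d' where d': "0 < d'" "\<And>y. y \<in> S \<Longrightarrow> dst n x y < d' \<Longrightarrow> \<bar>h y - h x\<bar> < s"
    using cont_atD[OF assms(1)] by blast
  show "\<exists>d>0. \<forall>y\<in>S. dst n x y < d \<longrightarrow> \<bar>k y - k x\<bar> < s"
    by (rule exI[of _ "min d d'"]) (use assms(2-) d' in auto)
qed

lemma cont_at_lipschitz:
  assumes "\<And>y. y \<in> S \<Longrightarrow> \<bar>h y - h x\<bar> \<le> c * dst n x y" "0 < c"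
  shows "cont_at n S h x"
  unfolding cont_at_def
proof (intro allI impI)
  fix s :: 'a assume s: "0 < s"
  have "\<bar>h y - h x\<bar> < s" if y: "y \<in> S" "dst n x y < s / c" for y
  proof -
    have "c * dst n x y < s" using y(2) assms(2) by (simp add: pos_less_divide_eq mult.commute)
    then show ?thesis using assms(1)[OF y(1)] by simp
  qed
  then show "\<exists>d>0. \<forall>y\<in>S. dst n x y < d \<longrightarrow> \<bar>h y - h x\<bar> < s"
    using s assms(2) by (intro exI[of _ "s / c"]) simp
qed

lemma cont_at_add_const: "cont_at n S h x \<Longrightarrow> cont_at n S (\<lambda>x. h x + c) x"
  unfolding cont_at_def by simp

lemma cont_at_one_plus_abs:
  assumes "cont_at n S h x" shows "cont_at n S (\<lambda>x. 1 + \<bar>h x\<bar>) x"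
proof -
  have "\<bar>\<bar>a\<bar> - \<bar>b\<bar>\<bar> \<le> \<bar>a - b\<bar>" for a b :: 'a by (rule abs_triangle_ineq3)
  then show ?thesis using assms unfolding cont_at_def by simp (meson le_less_trans)
qed

lemma cont_at_divide:
  fixes f g :: "(nat \<Rightarrow> 'a::linordered_field) \<Rightarrow> 'a"
  assumes f: "cont_at n S f x" and g: "cont_at n S g x" and pos: "0 < g x"
  shows "cont_at n S (\<lambda>x. f x / g x) x"
  unfolding cont_at_def
proof (intro allI impI)
  fix s :: 'a assume s: "0 < s"
  define c where "c = 2 * (g x + \<bar>f x\<bar>) + 1"
  have c: "0 < c" using pos by (simp add: c_def add_pos_nonneg)
  define \<eta> where "\<eta> = min (g x / 2) (s * (g x * g x) / c)"
  have \<eta>: "0 < \<eta>" using pos s c by (simp add: \<eta>_def)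
  obtain d1 where d1: "0 < d1" "\<And>y. y \<in> S \<Longrightarrow> dst n x y < d1 \<Longrightarrow> \<bar>f y - f x\<bar> < \<eta>"
    using cont_atD[OF f \<eta>] by blast
  obtain d2 where d2: "0 < d2" "\<And>y. y \<in> S \<Longrightarrow> dst n x y < d2 \<Longrightarrow> \<bar>g y - g x\<bar> < \<eta>"
    using cont_atD[OF g \<eta>] by blast
  have "\<bar>f y / g y - f x / g x\<bar> < s" if y: "y \<in> S" "dst n x y < min d1 d2" for y
  proof -
    have fy: "\<bar>f y - f x\<bar> < \<eta>" and gy: "\<bar>g y - g x\<bar> < \<eta>" using d1 d2 y by auto
    have "\<eta> \<le> g x / 2" unfolding \<eta>_def by (rule min.cobounded1)
    then have gy2: "g x < 2 * g y" using gy by (auto simp: abs_if field_simps split: if_splits)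
    then have gpos: "0 < g y" using pos by simp
    have "\<bar>(f y - f x) * g x - f x * (g y - g x)\<bar> \<le> \<bar>(f y - f x) * g x\<bar> + \<bar>f x * (g y - g x)\<bar>"
      by (rule abs_triangle_ineq4)
    also have "\<dots> \<le> \<eta> * g x + \<bar>f x\<bar> * \<eta>"
      using fy gy pos by (intro add_mono) (auto simp: abs_mult intro!: mult_right_mono mult_left_mono)
    also have "\<dots> = \<eta> * (c - 1) / 2" by (simp add: c_def field_simps)
    also have "\<dots> < \<eta> * c / 2" using \<eta> by (simp add: field_simps)
    also have "\<dots> \<le> s * (g x * g x) / 2"
    proof -
      have "\<eta> \<le> s * (g x * g x) / c" unfolding \<eta>_def by (rule min.cobounded2)
      then have "\<eta> * c \<le> s * (g x * g x)" using c by (simp add: pos_le_divide_eq)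
      then show ?thesis by simp
    qed
    also have "\<dots> \<le> s * (g y * g x)"
      using gy2 s pos mult_right_mono[of "g x" "2 * g y" "g x"] by (simp add: field_simps)
    finally have "\<bar>f y * g x - f x * g y\<bar> < s * (g y * g x)" by (simp add: algebra_simps)
    moreover have "f y / g y - f x / g x = (f y * g x - f x * g y) / (g y * g x)"
      using gpos pos by (simp add: field_simps)
    ultimately show ?thesis using gpos pos by (simp add: abs_divide abs_mult pos_divide_less_eq)
  qed
  then show "\<exists>d>0. \<forall>y\<in>S. dst n x y < d \<longrightarrow> \<bar>f y / g y - f x / g x\<bar> < s"
    using d1(1) d2(1) by (intro exI[of _ "min d1 d2"]) auto
qed

lemma cont_at_dst:
  assumes "\<And>i. i < m \<Longrightarrow> cont_at n S (\<lambda>x. v x i) x" "0 < s"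
  shows "\<exists>d>0. \<forall>y\<in>S. dst n x y < d \<longrightarrow> dst m (v x) (v y) < s"
  using assms
proof (induction m arbitrary: s)
  case 0
  then show ?case by (auto simp: dst_def intro: exI[of _ 1])
next
  case (Suc m)
  then obtain d1 where d1: "0 < d1" "\<forall>y\<in>S. dst n x y < d1 \<longrightarrow> dst m (v x) (v y) < s / 2"
    using Suc.IH[of "s / 2"] by auto
  obtain d2 where d2: "0 < d2" "\<And>y. y \<in> S \<Longrightarrow> dst n x y < d2 \<Longrightarrow> \<bar>v y m - v x m\<bar> < s / 2"
    using cont_atD[OF Suc.prems(1)[of m], of "s / 2"] Suc.prems(2) by auto
  have "dst (Suc m) (v x) (v y) < s" if "y \<in> S" "dst n x y < min d1 d2" for y
  proof -
    have "dst m (v x) (v y) < s / 2" "\<bar>v y m - v x m\<bar> < s / 2" using d1 d2 that by auto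
    then show ?thesis by (simp add: dst_Suc abs_minus_commute field_simps)
  qed
  then show ?case using d1 d2 by (intro exI[of _ "min d1 d2"]) auto
qed

context d_minimal_field
begin

text \<open>
  With \<open>d x\<close> the distance from \<open>x\<close> to \<open>B\<close>, the extension off \<open>B\<close> is
  \<open>sup {u b * max 0 (2 * d x - dst n x b) | b \<in> B} / d x\<close>. Since \<open>u\<close> is bounded, the supremum is
  Lipschitz in \<open>x\<close>. Only points \<open>b\<close> with \<open>dst n x b < 2 * d x\<close> contribute, and those nearly
  realising the distance have weight nearly \<open>d x\<close>, which gives continuity on \<open>B\<close>. Positive weights keep
  the extension positive.
\<close>

lemma extend_bounded:
  assumes B: "dset n B" "closed_in_Fn n B" "B \<noteq> {}" and u: "dfun n u"
    and range: "\<And>x. x \<in> B \<Longrightarrow> 0 < u x" "\<And>x. x \<in> B \<Longrightarrow> u x \<le> 2"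
    and cont: "\<And>x. x \<in> B \<Longrightarrow> cont_at n B u x"
  shows "\<exists>v. dfun n v \<and> (\<forall>x\<in>B. v x = u x) \<and>
    (\<forall>x\<in>Fn n. cont_at n (Fn n) v x) \<and> (\<forall>x\<in>Fn n. 0 < v x)"
proof -
  define d where "d = (\<lambda>x. glb {c. \<exists>b\<in>B. c = dst n x b})"
  have dd: "dfun n d" unfolding d_def
    by (intro dfun_glb drelI dfn_ex_set[OF B(1)] dfn_rules)
  have dglb: "isglb {c. \<exists>b\<in>B. c = dst n x b} (d x)" if x: "x \<in> Fn n" for x
    unfolding d_def
  proof (rule isglb_exists[where b = 0])
    show "dset1 {c. \<exists>b\<in>B. c = dst n x b}" unfolding dset1_def mem_Collect_eq
      by (intro dfn_ex_set[OF B(1)] dfn_rules dvec_const[OF x])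
  qed (use B(3) in auto)
  have d_le: "d x \<le> dst n x b" if "x \<in> Fn n" "b \<in> B" for x b
    using dglb[OF that(1)] that(2) unfolding isglb_def by blast
  have d_nn: "0 \<le> d x" if "x \<in> Fn n" for x
    using dglb[OF that] unfolding isglb_def by auto
  have d_near: "\<exists>b\<in>B. dst n x b < d x + s" if "x \<in> Fn n" "0 < s" for x s
  proof -
    have "\<not> d x + s \<le> d x" using that(2) by simp
    then show ?thesis using dglb[OF that(1)] unfolding isglb_def by (auto simp: not_le)
  qed
  have d_pos: "0 < d x" if "x \<in> Fn n" "x \<notin> B" for x
  proof (rule ccontr)
    assume "\<not> 0 < d x"
    then have "d x = 0" using d_nn[OF that(1)] by simp
    then have "\<forall>s>0. \<exists>y\<in>B. dst n x y < s" using d_near[OF that(1)] by simp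
    then show False using B(2) that unfolding closed_in_Fn_def by blast
  qed
  have d_lip: "d x \<le> d y + dst n x y" if "x \<in> Fn n" "y \<in> Fn n" for x y
  proof -
    have "d x - dst n x y \<le> dst n y b" if "b \<in> B" for b
      using d_le[OF \<open>x \<in> Fn n\<close> that] dst_triangle[of n x b y] by linarith
    then have "d x - dst n x y \<le> d y" using dglb[OF that(2)] unfolding isglb_def by blast
    then show ?thesis by simp
  qed
  define w where "w = (\<lambda>x b. max 0 (2 * d x - dst n x b))"
  \<comment> \<open>The supremum, written through the infimum of the negatives.\<close>
  define H where "H = (\<lambda>x. - glb {c. \<exists>b\<in>B. c = - (u b * w x b)})"
  have Hd: "dfun n H"
  proof -
    have Q: "drel n (\<lambda>x c. \<exists>b\<in>B. c = - (u b * w x b))" unfolding w_def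
      by (intro drelI dfn_ex_set[OF B(1)] dfn_rules dterm_fun[OF u] dterm_fun[OF dd])
    show ?thesis unfolding H_def
      by (intro dfunI dterm_uminus dterm_fun[OF dfun_glb[OF Q]] dvec_var_id)
  qed
  have w_le: "w x b \<le> d x" if "x \<in> Fn n" "b \<in> B" for x b
    using d_le[OF that] d_nn[OF that(1)] by (simp add: w_def)
  have w_nn: "0 \<le> w x b" for x b by (simp add: w_def)
  have uw: "u b * w x b \<le> 2 * d x" if "x \<in> Fn n" "b \<in> B" for x b
    using mult_mono[OF range(2)[OF that(2)] w_le[OF that]] w_nn by simp
  have Hglb: "isglb {c. \<exists>b\<in>B. c = - (u b * w x b)} (- H x)" if x: "x \<in> Fn n" for x
    unfolding H_def minus_minus
  proof (rule isglb_exists[where b = "- (2 * d x)"])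
    show "dset1 {c. \<exists>b\<in>B. c = - (u b * w x b)}" unfolding dset1_def mem_Collect_eq w_def
      by (intro dfn_ex_set[OF B(1)] dfn_rules dvec_const[OF x] dterm_fun[OF u] dterm_fun[OF dd])
    show "- (2 * d x) \<le> a" if "a \<in> {c. \<exists>b\<in>B. c = - (u b * w x b)}" for a
      using that uw[OF x] by auto
  qed (use B(3) in auto)
  have H_ge: "u b * w x b \<le> H x" if "x \<in> Fn n" "b \<in> B" for x b
  proof -
    have "- H x \<le> - (u b * w x b)" using Hglb[OF that(1)] that(2) unfolding isglb_def by blast
    then show ?thesis by simp
  qed
  have H_le: "H x \<le> c" if x: "x \<in> Fn n" and c: "\<And>b. b \<in> B \<Longrightarrow> u b * w x b \<le> c" for x c
  proof -
    have "- c \<le> - H x" using Hglb[OF x] c unfolding isglb_def by auto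
    then show ?thesis by simp
  qed
  have H_lip: "H x \<le> H y + 6 * dst n x y" if xy: "x \<in> Fn n" "y \<in> Fn n" for x y
  proof (rule H_le[OF xy(1)])
    fix b assume b: "b \<in> B"
    have "2 * d x - dst n x b \<le> (2 * d y - dst n y b) + 3 * dst n x y"
      using d_lip[OF xy] dst_triangle[of n y b x] by (simp add: dst_commute[of n y x])
    then have "w x b \<le> w y b + 3 * dst n x y" unfolding w_def by (auto simp: max_def)
    then have "u b * w x b \<le> u b * (w y b + 3 * dst n x y)"
      using range(1)[OF b] by (intro mult_left_mono) auto
    also have "\<dots> = u b * w y b + u b * (3 * dst n x y)" by (simp add: algebra_simps)
    also have "\<dots> \<le> H y + 2 * (3 * dst n x y)"
      using range(2)[OF b] by (intro add_mono H_ge[OF xy(2) b] mult_right_mono) auto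
    finally show "u b * w x b \<le> H y + 6 * dst n x y" by simp
  qed
  define v where "v = (\<lambda>x. if x \<in> B then u x else H x / d x)"
  have vd: "dfun n v" unfolding v_def
    by (intro dfunI dterm_if dfn_set[OF B(1)] dterm_divide dterm_fun[OF u] dterm_fun[OF Hd]
        dterm_fun[OF dd] dvec_var_id)
  have v_pos: "0 < v x" if x: "x \<in> Fn n" for x
  proof (cases "x \<in> B")
    case True
    then show ?thesis using range(1) by (simp add: v_def)
  next
    case False
    have dx: "0 < d x" by (rule d_pos[OF x False])
    obtain b where b: "b \<in> B" "dst n x b < d x + d x" using d_near[OF x dx] by blast
    have "0 < u b * w x b" using range(1)[OF b(1)] b(2) by (simp add: w_def)
    also have "\<dots> \<le> H x" by (rule H_ge[OF x b(1)])
    finally show ?thesis using dx False by (simp add: v_def)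
  qed
  have v_cont: "cont_at n (Fn n) v x" if x: "x \<in> Fn n" for x
  proof (cases "x \<in> B")
    case False
    have dx: "0 < d x" by (rule d_pos[OF x False])
    have "cont_at n (Fn n) H x"
    proof (rule cont_at_lipschitz[where c = 6])
      show "\<bar>H y - H x\<bar> \<le> 6 * dst n x y" if "y \<in> Fn n" for y
        using H_lip[OF x that] H_lip[OF that x] by (simp add: abs_le_iff dst_commute[of n y x])
    qed simp
    moreover have "cont_at n (Fn n) d x"
    proof (rule cont_at_lipschitz[where c = 1])
      show "\<bar>d y - d x\<bar> \<le> 1 * dst n x y" if "y \<in> Fn n" for y
        using d_lip[OF x that] d_lip[OF that x] by (simp add: abs_le_iff dst_commute[of n y x])
    qed simp
    ultimately have "cont_at n (Fn n) (\<lambda>x. H x / d x) x" using dx by (rule cont_at_divide)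
    then show ?thesis
    proof (rule cont_at_eventually_eq[OF _ dx])
      show "v y = H y / d y" if "y \<in> Fn n" "dst n x y < d x" for y
        using d_le[OF x, of y] that by (auto simp: v_def)
    qed (simp add: v_def False)
  next
    case True
    show ?thesis unfolding cont_at_def
    proof (intro allI impI)
      fix s :: 'a assume s: "0 < s"
      obtain r where r: "0 < r" "\<And>y. y \<in> B \<Longrightarrow> dst n x y < r \<Longrightarrow> \<bar>u y - u x\<bar> < s / 2"
        using cont_atD[OF cont[OF True], of "s / 2"] s by auto
      have "\<bar>v y - v x\<bar> < s" if y: "y \<in> Fn n" "dst n x y < r / 3" for y
      proof (cases "y \<in> B")
        case yB: True
        then show ?thesis using r(2)[of y] y(2) r(1) s True by (auto simp: v_def field_simps)
      next
        case yB: False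
        have dy: "0 < d y" by (rule d_pos[OF y(1) yB])
        have dyr: "d y < r / 3" using d_le[OF y(1) True] y(2) by (simp add: dst_commute[of n y x])
        have near: "\<bar>u b - u x\<bar> < s / 2" if b: "b \<in> B" "dst n y b < 2 * d y" for b
        proof (rule r(2)[OF b(1)])
          show "dst n x b < r" using dst_triangle[of n x b y] y(2) b(2) dyr by linarith
        qed
        have ux: "0 < u x" by (rule range(1)[OF True])
        have "H y \<le> (u x + s / 2) * d y"
        proof (rule H_le[OF y(1)])
          fix b assume b: "b \<in> B"
          show "u b * w y b \<le> (u x + s / 2) * d y"
          proof (cases "dst n y b < 2 * d y")
            case True
            then show ?thesis using near[OF b True] ux s
              by (intro mult_mono w_le[OF y(1) b] w_nn) (auto simp: abs_if split: if_splits)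
          next
            case False
            then have "w y b = 0" by (simp add: w_def)
            then show ?thesis using ux s dy by simp
          qed
        qed
        then have upper: "H y / d y \<le> u x + s / 2" using dy by (simp add: pos_divide_le_eq)
        define \<eta> where "\<eta> = min 1 (s / 8)"
        have \<eta>: "0 < \<eta>" "\<eta> \<le> 1" "\<eta> \<le> s / 8" using s by (auto simp: \<eta>_def)
        obtain b where b: "b \<in> B" "dst n y b < d y + \<eta> * d y"
          using d_near[OF y(1), of "\<eta> * d y"] \<eta> dy by auto
        have "\<eta> * d y \<le> d y" using \<eta> dy by simp
        then have "\<bar>u b - u x\<bar> < s / 2" using b by (intro near) auto
        then have ub: "u x - s / 2 \<le> u b" by (auto simp: abs_if split: if_splits)
        have "(1 - \<eta>) * d y \<le> w y b" using b(2) by (simp add: w_def algebra_simps max_def)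
        then have "u b * ((1 - \<eta>) * d y) \<le> u b * w y b"
          using range(1)[OF b(1)] by (intro mult_left_mono) auto
        also have "\<dots> \<le> H y" by (rule H_ge[OF y(1) b(1)])
        finally have "u b * (1 - \<eta>) * d y \<le> H y" by (simp add: mult.assoc)
        then have "u b * (1 - \<eta>) \<le> H y / d y" using dy by (simp add: pos_le_divide_eq)
        moreover have "u b * \<eta> \<le> 2 * \<eta>" using range(2)[OF b(1)] \<eta>(1) by simp
        then have "u b - 2 * \<eta> \<le> u b * (1 - \<eta>)" by (simp add: algebra_simps)
        ultimately have lower: "u x - s / 2 - s / 4 \<le> H y / d y" using ub \<eta>(3) by simp
        have "\<bar>H y / d y - u x\<bar> < s" using upper lower s by (auto simp: abs_if)
        then show ?thesis using yB True by (simp add: v_def)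
      qed
      then show "\<exists>d>0. \<forall>y\<in>Fn n. dst n x y < d \<longrightarrow> \<bar>v y - v x\<bar> < s"
        using r(1) by (intro exI[of _ "r / 3"]) auto
    qed
  qed
  have "\<forall>x\<in>B. v x = u x" by (simp add: v_def)
  then show ?thesis using vd v_cont v_pos by blast
qed

text \<open>
  An unbounded \<open>g\<close> is the quotient of the bounded functions \<open>g / (1 + \<bar>g\<bar>)\<close> and \<open>1 / (1 + \<bar>g\<bar>)\<close>. The
  first is shifted by \<open>1\<close> to be positive; the extension of the second has no zero because it is
  positive.
\<close>

lemma tietze_extension:
  assumes B: "dset n B" "closed_in_Fn n B" and g: "dfun n g"
    and cont: "\<And>x. x \<in> B \<Longrightarrow> cont_at n B g x"
  shows "\<exists>h. dfun n h \<and> (\<forall>x\<in>B. h x = g x) \<and> (\<forall>x\<in>Fn n. cont_at n (Fn n) h x)"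
proof (cases "B = {}")
  case True
  have "dfun n (\<lambda>_. 0)" by (intro dfunI dterm_const)
  then show ?thesis using True cont_at_const by blast
next
  case False
  have one: "0 < 1 + \<bar>a\<bar>" for a :: 'a by (simp add: add_pos_nonneg)
  define p where "p = (\<lambda>x. g x / (1 + \<bar>g x\<bar>) + 1)"
  define q where "q = (\<lambda>x. 1 / (1 + \<bar>g x\<bar>))"
  have gt: "dterm (\<lambda>e. g (\<lambda>i\<in>{..<n}. e i))" by (rule dterm_fun[OF g dvec_var_id])
  have pd: "dfun n p" and qd: "dfun n q"
    unfolding p_def q_def by (intro dfunI dfn_rules gt)+
  have p_range: "0 < p x" "p x \<le> 2" for x
  proof -
    have "- (1 + \<bar>g x\<bar>) < g x" "g x \<le> 1 + \<bar>g x\<bar>" by (auto simp: abs_if)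
    then have "- 1 < g x / (1 + \<bar>g x\<bar>)" "g x / (1 + \<bar>g x\<bar>) \<le> 1"
      using one[of "g x"] by (simp_all add: pos_less_divide_eq pos_divide_le_eq)
    then show "0 < p x" "p x \<le> 2" by (simp_all add: p_def)
  qed
  have q_range: "0 < q x" "q x \<le> 2" for x
    using one[of "g x"] by (simp_all add: q_def pos_divide_le_eq)
  have one_cont: "cont_at n B (\<lambda>x. 1 + \<bar>g x\<bar>) x" if "x \<in> B" for x
    by (rule cont_at_one_plus_abs[OF cont[OF that]])
  have p_cont: "cont_at n B p x" if "x \<in> B" for x unfolding p_def
    by (rule cont_at_add_const[OF cont_at_divide[OF cont[OF that] one_cont[OF that] one]])
  have q_cont: "cont_at n B q x" if "x \<in> B" for x unfolding q_def
    by (rule cont_at_divide[OF cont_at_const one_cont[OF that] one])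
  obtain P where P: "dfun n P" "\<forall>x\<in>B. P x = p x" "\<forall>x\<in>Fn n. cont_at n (Fn n) P x"
    using extend_bounded[OF B False pd p_range p_cont] by blast
  obtain Q where Q: "dfun n Q" "\<forall>x\<in>B. Q x = q x" "\<forall>x\<in>Fn n. cont_at n (Fn n) Q x"
    "\<forall>x\<in>Fn n. 0 < Q x"
    using extend_bounded[OF B False qd q_range q_cont] by blast
  define h where "h = (\<lambda>x. (P x + - 1) / Q x)"
  have "dfun n h" unfolding h_def
    by (intro dfunI dfn_rules dterm_fun[OF P(1)] dterm_fun[OF Q(1)])
  moreover have "h x = g x" if "x \<in> B" for x
    using one[of "g x"] P(2) Q(2) that by (simp add: h_def p_def q_def)
  moreover have "cont_at n (Fn n) h x" if "x \<in> Fn n" for x unfolding h_def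
    by (intro cont_at_divide cont_at_add_const P(3)[rule_format] Q(3,4)[rule_format] that)
  ultimately show ?thesis by blast
qed

end

section \<open>Nearest points in closed convex sets\<close>

definition sqd :: "nat \<Rightarrow> (nat \<Rightarrow> 'a::linordered_field) \<Rightarrow> (nat \<Rightarrow> 'a) \<Rightarrow> 'a" where
  "sqd m x y = (\<Sum>i<m. (x i - y i) * (x i - y i))"

lemma sqd_nonneg [simp]: "0 \<le> sqd m x y"
  unfolding sqd_def by (intro sum_nonneg) simp

lemma sqd_le_dst: "sqd m x y \<le> dst m x y * dst m x y"
proof -
  have "sqd m x y = (\<Sum>i<m. \<bar>x i - y i\<bar> * \<bar>x i - y i\<bar>)"
    unfolding sqd_def by (simp add: abs_mult_self_eq)
  also have "\<dots> \<le> (\<Sum>i<m. \<bar>x i - y i\<bar> * dst m x y)"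
    by (intro sum_mono mult_left_mono dst_coord) auto
  also have "\<dots> = dst m x y * dst m x y" by (simp add: dst_def sum_distrib_right)
  finally show ?thesis .
qed

lemma sqd_coord:
  assumes "sqd m x y \<le> K * K" "0 \<le> K" "i < m" shows "\<bar>x i - y i\<bar> \<le> K"
proof -
  have "(x i - y i) * (x i - y i) \<le> sqd m x y"
    unfolding sqd_def by (rule member_le_sum[of i _ "\<lambda>i. (x i - y i) * (x i - y i)"]) (use assms in auto)
  then have "(x i - y i)\<^sup>2 \<le> K\<^sup>2" using assms(1) by (simp add: power2_eq_square)
  then show ?thesis using abs_le_square_iff[of "x i - y i" K] assms(2) by simp
qed

text \<open>
  Moving the two arguments slightly changes the squared distance slightly.
\<close>

lemma sqd_diff:
  "sqd m a c \<le> sqd m b d + (dst m a b + dst m c d) * (dst m a c + dst m b d)"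
proof -
  have "sqd m a c - sqd m b d = (\<Sum>i<m. ((a i - b i) - (c i - d i)) * ((a i - c i) + (b i - d i)))"
    unfolding sqd_def sum_subtractf[symmetric] by (intro sum.cong) (auto simp: algebra_simps)
  also have "\<dots> \<le> (\<Sum>i<m. (\<bar>a i - b i\<bar> + \<bar>c i - d i\<bar>) * (dst m a c + dst m b d))"
  proof (rule sum_mono)
    fix i assume "i \<in> {..<m}"
    then have i: "i < m" by simp
    have "((a i - b i) - (c i - d i)) * ((a i - c i) + (b i - d i)) \<le>
        \<bar>(a i - b i) - (c i - d i)\<bar> * \<bar>(a i - c i) + (b i - d i)\<bar>"
      by (metis abs_ge_self abs_mult)
    also have "\<dots> \<le> (\<bar>a i - b i\<bar> + \<bar>c i - d i\<bar>) * (\<bar>a i - c i\<bar> + \<bar>b i - d i\<bar>)"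
      by (intro mult_mono abs_triangle_ineq abs_triangle_ineq4) auto
    also have "\<dots> \<le> (\<bar>a i - b i\<bar> + \<bar>c i - d i\<bar>) * (dst m a c + dst m b d)"
      by (intro mult_left_mono add_mono dst_coord i) auto
    finally show "((a i - b i) - (c i - d i)) * ((a i - c i) + (b i - d i)) \<le>
        (\<bar>a i - b i\<bar> + \<bar>c i - d i\<bar>) * (dst m a c + dst m b d)" .
  qed
  also have "\<dots> = (dst m a b + dst m c d) * (dst m a c + dst m b d)"
    by (simp add: dst_def sum_distrib_right[symmetric] sum.distrib)
  finally show ?thesis by simp
qed

text \<open>
  The parallelogram law; the coefficients are spelled as in the definition of convexity.
\<close>

lemma sqd_midpoint:
  "4 * sqd m (\<lambda>i\<in>{..<m}. (1 - 1/2) * x i + 1/2 * y i) z + sqd m x y = 2 * sqd m x z + 2 * sqd m y z"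
  unfolding sqd_def sum_distrib_left sum.distrib[symmetric]
  by (intro sum.cong) (auto simp: field_simps)

lemma sqd_0: assumes "sqd m x y \<le> 0" "i < m" shows "x i = y i"
  using sqd_coord[of m x y 0 i] assms by simp

lemma le_limit:
  fixes a b c :: "'a::linordered_field"
  assumes "\<And>t. 0 < t \<Longrightarrow> t \<le> 1 \<Longrightarrow> a \<le> b + t * c" "0 \<le> c" shows "a \<le> b"
proof (rule ccontr)
  assume "\<not> a \<le> b"
  then have ab: "0 < a - b" by simp
  define t where "t = min 1 ((a - b) / (c + 1))"
  have c1: "0 < c + 1" using assms(2) by simp
  have t: "0 < t" "t \<le> 1" "t \<le> (a - b) / (c + 1)" using ab c1 by (auto simp: t_def)
  have "t * (c + 1) \<le> a - b" using t(3) c1 by (simp add: pos_le_divide_eq)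
  moreover have "a \<le> b + t * c" using assms(1)[OF t(1,2)] .
  ultimately show False using t(1) by (simp add: algebra_simps)
qed

context d_minimal_field
begin

lemma dterm_sqd: "dvec n X \<Longrightarrow> dvec n Y \<Longrightarrow> dterm (\<lambda>e. sqd n (X e) (Y e))"
  unfolding sqd_def by (intro dterm_sum dterm_mult dterm_diff dvec_comp) auto

text \<open>
  The hypotheses of the theorem in metric terms. Values of \<open>T\<close> outside \<open>E\<close> are arbitrary, so the
  definability clause speaks about the graph over \<open>E\<close>.
\<close>

definition lsc_convex_family :: "nat \<Rightarrow> nat \<Rightarrow> (nat \<Rightarrow> 'a) set \<Rightarrow> ((nat \<Rightarrow> 'a) \<Rightarrow> (nat \<Rightarrow> 'a) set) \<Rightarrow> bool" where
  "lsc_convex_family n m E T \<longleftrightarrow> dset n E \<and> closed_in_Fn n E \<and>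
     (\<forall>X Y. dvec n X \<longrightarrow> dvec m Y \<longrightarrow> dfn (\<lambda>e. X e \<in> E \<and> Y e \<in> T (X e))) \<and>
     (\<forall>x\<in>E. T x \<noteq> {} \<and> T x \<subseteq> Fn m \<and> closed_in_Fn m (T x) \<and> convex_in_power m (T x)) \<and>
     (\<forall>x\<in>E. \<forall>y\<in>T x. \<forall>s>0. \<exists>d>0. \<forall>z\<in>E. dst n x z < d \<longrightarrow> (\<exists>w\<in>T z. dst m y w < s))"

lemma familyD:
  assumes "lsc_convex_family n m E T"
  shows "dset n E" "closed_in_Fn n E"
    "\<And>X Y. dvec n X \<Longrightarrow> dvec m Y \<Longrightarrow> dfn (\<lambda>e. X e \<in> E \<and> Y e \<in> T (X e))"
    "\<And>x. x \<in> E \<Longrightarrow> T x \<noteq> {}" "\<And>x y. x \<in> E \<Longrightarrow> y \<in> T x \<Longrightarrow> y \<in> Fn m"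
    "\<And>x. x \<in> E \<Longrightarrow> closed_in_Fn m (T x)" "\<And>x. x \<in> E \<Longrightarrow> convex_in_power m (T x)"
  using assms unfolding lsc_convex_family_def by blast+

lemma family_lsc:
  assumes "lsc_convex_family n m E T" "x \<in> E" "y \<in> T x" "0 < s"
  obtains d where "0 < d" "\<forall>z\<in>E. dst n x z < d \<longrightarrow> (\<exists>w\<in>T z. dst m y w < s)"
proof -
  have "\<forall>x\<in>E. \<forall>y\<in>T x. \<forall>s>0. \<exists>d>0. \<forall>z\<in>E. dst n x z < d \<longrightarrow> (\<exists>w\<in>T z. dst m y w < s)"
    using assms(1) unfolding lsc_convex_family_def by (elim conjE)
  then show thesis using assms(2-) that by blast
qed

lemma family_restrict:
  assumes T: "lsc_convex_family n m E T" and B: "dset n B" "closed_in_Fn n B" "B \<subseteq> E"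
  shows "lsc_convex_family n m B T"
  unfolding lsc_convex_family_def
proof (intro conjI allI impI ballI B(1,2))
  show "dfn (\<lambda>e. X e \<in> B \<and> Y e \<in> T (X e))" if XY: "dvec n X" "dvec m Y" for X Y
  proof -
    have "dfn (\<lambda>e. X e \<in> B \<and> X e \<in> E \<and> Y e \<in> T (X e))"
      by (intro dfn_conj[OF dfn_set[OF B(1) XY(1)] familyD(3)[OF T XY]])
    moreover have "(X e \<in> B \<and> X e \<in> E \<and> Y e \<in> T (X e)) = (X e \<in> B \<and> Y e \<in> T (X e))" for e
      using B(3) by blast
    ultimately show ?thesis by simp
  qed
  fix x assume "x \<in> B"
  then have x: "x \<in> E" using B(3) by blast
  show "T x \<noteq> {}" "closed_in_Fn m (T x)" "convex_in_power m (T x)"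
    by (rule familyD(4)[OF T x], rule familyD(6)[OF T x], rule familyD(7)[OF T x])
  show "T x \<subseteq> Fn m" using familyD(5)[OF T x] by blast
  fix y s assume "y \<in> T x" "(0::'a) < s"
  then obtain d where "0 < d" "\<forall>z\<in>E. dst n x z < d \<longrightarrow> (\<exists>w\<in>T z. dst m y w < s)"
    using family_lsc[OF T x] by blast
  then show "\<exists>d>0. \<forall>z\<in>B. dst n x z < d \<longrightarrow> (\<exists>w\<in>T z. dst m y w < s)" using B(3) by blast
qed

definition nearest_pt :: "nat \<Rightarrow> (nat \<Rightarrow> 'a) set \<Rightarrow> (nat \<Rightarrow> 'a) \<Rightarrow> (nat \<Rightarrow> 'a) \<Rightarrow> bool" where
  "nearest_pt m S z y \<longleftrightarrow> y \<in> S \<and> (\<forall>w\<in>S. sqd m y z \<le> sqd m w z)"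

text \<open>
  The midpoint of two nearest points would be nearer.
\<close>

lemma nearest_pt_unique:
  assumes S: "convex_in_power m S" "S \<subseteq> Fn m" and x: "nearest_pt m S z x" and y: "nearest_pt m S z y"
  shows "x = y"
proof (rule Fn_cong)
  have xy: "x \<in> S" "y \<in> S" using x y by (auto simp: nearest_pt_def)
  then show "x \<in> Fn m" "y \<in> Fn m" using S(2) by blast+
  let ?w = "\<lambda>i\<in>{..<m}. (1 - 1/2) * x i + 1/2 * y i"
  have "\<forall>t. 0 \<le> t \<and> t \<le> 1 \<longrightarrow> (\<lambda>i\<in>{..<m}. (1 - t) * x i + t * y i) \<in> S"
    using S(1) xy unfolding convex_in_power_def by blast
  then have "0 \<le> (1/2 :: 'a) \<and> 1/2 \<le> (1 :: 'a) \<longrightarrow> ?w \<in> S" by (rule spec)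
  then have "?w \<in> S" by (rule mp) simp
  then have "sqd m x z \<le> sqd m ?w z" "sqd m y z \<le> sqd m ?w z" using x y unfolding nearest_pt_def by blast+
  then have "sqd m x y \<le> 0" using sqd_midpoint[of m x y z] by linarith
  then show "x i = y i" if "i < m" for i using sqd_0 that by blast
qed

text \<open>
  A cluster point of points of \<open>S\<close> whose squared distance to \<open>z\<close> tends to the infimum.
\<close>

lemma nearest_pt_exists:
  assumes S: "dset m S" "S \<noteq> {}" "closed_in_Fn m S" and z: "z \<in> Fn m"
  shows "\<exists>y. nearest_pt m S z y"
proof -
  define r where "r = glb {c. \<exists>w\<in>S. c = sqd m w z}"
  have r: "isglb {c. \<exists>w\<in>S. c = sqd m w z} r" unfolding r_def
  proof (rule isglb_exists[where b = 0])
    show "dset1 {c. \<exists>w\<in>S. c = sqd m w z}" unfolding dset1_def mem_Collect_eq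
      by (intro dfn_ex_set[OF S(1)] dfn_rules dterm_sqd dvec_const[OF z])
  qed (use S(2) in auto)
  have r_le: "r \<le> sqd m w z" if "w \<in> S" for w using r that unfolding isglb_def by blast
  define C where "C = (\<lambda>t. {y\<in>S. sqd m y z \<le> r + t})"
  have Cd: "drel m (\<lambda>y t. y \<in> C t)" unfolding C_def mem_Collect_eq
    by (intro drelI dfn_rules dfn_set[OF S(1)] dterm_sqd dvec_const[OF z])
  have CF: "C t \<subseteq> Fn m" for t using dset_subset[OF S(1)] by (auto simp: C_def)
  have Cne: "C t \<noteq> {}" if "0 < t" for t
  proof -
    have "\<not> r + t \<le> r" using that by simp
    then show ?thesis using r unfolding isglb_def by (auto simp: not_le C_def intro: less_imp_le)
  qed
  have Cmono: "C t \<subseteq> C u" if "t \<le> u" for t u using that by (auto simp: C_def)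
  define K where "K = \<bar>r + 1\<bar> + 1"
  have K: "0 \<le> K" "r + 1 \<le> K * K"
  proof -
    show "0 \<le> K" by (simp add: K_def)
    have "r + 1 \<le> K" by (simp add: K_def)
    also have "K * 1 \<le> K * K" by (intro mult_left_mono) (auto simp: K_def)
    finally show "r + 1 \<le> K * K" by simp
  qed
  have Cbd: "\<bar>y i\<bar> \<le> K + dst m z (\<lambda>_. 0)" if y: "y \<in> C 1" "i < m" for y i
  proof -
    have "sqd m y z \<le> K * K" using y(1) K(2) by (auto simp: C_def)
    then have "\<bar>y i - z i\<bar> \<le> K" using sqd_coord K(1) y(2) by blast
    moreover have "\<bar>z i\<bar> \<le> dst m z (\<lambda>_. 0)" using dst_coord[OF y(2), of z "\<lambda>_. 0"] by simp
    ultimately show ?thesis by linarith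
  qed
  have "\<exists>p\<in>Fn m. \<forall>t>0. \<exists>y\<in>C t. dst m y p < t"
    by (rule definable_cluster_point[where ?t1.0 = 1 and b = "K + dst m z (\<lambda>_. 0)"])
      (fact Cd CF Cne Cmono zero_less_one Cbd)+
  then obtain p where p: "p \<in> Fn m" "\<And>t. 0 < t \<Longrightarrow> \<exists>y\<in>C t. dst m y p < t" by blast
  have "p \<in> S"
  proof -
    have "\<exists>y\<in>S. dst m p y < s" if "0 < s" for s
      using p(2)[OF that] by (auto simp: C_def dst_commute)
    then show ?thesis using S(3) p(1) unfolding closed_in_Fn_def by blast
  qed
  moreover have "sqd m p z \<le> r"
  proof (rule le_limit[where c = "1 + (2 * dst m p z + 1)"])
    fix t :: 'a assume t: "0 < t" "t \<le> 1"
    obtain y where y: "y \<in> C t" "dst m y p < t" using p(2)[OF t(1)] by blast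
    have pz: "dst m y z \<le> dst m p z + 1" using dst_triangle[of m y z p] y(2) t(2) by linarith
    have "sqd m p z \<le> sqd m y z + (dst m p y + dst m z z) * (dst m p z + dst m y z)" by (rule sqd_diff)
    also have "\<dots> \<le> (r + t) + t * (2 * dst m p z + 1)"
    proof (rule add_mono)
      show "sqd m y z \<le> r + t" using y(1) by (simp add: C_def)
      show "(dst m p y + dst m z z) * (dst m p z + dst m y z) \<le> t * (2 * dst m p z + 1)"
        using y(2) t pz by (intro mult_mono) (simp_all add: dst_commute[of m p y])
    qed
    finally show "sqd m p z \<le> r + t * (1 + (2 * dst m p z + 1))" by (simp add: algebra_simps)
  qed simp
  ultimately show ?thesis using r_le unfolding nearest_pt_def by (blast intro: order_trans)
qed

section \<open>Extending a selection over the points where the graph is closed\<close>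

text \<open>
  The points of \<open>E\<close> over which the graph of \<open>T\<close> is not closed: some limit \<open>(x, y)\<close> of points of the
  graph is not in the graph. Membership in the graph is spelled out as membership in \<open>E\<close> and in \<open>T x\<close>,
  the form in which \<open>lsc_convex_family\<close> makes it definable.
\<close>

definition gap_pts :: "nat \<Rightarrow> nat \<Rightarrow> ((nat \<Rightarrow> 'a) \<Rightarrow> (nat \<Rightarrow> 'a) set) \<Rightarrow> (nat \<Rightarrow> 'a) set \<Rightarrow> (nat \<Rightarrow> 'a) set" where
  "gap_pts n m T E = {x\<in>E. \<exists>y\<in>Fn m. \<not> (x \<in> E \<and> y \<in> T x) \<and>
     (\<forall>d. 0 < d \<longrightarrow> (\<exists>x'\<in>E. \<exists>y'\<in>Fn m. dst n x x' < d \<and> dst m y y' < d \<and> x' \<in> E \<and> y' \<in> T x'))}"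

definition gap_closure :: "nat \<Rightarrow> nat \<Rightarrow> ((nat \<Rightarrow> 'a) \<Rightarrow> (nat \<Rightarrow> 'a) set) \<Rightarrow> (nat \<Rightarrow> 'a) set \<Rightarrow> (nat \<Rightarrow> 'a) set" where
  "gap_closure n m T E = {x\<in>E. \<forall>d. 0 < d \<longrightarrow> (\<exists>x'\<in>gap_pts n m T E. dst n x x' < d)}"

lemma dset_gap_pts:
  assumes T: "lsc_convex_family n m E T" shows "dset n (gap_pts n m T E)"
  unfolding gap_pts_def
  by (intro dset_Collect[OF familyD(1)[OF T]] dfn_ex_set[OF familyD(1)[OF T]] dfn_rules familyD(3)[OF T])

lemma gap_pts_subset: "gap_pts n m T E \<subseteq> E"
  by (auto simp: gap_pts_def)

text \<open>
  Otherwise choose, over a relatively open part, limits \<open>y\<close> of the graph at distance at least \<open>s\<close> from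
  \<open>T x\<close>, all of them within \<open>s / 4\<close> of one point \<open>y0\<close>. Near \<open>y0\<close> the graph has no points over this part,
  although the chosen limits are limits of such points.
\<close>

lemma thin_gap_pts:
  assumes T: "lsc_convex_family n m E T" shows "thin n E (gap_pts n m T E)"
  unfolding thin_def
proof (intro allI impI notI)
  fix V assume V: "open_part n E V" "V \<subseteq> gap_pts n m T E"
  note Ed = familyD(1)[OF T] and VD = open_partD[OF V(1)]
  define R where "R = (\<lambda>x y s.
     (\<forall>d. 0 < d \<longrightarrow> (\<exists>x'\<in>E. \<exists>y'\<in>Fn m. dst n x x' < d \<and> dst m y y' < d \<and> x' \<in> E \<and> y' \<in> T x')) \<and>
     (\<forall>y'\<in>Fn m. x \<in> E \<and> y' \<in> T x \<longrightarrow> s \<le> dst m y y'))"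
  have Rd: "dfn (\<lambda>e. R (X e) (Y e) (t e))" if XYt: "dvec n X" "dvec m Y" "dterm t" for X Y t
    unfolding R_def
    by (intro dfn_ex_set[OF Ed] dfn_rules familyD(3)[OF T] dvec_reindex[OF XYt(1)]
        dvec_reindex[OF XYt(2)] dterm_reindex[OF XYt(3)] XYt)
  have Rex: "\<exists>y\<in>Fn m. \<exists>s>0. R z y s" if z: "z \<in> V" for z
  proof -
    have "z \<in> gap_pts n m T E" using V(2) z by blast
    then obtain y where y: "y \<in> Fn m" "y \<notin> T z" "z \<in> E"
      "\<forall>d. 0 < d \<longrightarrow> (\<exists>x'\<in>E. \<exists>y'\<in>Fn m. dst n z x' < d \<and> dst m y y' < d \<and> x' \<in> E \<and> y' \<in> T x')"
      unfolding gap_pts_def by blast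
    obtain s where s: "0 < s" "\<And>y'. y' \<in> T z \<Longrightarrow> \<not> dst m y y' < s"
      using familyD(6)[OF T y(3)] y(1,2) unfolding closed_in_Fn_def by blast
    have "R z y s" unfolding R_def
    proof (intro conjI y(4) ballI impI)
      show "s \<le> dst m y y'" if "z \<in> E \<and> y' \<in> T z" for y' using s(2)[of y'] that by simp
    qed
    then show ?thesis using y(1) s(1) by blast
  qed
  have Rmono: "R x y s'" if "R x y s" "0 < s'" "s' \<le> s" for x y s s'
    using that unfolding R_def by (blast intro: order_trans)
  obtain W s y0 where W: "open_part n V W" "0 < s"
    "\<forall>x\<in>W. \<exists>y\<in>Fn m. R x y s \<and> dst m y y0 < s / 4"
    by (rule uniform_vector_choice[OF VD(1,2) Rd Rex Rmono])
  obtain x0 where x0: "x0 \<in> W" using open_partD(2)[OF W(1)] by blast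
  obtain y1 where y1: "R x0 y1 s" "dst m y1 y0 < s / 4" using W(3) x0 by blast
  obtain d where d: "0 < d" "\<forall>z\<in>E. dst n x0 z < d \<longrightarrow> z \<in> W"
    using open_partD(4)[OF open_part_trans[OF V(1) W(1)] x0] by blast
  \<comment> \<open>A point of the graph this near to \<open>(x0, y1)\<close> lies over \<open>W\<close>, and its value is too near to
    \<open>y0\<close>.\<close>
  define \<delta> where "\<delta> = min d (s / 4)"
  have "0 < \<delta>" using W(2) d(1) by (simp add: \<delta>_def)
  then obtain x' y' where x': "x' \<in> E" "y' \<in> Fn m" "dst n x0 x' < \<delta>" "dst m y1 y' < \<delta>" "y' \<in> T x'"
    using y1(1) unfolding R_def by blast
  then have close: "x' \<in> W" "dst m y1 y' < s / 4" using d(2) by (auto simp: \<delta>_def)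
  obtain y2 where y2: "R x' y2 s" "dst m y2 y0 < s / 4" using W(3) close(1) by blast
  have "s \<le> dst m y2 y'" using y2(1) x' unfolding R_def by blast
  also have "\<dots> \<le> dst m y2 y0 + (dst m y0 y1 + dst m y1 y')"
    using dst_triangle[of m y2 y' y0] dst_triangle[of m y0 y' y1] by linarith
  also have "\<dots> < s / 4 + (s / 4 + s / 4)"
    using y2(2) y1(2) close(2) by (intro add_strict_mono) (auto simp: dst_commute[of m y0 y1])
  finally show False using W(2) by (simp add: field_simps)
qed

lemma dset_gap_closure:
  assumes T: "lsc_convex_family n m E T" shows "dset n (gap_closure n m T E)"
  unfolding gap_closure_def
  by (intro dset_Collect[OF familyD(1)[OF T]] dfn_ex_set[OF dset_gap_pts[OF T]] dfn_rules)

lemma gap_closure_subset: "gap_closure n m T E \<subseteq> E"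
  by (auto simp: gap_closure_def)

lemma gap_pts_gap_closure:
  assumes "x \<in> gap_pts n m T E" shows "x \<in> gap_closure n m T E"
  using assms gap_pts_subset[of n m T E] unfolding gap_closure_def
  by (intro CollectI conjI allI impI bexI[of _ x]) auto

lemma closed_gap_closure:
  assumes T: "lsc_convex_family n m E T" shows "closed_in_Fn n (gap_closure n m T E)"
  unfolding closed_in_Fn_def
proof (intro ballI impI)
  fix x assume x: "x \<in> Fn n" "\<forall>s>0. \<exists>y\<in>gap_closure n m T E. dst n x y < s"
  have "\<exists>y\<in>E. dst n x y < s" if "0 < s" for s
    using x(2) that gap_closure_subset[of n m T E] by blast
  then have "x \<in> E" using familyD(2)[OF T] x(1) unfolding closed_in_Fn_def by blast
  moreover have "\<exists>z\<in>gap_pts n m T E. dst n x z < d" if d: "0 < d" for d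
  proof -
    obtain y where y: "y \<in> gap_closure n m T E" "dst n x y < d / 2" using x(2) d by (meson half_gt_zero)
    then obtain z where z: "z \<in> gap_pts n m T E" "dst n y z < d / 2"
      using d unfolding gap_closure_def by (auto dest!: spec[of _ "d / 2"])
    have "dst n x z < d" using dst_triangle[of n x z y] y(2) z(2) by (simp add: field_simps)
    then show ?thesis using z(1) by blast
  qed
  ultimately show "x \<in> gap_closure n m T E" unfolding gap_closure_def by blast
qed

text \<open>
  On some relatively open part the gap points are either all or none of the points. The first
  contradicts \<open>thin_gap_pts\<close>, and in the second the part contains no limit of gap points.
\<close>

lemma thin_gap_closure:
  assumes T: "lsc_convex_family n m E T" shows "thin n E (gap_closure n m T E)"
  unfolding thin_def
proof (intro allI impI notI)
  fix V assume V: "open_part n E V" "V \<subseteq> gap_closure n m T E"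
  consider W where "open_part n V W" "W \<subseteq> gap_pts n m T E"
    | W where "open_part n V W" "W \<inter> gap_pts n m T E = {}"
    by (rule dichotomy[OF covering open_partD(1,2)[OF V(1)] dset_gap_pts[OF T]])
  then show False
  proof cases
    case 1
    show False by (rule thinD[OF thin_gap_pts[OF T] open_part_trans[OF V(1) 1(1)] 1(2)])
  next
    case 2
    note WD = open_partD[OF open_part_trans[OF V(1) 2(1)]]
    obtain y where y: "y \<in> W" using WD(2) by blast
    obtain s where s: "0 < s" "\<forall>z\<in>E. dst n y z < s \<longrightarrow> z \<in> W" using WD(4)[OF y] by blast
    have "y \<in> gap_closure n m T E" using V(2) open_partD(3)[OF 2(1)] y by blast
    then obtain z where "z \<in> gap_pts n m T E" "dst n y z < s" using s(1) unfolding gap_closure_def by blast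
    then show False using s(2) 2(2) gap_pts_subset by blast
  qed
qed

definition cont_selection :: "nat \<Rightarrow> nat \<Rightarrow> ((nat \<Rightarrow> 'a) \<Rightarrow> (nat \<Rightarrow> 'a) set) \<Rightarrow> (nat \<Rightarrow> 'a) set \<Rightarrow>
    ((nat \<Rightarrow> 'a) \<Rightarrow> nat \<Rightarrow> 'a) \<Rightarrow> bool" where
  "cont_selection n m T E f \<longleftrightarrow> (\<forall>x\<in>E. f x \<in> T x) \<and>
     (\<forall>i<m. dfun n (\<lambda>x. f x i)) \<and> (\<forall>x\<in>E. \<forall>i<m. cont_at n E (\<lambda>x. f x i) x)"

text \<open>
  The selection sends \<open>x\<close> to the point of \<open>T x\<close> nearest to \<open>G x\<close>, where \<open>G\<close> is a continuous extension of
  \<open>g\<close>. If \<open>f\<close> were discontinuous at \<open>x\<close>, values \<open>f y\<close> that stay away from \<open>f x\<close> would have a cluster point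
  \<open>p\<close> as \<open>y\<close> tends to \<open>x\<close>, and lower semicontinuity makes \<open>p\<close> as near to \<open>G x\<close> as \<open>f x\<close>. This forces
  \<open>p = f x\<close>: at points of \<open>gap_closure n m T E\<close> because \<open>f x = G x\<close>, elsewhere because \<open>p \<in> T x\<close>.
\<close>

lemma extend_selection:
  assumes T: "lsc_convex_family n m E T" and g: "cont_selection n m T (gap_closure n m T E) g"
  shows "\<exists>f. cont_selection n m T E f"
proof -
  let ?B = "gap_closure n m T E"
  note Ed = familyD(1)[OF T]
  have EF: "x \<in> Fn n" if "x \<in> E" for x using dset_subset[OF Ed that] .
  have "\<exists>h. dfun n h \<and> (\<forall>x\<in>?B. h x = g x i) \<and> (\<forall>x\<in>Fn n. cont_at n (Fn n) h x)" if "i < m" for i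
    using g that unfolding cont_selection_def
    by (intro tietze_extension dset_gap_closure[OF T] closed_gap_closure[OF T]) auto
  then obtain h where h: "\<And>i. i < m \<Longrightarrow> dfun n (h i)" "\<And>i x. i < m \<Longrightarrow> x \<in> ?B \<Longrightarrow> h i x = g x i"
    "\<And>i x. i < m \<Longrightarrow> x \<in> Fn n \<Longrightarrow> cont_at n (Fn n) (h i) x" by metis
  define G where "G = (\<lambda>x. \<lambda>i\<in>{..<m}. h i x)"
  have GF: "G x \<in> Fn m" for x by (simp add: G_def)
  have Gd: "dvec m (\<lambda>e. G (X e))" if "dvec n X" for X
    unfolding G_def by (intro dvec_restrict dterm_fun[OF h(1) that])
  have Gcont: "\<exists>d>0. \<forall>y\<in>E. dst n x y < d \<longrightarrow> dst m (G x) (G y) < s" if x: "x \<in> E" "0 < s" for x s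
  proof (rule cont_at_dst[OF _ x(2)])
    show "cont_at n E (\<lambda>x. G x i) x" if "i < m" for i
      using cont_at_subset[OF h(3)[OF that EF[OF x(1)]], of E] EF that by (auto simp: G_def)
  qed
  have near_ex: "\<exists>y. nearest_pt m (T x) (G x) y" if x: "x \<in> E" for x
  proof (rule nearest_pt_exists[OF _ familyD(4)[OF T x] familyD(6)[OF T x] GF])
    show "dset m (T x)" unfolding dset_def
    proof (intro conjI allI impI)
      show "T x \<subseteq> Fn m" using familyD(5)[OF T x] by blast
      show "dfn (\<lambda>e. Y e \<in> T x)" if "dvec m Y" for Y
        using familyD(3)[OF T dvec_const[OF EF[OF x]] that] x by simp
    qed
  qed
  define f where "f = (\<lambda>x. if x \<in> E then SOME y. nearest_pt m (T x) (G x) y else (\<lambda>i\<in>{..<m}. 0))"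
  have f: "nearest_pt m (T x) (G x) (f x)" if "x \<in> E" for x
    using someI_ex[OF near_ex[OF that]] that by (simp add: f_def)
  have fT: "f x \<in> T x" if "x \<in> E" for x using f[OF that] by (simp add: nearest_pt_def)
  have f_le: "sqd m (f x) (G x) \<le> sqd m w (G x)" if "x \<in> E" "w \<in> T x" for x w
    using f[OF that(1)] that(2) by (simp add: nearest_pt_def)
  have f_uniq: "y = f x" if "x \<in> E" "nearest_pt m (T x) (G x) y" for x y
    using nearest_pt_unique[OF familyD(7)[OF T that(1)] _ that(2) f[OF that(1)]] familyD(5)[OF T that(1)] by blast
  have fF: "f x \<in> Fn m" for x using familyD(5)[OF T _ fT] by (cases "x \<in> E") (auto simp: f_def)
  have fd: "dfun n (\<lambda>x. f x i)" if i: "i < m" for i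
  proof (rule dfunI, rule dterm_unique)
    let ?x = "\<lambda>e. \<lambda>i\<in>{..<n}. e i"
    let ?Q = "\<lambda>a x. (\<exists>y\<in>Fn m. (x \<in> E \<and> y \<in> T x) \<and>
        (\<forall>w\<in>Fn m. x \<in> E \<and> w \<in> T x \<longrightarrow> sqd m y (G x) \<le> sqd m w (G x)) \<and> a = y i) \<or> (\<not> x \<in> E \<and> a = 0)"
    have "a = f x i \<longleftrightarrow> ?Q a x" for a x
    proof (cases "x \<in> E")
      case True
      have "nearest_pt m (T x) (G x) y \<longleftrightarrow> y \<in> T x \<and> (\<forall>w\<in>Fn m. w \<in> T x \<longrightarrow> sqd m y (G x) \<le> sqd m w (G x))" for y
        unfolding nearest_pt_def using familyD(5)[OF T True] by blast
      then have "?Q a x \<longleftrightarrow> (\<exists>y\<in>Fn m. nearest_pt m (T x) (G x) y \<and> a = y i)"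
        using True by auto
      also have "\<dots> \<longleftrightarrow> a = f x i" using f[OF True] f_uniq[OF True] fF by blast
      finally show ?thesis by blast
    next
      case False
      then show ?thesis using i by (simp add: f_def)
    qed
    then show "a = f (?x e) i \<longleftrightarrow> ?Q a (?x e)" for e a .
    have comp: "dterm (\<lambda>e. (\<lambda>i\<in>{..<m}. e i) i)" by (rule dvec_comp[OF dvec_var_id i])
    show "dfn (\<lambda>e. ?Q (e 0) (?x (\<lambda>i. e (Suc i))))"
      by (intro dfn_rules familyD(3)[OF T] dfn_set[OF Ed] dterm_sqd Gd comp)
  qed
  have f_cont: "cont_at n E (\<lambda>x. f x i) x" if x: "x \<in> E" and i: "i < m" for x i
  proof (rule ccontr)
    assume "\<not> cont_at n E (\<lambda>x. f x i) x"
    then obtain s where s: "0 < s" "\<And>d. 0 < d \<Longrightarrow> \<exists>y\<in>E. dst n x y < d \<and> s \<le> \<bar>f y i - f x i\<bar>"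
      unfolding cont_at_def by (meson not_less)
    define C where "C = (\<lambda>t. {v\<in>Fn m. \<exists>y\<in>E. dst n x y < t \<and> v = f y \<and> s \<le> \<bar>v i - f x i\<bar>})"
    have fvd: "dvec m (\<lambda>e. f (X e))" if "dvec n X" for X
      unfolding dvec_def using fF dterm_fun[OF fd that] by blast
    have comp: "dterm (\<lambda>e. (\<lambda>i\<in>{..<m}. e (k i)) i)" for k by (rule dvec_comp[OF dvec_var i])
    have Cd: "drel m (\<lambda>v t. v \<in> C t)"
    proof (rule drelI)
      have "dfn (\<lambda>e. (\<lambda>i\<in>{..<m}. e (Suc i)) \<in> Fn m)" using dfn_const[of True] by simp
      then show "dfn (\<lambda>e. (\<lambda>i\<in>{..<m}. e (Suc i)) \<in> C (e 0))" unfolding C_def mem_Collect_eq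
        by (intro dfn_ex_set[OF Ed] dfn_rules dfn_eq_vec[of m] fvd comp dvec_const[OF EF[OF x]])
    qed
    have CF: "C t \<subseteq> Fn m" for t by (auto simp: C_def)
    have Cne: "C t \<noteq> {}" if "0 < t" for t using s(2)[OF that] fF unfolding C_def by blast
    have Cmono: "C t \<subseteq> C u" if "t \<le> u" for t u
      using that unfolding C_def by (blast intro: less_le_trans)
    have approx: "\<exists>d>0. \<forall>y\<in>E. dst n x y < d \<longrightarrow> dst m (G x) (G y) < t \<and> (\<exists>w\<in>T y. dst m (f x) w < t)"
      if t: "0 < t" for t
    proof -
      obtain d1 where d1: "0 < d1" "\<forall>z\<in>E. dst n x z < d1 \<longrightarrow> (\<exists>w\<in>T z. dst m (f x) w < t)"
        using family_lsc[OF T x fT[OF x] t] by blast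
      obtain d2 where d2: "0 < d2" "\<forall>y\<in>E. dst n x y < d2 \<longrightarrow> dst m (G x) (G y) < t"
        using Gcont[OF x t] by blast
      show ?thesis by (rule exI[of _ "min d1 d2"]) (use d1 d2 in auto)
    qed
    obtain t1 where t1: "0 < t1"
      "\<forall>y\<in>E. dst n x y < t1 \<longrightarrow> dst m (G x) (G y) < 1 \<and> (\<exists>w\<in>T y. dst m (f x) w < 1)"
      using approx[OF zero_less_one] by blast
    define K where "K = dst m (f x) (G x) + 2"
    have "0 \<le> K" by (simp add: K_def)
    have Cbd: "\<bar>v j\<bar> \<le> K + 1 + dst m (G x) (\<lambda>_. 0)" if v: "v \<in> C t1" "j < m" for v j
    proof -
      obtain y where y: "y \<in> E" "dst n x y < t1" "v = f y" using v(1) by (auto simp: C_def)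
      obtain w where w: "dst m (G x) (G y) < 1" "w \<in> T y" "dst m (f x) w < 1" using t1(2) y by blast
      have wG: "dst m w (G y) \<le> K"
        using dst_triangle[of m w "G y" "f x"] dst_triangle[of m "f x" "G y" "G x"] w
        by (simp add: K_def dst_commute[of m w])
      have "sqd m (f y) (G y) \<le> sqd m w (G y)" by (rule f_le[OF y(1) w(2)])
      also have "\<dots> \<le> dst m w (G y) * dst m w (G y)" by (rule sqd_le_dst)
      also have "\<dots> \<le> K * K" using wG \<open>0 \<le> K\<close> by (intro mult_mono) auto
      finally have "\<bar>f y j - G y j\<bar> \<le> K" using sqd_coord \<open>0 \<le> K\<close> v(2) by blast
      moreover have "\<bar>G x j - G y j\<bar> < 1" using dst_coord[OF v(2), of "G x" "G y"] w(1) by linarith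
      moreover have "\<bar>G x j\<bar> \<le> dst m (G x) (\<lambda>_. 0)" using dst_coord[OF v(2), of "G x" "\<lambda>_. 0"] by simp
      ultimately show ?thesis unfolding y(3) by linarith
    qed
    have "\<exists>p\<in>Fn m. \<forall>t>0. \<exists>v\<in>C t. dst m v p < t"
      by (rule definable_cluster_point[where ?t1.0 = t1 and b = "K + 1 + dst m (G x) (\<lambda>_. 0)"])
        (fact Cd CF Cne Cmono t1(1) Cbd)+
    then obtain p where p: "p \<in> Fn m" "\<And>t. 0 < t \<Longrightarrow> \<exists>v\<in>C t. dst m v p < t" by blast
    have cl: "\<exists>y\<in>E. dst n x y < t \<and> dst m (f y) p < t \<and> s \<le> \<bar>f y i - f x i\<bar>" if "0 < t" for t
      using p(2)[OF that] by (auto simp: C_def)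
    have p_le: "sqd m p (G x) \<le> sqd m (f x) (G x)"
    proof (rule le_limit[where c = "2 * (2 * dst m p (G x) + 2) + 2 * (2 * dst m (f x) (G x) + 2)"])
      fix t :: 'a assume t: "0 < t" "t \<le> 1"
      obtain d where d: "0 < d"
        "\<forall>y\<in>E. dst n x y < d \<longrightarrow> dst m (G x) (G y) < t \<and> (\<exists>w\<in>T y. dst m (f x) w < t)"
        using approx[OF t(1)] by blast
      obtain y where y: "y \<in> E" "dst n x y < min d t" "dst m (f y) p < min d t"
        using cl[of "min d t"] d(1) t(1) by auto
      have GG: "dst m (G x) (G y) < t" using d(2) y by auto
      obtain w where w: "w \<in> T y" "dst m (f x) w < t" using d(2) y by auto
      have pf: "dst m p (f y) < t" using y(3) by (simp add: dst_commute[of m p])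
      have 1: "dst m (f y) (G y) \<le> dst m p (G x) + 2"
        using dst_triangle[of m "f y" "G y" p] dst_triangle[of m p "G y" "G x"] pf GG t(2)
        by (simp add: dst_commute[of m p "f y"])
      have 2: "dst m w (G y) \<le> dst m (f x) (G x) + 2"
        using dst_triangle[of m w "G y" "f x"] dst_triangle[of m "f x" "G y" "G x"] w(2) GG t(2)
        by (simp add: dst_commute[of m w "f x"])
      have "sqd m p (G x) \<le> sqd m (f y) (G y) +
          (dst m p (f y) + dst m (G x) (G y)) * (dst m p (G x) + dst m (f y) (G y))" by (rule sqd_diff)
      also have "\<dots> \<le> sqd m (f y) (G y) + (t + t) * (2 * dst m p (G x) + 2)"
        using pf GG 1 t by (intro add_left_mono mult_mono) auto
      also have "sqd m (f y) (G y) \<le> sqd m w (G y)" by (rule f_le[OF y(1) w(1)])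
      also have "sqd m w (G y) \<le> sqd m (f x) (G x) +
          (dst m w (f x) + dst m (G y) (G x)) * (dst m w (G y) + dst m (f x) (G x))" by (rule sqd_diff)
      also have "\<dots> \<le> sqd m (f x) (G x) + (t + t) * (2 * dst m (f x) (G x) + 2)"
        using w(2) GG 2 t
        by (intro add_left_mono mult_mono) (auto simp: dst_commute[of m w "f x"] dst_commute[of m "G y" "G x"])
      finally show "sqd m p (G x) \<le> sqd m (f x) (G x) +
          t * (2 * (2 * dst m p (G x) + 2) + 2 * (2 * dst m (f x) (G x) + 2))"
        by (simp add: algebra_simps)
    qed (simp add: add_nonneg_nonneg)
    have pfx: "p = f x"
    proof (cases "x \<in> ?B")
      case True
      have gx: "g x \<in> T x" using g True unfolding cont_selection_def by blast
      have "sqd m (g x) (G x) = 0" unfolding sqd_def by (simp add: G_def h(2)[OF _ True])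
      then have f0: "sqd m (f x) (G x) \<le> 0" using f_le[OF x gx] by simp
      then have p0: "sqd m p (G x) \<le> 0" using p_le by simp
      show ?thesis by (rule Fn_cong[OF p(1) fF]) (simp add: sqd_0[OF p0] sqd_0[OF f0])
    next
      case False
      then have good: "x \<notin> gap_pts n m T E" using gap_pts_gap_closure by blast
      have "p \<in> T x"
      proof (rule ccontr)
        assume "p \<notin> T x"
        moreover have "\<exists>x'\<in>E. \<exists>y'\<in>Fn m. dst n x x' < d \<and> dst m p y' < d \<and> x' \<in> E \<and> y' \<in> T x'" if d: "0 < d" for d
        proof -
          obtain y where "y \<in> E" "dst n x y < d" "dst m (f y) p < d" using cl[OF d] by blast
          then show ?thesis using fT fF by (intro bexI[of _ y] bexI[of _ "f y"]) (auto simp: dst_commute[of m p])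
        qed
        ultimately have "x \<in> gap_pts n m T E" using x p(1) unfolding gap_pts_def by blast
        then show False using good by blast
      qed
      then have "nearest_pt m (T x) (G x) p"
        unfolding nearest_pt_def using f_le[OF x] p_le by (blast intro: order_trans)
      then show ?thesis by (rule f_uniq[OF x])
    qed
    obtain y where y: "dst m (f y) p < s" "s \<le> \<bar>f y i - f x i\<bar>" using cl[OF s(1)] by blast
    have "\<bar>f y i - p i\<bar> \<le> dst m (f y) p" by (rule dst_coord[OF i])
    then show False using y pfx by simp
  qed
  show ?thesis unfolding cont_selection_def using fT fd f_cont by blast
qed

lemma continuous_selection:
  assumes T: "lsc_convex_family n m E T"
  shows "\<exists>f. cont_selection n m T E f"
proof -
  define A where "A = (\<lambda>k. (gap_closure n m T ^^ k) E)"
  have A_Suc: "A (Suc k) = gap_closure n m T (A k)" for k by (simp add: A_def)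
  have fam: "lsc_convex_family n m (A k) T" for k
  proof (induction k)
    case 0
    then show ?case using T by (simp add: A_def)
  next
    case (Suc k)
    then show ?case unfolding A_Suc
      by (rule family_restrict) (intro dset_gap_closure closed_gap_closure Suc gap_closure_subset)+
  qed
  have "\<exists>k. A k = {}"
  proof (rule thin_chain_terminates[of n])
    show "dset n (A i)" for i by (rule familyD(1)[OF fam])
    show "A (Suc i) \<subseteq> A i" for i unfolding A_Suc by (rule gap_closure_subset)
    show "thin n (A i) (A (Suc i))" for i unfolding A_Suc by (rule thin_gap_closure[OF fam])
  qed
  then obtain k where "A k = {}" by blast
  then have "\<exists>f. cont_selection n m T (A k) f"
    unfolding cont_selection_def by (auto intro!: exI[of _ "\<lambda>_ _. 0"] dfunI dterm_const)
  then have "\<exists>f. cont_selection n m T (A 0) f"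
  proof (induction k)
    case (Suc k)
    then show ?case using extend_selection[OF fam[of k]] unfolding A_Suc by blast
  qed
  then show ?thesis by (simp add: A_def)
qed

end

section \<open>From the metric formulation to the topological one\<close>

lemma topspace_power_space: "topspace (power_space n) = Fn n"
  by (simp add: power_space_def)

lemma open_box_contains_ball:
  fixes x :: "nat \<Rightarrow> 'a::{linordered_field, linorder_topology}"
  assumes "\<And>i. i < n \<Longrightarrow> open (U i) \<and> x i \<in> U i"
  shows "\<exists>s>0. \<forall>y. dst n x y < s \<longrightarrow> (\<forall>i<n. y i \<in> U i)"
  using assms
proof (induction n)
  case 0
  then show ?case by (auto intro: exI[of _ 1])
next
  case (Suc n)
  then obtain s where s: "0 < s" "\<And>y. dst n x y < s \<Longrightarrow> \<forall>i<n. y i \<in> U i" by force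
  have "inner_pt (U n) (x n)" using Suc.prems[of n] by (intro open_inner_pt) auto
  then obtain t where t: "0 < t" "\<And>b. \<bar>b - x n\<bar> < t \<Longrightarrow> b \<in> U n" unfolding inner_pt_def by blast
  have "\<forall>i<Suc n. y i \<in> U i" if y: "dst (Suc n) x y < min s t" for y
  proof -
    have "dst n x y < s" "\<bar>y n - x n\<bar> < t"
      using y dst_nonneg[of n x y] by (auto simp: dst_Suc abs_minus_commute simp del: dst_nonneg)
    then show ?thesis using s(2) t(2) by (auto simp: less_Suc_eq)
  qed
  then show ?case using s(1) t(1) by (intro exI[of _ "min s t"]) auto
qed

lemma openin_power_space:
  fixes S :: "(nat \<Rightarrow> 'a::{linordered_field, linorder_topology}) set"
  shows "openin (power_space n) S \<longleftrightarrow>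
    S \<subseteq> Fn n \<and> (\<forall>x\<in>S. \<exists>s>0. \<forall>y\<in>Fn n. dst n x y < s \<longrightarrow> y \<in> S)"
proof
  assume S: "openin (power_space n) S"
  have "\<exists>s>0. \<forall>y\<in>Fn n. dst n x y < s \<longrightarrow> y \<in> S" if "x \<in> S" for x
  proof -
    have "\<forall>x\<in>S. \<exists>U. finite {i \<in> {..<n}. U i \<noteq> topspace euclidean} \<and>
        (\<forall>i\<in>{..<n}. openin euclidean (U i)) \<and> x \<in> Pi\<^sub>E {..<n} U \<and> Pi\<^sub>E {..<n} U \<subseteq> S"
      using S unfolding power_space_def openin_product_topology_alt .
    from bspec[OF this \<open>x \<in> S\<close>] obtain U where
      U: "\<forall>i\<in>{..<n}. open (U i)" "x \<in> Pi\<^sub>E {..<n} U" "Pi\<^sub>E {..<n} U \<subseteq> S"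
      unfolding open_openin[symmetric] by (elim exE conjE)
    have "open (U i) \<and> x i \<in> U i" if "i < n" for i using U(1,2) that by (auto simp: PiE_iff)
    from open_box_contains_ball[of n U x, OF this] obtain s where
      s: "0 < s" "\<And>y. dst n x y < s \<Longrightarrow> \<forall>i<n. y i \<in> U i" by blast
    have "y \<in> S" if "y \<in> Fn n" "dst n x y < s" for y
    proof -
      have "y \<in> Pi\<^sub>E {..<n} U" using s(2)[OF that(2)] that(1) by (auto simp: PiE_iff)
      then show ?thesis using U(3) by blast
    qed
    then show ?thesis using s(1) by blast
  qed
  then show "S \<subseteq> Fn n \<and> (\<forall>x\<in>S. \<exists>s>0. \<forall>y\<in>Fn n. dst n x y < s \<longrightarrow> y \<in> S)"
    using openin_subset[OF S] unfolding topspace_power_space by (intro conjI ballI)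
next
  assume S: "S \<subseteq> Fn n \<and> (\<forall>x\<in>S. \<exists>s>0. \<forall>y\<in>Fn n. dst n x y < s \<longrightarrow> y \<in> S)"
  show "openin (power_space n) S" unfolding power_space_def openin_product_topology_alt
  proof
    fix x assume x: "x \<in> S"
    from bspec[OF conjunct2[OF S] this] obtain s where
      s: "0 < s" "\<forall>y\<in>Fn n. dst n x y < s \<longrightarrow> y \<in> S" by (elim exE conjE)
    define w where "w = s / of_nat (Suc n)"
    have w: "0 < w" unfolding w_def by (intro divide_pos_pos s(1) of_nat_Suc_pos)
    define U where "U = (\<lambda>i. {x i - w<..<x i + w})"
    have "x \<in> Fn n" by (rule subsetD[OF conjunct1[OF S] x])
    then have "x \<in> Pi\<^sub>E {..<n} U" using w by (auto simp: U_def PiE_iff)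
    moreover have "Pi\<^sub>E {..<n} U \<subseteq> S"
    proof
      fix y assume y: "y \<in> Pi\<^sub>E {..<n} U"
      then have "y \<in> Fn n" by (auto simp: PiE_iff)
      moreover have "dst n x y < s"
      proof (rule dst_less[OF _ s(1)])
        fix i assume "i < n"
        then have "y i \<in> U i" using y by (auto simp: PiE_iff)
        then show "\<bar>x i - y i\<bar> \<le> s / of_nat (Suc n)"
          unfolding U_def w_def[symmetric] by (auto simp: abs_if)
      qed
      ultimately show "y \<in> S" by (rule mp[OF bspec[OF s(2)]])
    qed
    moreover have "\<forall>i\<in>{..<n}. openin euclidean (U i)" by (simp add: U_def)
    moreover have "finite {i \<in> {..<n}. U i \<noteq> topspace euclidean}" by simp
    ultimately show "\<exists>U. finite {i \<in> {..<n}. U i \<noteq> topspace euclidean} \<and>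
        (\<forall>i\<in>{..<n}. openin euclidean (U i)) \<and> x \<in> Pi\<^sub>E {..<n} U \<and> Pi\<^sub>E {..<n} U \<subseteq> S" by blast
  qed
qed

lemma openin_ball:
  fixes x :: "nat \<Rightarrow> 'a::{linordered_field, linorder_topology}"
  shows "openin (power_space n) {y \<in> Fn n. dst n x y < s}"
  unfolding openin_power_space
proof (intro conjI ballI)
  fix y assume "y \<in> {y \<in> Fn n. dst n x y < s}"
  then have y: "dst n x y < s" by simp
  have "dst n x z < s" if "dst n y z < s - dst n x y" for z
    using dst_triangle[of n x z y] that by linarith
  then show "\<exists>t>0. \<forall>z\<in>Fn n. dst n y z < t \<longrightarrow> z \<in> {y \<in> Fn n. dst n x y < s}"
    using y by (intro exI[of _ "s - dst n x y"]) auto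
qed auto

lemma closedin_power_space_closed:
  fixes S :: "(nat \<Rightarrow> 'a::{linordered_field, linorder_topology}) set"
  assumes "closedin (power_space n) S" shows "closed_in_Fn n S"
  unfolding closed_in_Fn_def
proof (intro ballI impI, rule ccontr)
  fix x assume x: "x \<in> Fn n" "\<forall>s>0. \<exists>y\<in>S. dst n x y < s" "x \<notin> S"
  have S: "S \<subseteq> Fn n" using closedin_subset[OF assms] unfolding topspace_power_space .
  have "openin (power_space n) (Fn n - S)"
    using assms unfolding closedin_def topspace_power_space by blast
  then have "\<forall>x\<in>Fn n - S. \<exists>s>0. \<forall>y\<in>Fn n. dst n x y < s \<longrightarrow> y \<in> Fn n - S"
    unfolding openin_power_space by (rule conjunct2)
  from bspec[OF this DiffI[OF x(1,3)]] obtain s where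
    s: "0 < s" "\<forall>y\<in>Fn n. dst n x y < s \<longrightarrow> y \<in> Fn n - S" by (elim exE conjE)
  obtain y where y: "y \<in> S" "dst n x y < s" using x(2) s(1) by blast
  have "y \<in> Fn n - S" using bspec[OF s(2) subsetD[OF S y(1)]] y(2) by (rule mp)
  then show False using y(1) by (rule DiffD2)
qed

lemma neighbourhood_ball:
  fixes y :: "nat \<Rightarrow> 'a::{linordered_field, linorder_topology}"
  assumes "y \<in> Fn m" "0 < s" shows "neighbourhood (power_space m) y {z \<in> Fn m. dst m y z < s}"
  unfolding neighbourhood_def topspace_power_space
  using openin_ball[of m y s] assms by (intro conjI exI[of _ "{z \<in> Fn m. dst m y z < s}"]) auto

lemma neighbourhood_subtopology_ball:
  fixes x :: "nat \<Rightarrow> 'a::{linordered_field, linorder_topology}"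
  assumes "neighbourhood (subtopology (power_space n) E) x U" "E \<subseteq> Fn n"
  obtains d where "0 < d" "\<And>z. z \<in> E \<Longrightarrow> dst n x z < d \<Longrightarrow> z \<in> U"
proof -
  obtain W where W: "openin (subtopology (power_space n) E) W" "x \<in> W" "W \<subseteq> U"
    using assms(1) unfolding neighbourhood_def by blast
  then obtain S where S: "openin (power_space n) S" "W = S \<inter> E" unfolding openin_subtopology by blast
  have "\<forall>x\<in>S. \<exists>d>0. \<forall>z\<in>Fn n. dst n x z < d \<longrightarrow> z \<in> S"
    using S(1) unfolding openin_power_space by (rule conjunct2)
  moreover have "x \<in> S" using W(2) S(2) by blast
  ultimately have "\<exists>d>0. \<forall>z\<in>Fn n. dst n x z < d \<longrightarrow> z \<in> S" by (rule bspec)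
  then obtain d where d: "0 < d" "\<forall>z\<in>Fn n. dst n x z < d \<longrightarrow> z \<in> S" by (elim exE conjE)
  show thesis
  proof (rule that[OF d(1)])
    fix z assume z: "z \<in> E" "dst n x z < d"
    have "z \<in> S" using bspec[OF d(2) subsetD[OF assms(2) z(1)]] z(2) by (rule mp)
    then show "z \<in> U" using z(1) S(2) W(3) by blast
  qed
qed

lemma continuous_map_power_space:
  fixes f :: "(nat \<Rightarrow> 'a::{linordered_field, linorder_topology}) \<Rightarrow> nat \<Rightarrow> 'a"
  assumes E: "E \<subseteq> Fn n" and f: "\<And>x. x \<in> E \<Longrightarrow> f x \<in> Fn m"
    and cont: "\<And>x i. x \<in> E \<Longrightarrow> i < m \<Longrightarrow> cont_at n E (\<lambda>x. f x i) x"
  shows "continuous_map (subtopology (power_space n) E) (power_space m) f"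
  unfolding continuous_map_def
proof (intro conjI allI impI)
  have top: "topspace (subtopology (power_space n) E) = E"
    using E by (simp only: topspace_subtopology topspace_power_space) blast
  show "f \<in> topspace (subtopology (power_space n) E) \<rightarrow> topspace (power_space m)"
    unfolding top topspace_power_space using f by blast
  fix U :: "(nat \<Rightarrow> 'a) set"
  assume "openin (power_space m) U"
  then have "\<forall>v\<in>U. \<exists>s>0. \<forall>w\<in>Fn m. dst m v w < s \<longrightarrow> w \<in> U"
    unfolding openin_power_space by (rule conjunct2)
  note U = bspec[OF this]
  define S where "S = {z \<in> Fn n. \<exists>x\<in>E. \<exists>d. dst n x z < d \<and> (\<forall>y\<in>E. dst n x y < d \<longrightarrow> f y \<in> U)}"
  have "openin (power_space n) S" unfolding openin_power_space
  proof (intro conjI ballI)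
    fix z assume "z \<in> S"
    then obtain x d where x: "x \<in> E" "dst n x z < d" "\<forall>y\<in>E. dst n x y < d \<longrightarrow> f y \<in> U"
      by (auto simp: S_def)
    have "dst n x z' < d" if "dst n z z' < d - dst n x z" for z'
      using dst_triangle[of n x z' z] that by linarith
    then show "\<exists>s>0. \<forall>y\<in>Fn n. dst n z y < s \<longrightarrow> y \<in> S"
      using x unfolding S_def by (intro exI[of _ "d - dst n x z"]) auto
  qed (auto simp: S_def)
  moreover have "{x \<in> E. f x \<in> U} = S \<inter> E"
  proof (intro set_eqI iffI)
    fix x assume "x \<in> {x \<in> E. f x \<in> U}"
    then have x: "x \<in> E" "f x \<in> U" by auto
    obtain s where s: "0 < s" "\<forall>w\<in>Fn m. dst m (f x) w < s \<longrightarrow> w \<in> U" using U[OF x(2)] by blast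
    obtain d where "0 < d" "\<forall>y\<in>E. dst n x y < d \<longrightarrow> dst m (f x) (f y) < s"
      using cont_at_dst[of m n E f x s] cont[OF x(1)] s(1) by blast
    then have "dst n x x < d" "\<forall>y\<in>E. dst n x y < d \<longrightarrow> f y \<in> U" using s(2) f by auto
    then show "x \<in> S \<inter> E" using x(1) E unfolding S_def by blast
  qed (auto simp: S_def)
  ultimately show "openin (subtopology (power_space n) E) {x \<in> topspace (subtopology (power_space n) E). f x \<in> U}"
    unfolding top openin_subtopology by blast
qed

lemma concat_point_inject:
  assumes "x \<in> Fn n" "x' \<in> Fn n" "y \<in> Fn m" "y' \<in> Fn m"
    and eq: "concat_point n m x y = concat_point n m x' y'"
  shows "x = x'" "y = y'"
proof -
  show "x = x'"
  proof (rule Fn_cong[OF assms(1,2)])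
    show "x i = x' i" if "i < n" for i using fun_cong[OF eq, of i] that by (simp add: concat_point_def)
  qed
  show "y = y'"
  proof (rule Fn_cong[OF assms(3,4)])
    show "y i = y' i" if "i < m" for i using fun_cong[OF eq, of "n + i"] that by (simp add: concat_point_def)
  qed
qed

lemma concat_point_in_Fn: "concat_point n m x y \<in> Fn (n + m)"
  by (simp add: concat_point_def)

context d_minimal_field
begin

lemma dvec_concat:
  assumes "dvec n X" "dvec m Y" shows "dvec (n + m) (\<lambda>e. concat_point n m (X e) (Y e))"
  unfolding concat_point_def
proof (rule dvec_restrict)
  fix i assume "i < n + m"
  then show "dterm (\<lambda>e. if i < n then X e i else Y e (i - n))"
    by (cases "i < n") (auto intro: dvec_comp[OF assms(1)] dvec_comp[OF assms(2)])
qed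

lemma lsc_convex_familyI:
  assumes "definable M n E" and "closedin (power_space n) E"
    and T: "definable_set_valued M n m E T" and lsc: "lower_semicontinuous n m E T"
    and ne: "\<And>x. x \<in> E \<Longrightarrow> T x \<noteq> {}" and cl: "\<And>x. x \<in> E \<Longrightarrow> closedin (power_space m) (T x)"
    and conv: "\<And>x. x \<in> E \<Longrightarrow> convex_in_power m (T x)"
  shows "lsc_convex_family n m E T"
proof -
  have Ed: "dset n E" by (rule dset_definable[OF assms(1)])
  have EF: "E \<subseteq> Fn n" using dset_subset[OF Ed] by blast
  have TF: "T x \<subseteq> Fn m" if "x \<in> E" for x using T that unfolding definable_set_valued_def by blast
  let ?G = "set_valued_graph n m E T"
  have Gd: "dset (n + m) ?G" using T dset_definable unfolding definable_set_valued_def by blast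
  have G: "concat_point n m x y \<in> ?G \<longleftrightarrow> x \<in> E \<and> y \<in> T x" if xy: "x \<in> Fn n" "y \<in> Fn m" for x y
  proof
    assume "concat_point n m x y \<in> ?G"
    then obtain x' y' where "x' \<in> E" "y' \<in> T x'" "concat_point n m x y = concat_point n m x' y'"
      unfolding set_valued_graph_def by blast
    moreover from this have "x = x'" "y = y'"
      using concat_point_inject[of x n x' y m y'] xy EF TF by blast+
    ultimately show "x \<in> E \<and> y \<in> T x" by blast
  qed (auto simp: set_valued_graph_def)
  show ?thesis unfolding lsc_convex_family_def
  proof (intro conjI allI impI ballI Ed closedin_power_space_closed assms(2) cl)
    fix X Y assume X: "dvec n X" and Y: "dvec m Y"
    have "dfn (\<lambda>e. concat_point n m (X e) (Y e) \<in> ?G)" by (rule dfn_set[OF Gd dvec_concat[OF X Y]])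
    moreover have "X e \<in> Fn n" "Y e \<in> Fn m" for e using X Y unfolding dvec_def by blast+
    ultimately show "dfn (\<lambda>e. X e \<in> E \<and> Y e \<in> T (X e))" by (simp only: G)
  next
    fix x y and s :: 'a assume x: "x \<in> E" and y: "y \<in> T x" and s: "0 < s"
    have "y \<in> Fn m" using TF[OF x] y by blast
    then have "neighbourhood (power_space m) y {w \<in> Fn m. dst m y w < s}" using s by (rule neighbourhood_ball)
    then obtain U where U: "neighbourhood (subtopology (power_space n) E) x U"
      "\<And>z. z \<in> U \<Longrightarrow> T z \<inter> {w \<in> Fn m. dst m y w < s} \<noteq> {}"
      using lsc x y unfolding lower_semicontinuous_def by meson
    obtain d where "0 < d" "\<And>z. z \<in> E \<Longrightarrow> dst n x z < d \<Longrightarrow> z \<in> U"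
      using neighbourhood_subtopology_ball[OF U(1) EF] by blast
    then show "\<exists>d>0. \<forall>z\<in>E. dst n x z < d \<longrightarrow> (\<exists>w\<in>T z. dst m y w < s)" using U(2) by blast
  qed (use ne conv TF in blast)+
qed

lemma definable_map_cont_selection:
  assumes Ed: "dset n E" and TF: "\<And>x. x \<in> E \<Longrightarrow> T x \<subseteq> Fn m" and f: "cont_selection n m T E f"
  shows "definable_map M n m E f"
proof -
  have fF: "f x \<in> Fn m" if "x \<in> E" for x using f TF that unfolding cont_selection_def by blast
  have fd: "dfun n (\<lambda>x. f x i)" if "i < m" for i using f that unfolding cont_selection_def by blast
  let ?G = "{concat_point n m x (f x) | x. x \<in> E}"
  let ?G' = "{z \<in> Fn (n + m). \<exists>x\<in>E. z = concat_point n m x (\<lambda>i\<in>{..<m}. f x i)}"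
  have restr: "(\<lambda>i\<in>{..<m}. f x i) = f x" if "x \<in> E" for x
    by (rule Fn_cong[OF _ fF[OF that]]) auto
  have "z \<in> ?G \<longleftrightarrow> z \<in> ?G'" for z
  proof -
    have "z \<in> ?G' \<longleftrightarrow> (\<exists>x\<in>E. z = concat_point n m x (\<lambda>i\<in>{..<m}. f x i))" (is "_ \<longleftrightarrow> ?R")
    proof
      assume ?R
      then have "z \<in> Fn (n + m)" by (elim bexE) (simp only: concat_point_in_Fn)
      then show "z \<in> ?G'" using \<open>?R\<close> by (intro CollectI conjI)
    next
      assume "z \<in> ?G'"
      then have "z \<in> Fn (n + m) \<and> ?R" by (rule CollectD)
      then show ?R by (rule conjunct2)
    qed
    also have "\<dots> \<longleftrightarrow> (\<exists>x\<in>E. z = concat_point n m x (f x))"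
      by (rule bex_cong[OF refl]) (simp only: restr)
    finally show ?thesis by blast
  qed
  then have eq: "?G = ?G'" by blast
  have "dset (n + m) ?G'"
  proof (intro dsetI dfn_ex_set[OF Ed] dfn_eq_vec[of "n + m"] dvec_concat)
    show "dvec (n + m) (\<lambda>e. \<lambda>i\<in>{..<n + m}. e (n + i))" by (rule dvec_var)
    show "dvec n (\<lambda>e. \<lambda>i\<in>{..<n}. e i)" by (rule dvec_var_id)
    show "dvec m (\<lambda>e. \<lambda>i\<in>{..<m}. f (\<lambda>i\<in>{..<n}. e i) i)"
      by (intro dvec_restrict dterm_fun[OF fd] dvec_var_id)
  qed
  then have "definable M (n + m) ?G" unfolding eq by (rule definable_dset)
  then show ?thesis unfolding definable_map_def using fF by blast
qed

end

theorem theorem3p5: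
  fixes M :: "('a::{linordered_field, linorder_topology}, 'f, 'r) expansion"
    and n m :: nat
    and E :: "(nat \<Rightarrow> 'a) set"
    and T :: "(nat \<Rightarrow> 'a) \<Rightarrow> (nat \<Rightarrow> 'a) set"
  assumes "expands_ordered_field M"
    and "d_minimal M"
    and "definable M n E"
    and "closedin (power_space n) E"
    and "definable_set_valued M n m E T"
    and "lower_semicontinuous n m E T"
    and "\<And>x. x \<in> E \<Longrightarrow> T x \<noteq> {}"
    and "\<And>x. x \<in> E \<Longrightarrow> closedin (power_space m) (T x)"
    and "\<And>x. x \<in> E \<Longrightarrow> convex_in_power m (T x)"
  shows "\<exists>f. definable_map M n m E f \<and>
             continuous_map (subtopology (power_space n) E) (power_space m) f \<and>
             (\<forall>x\<in>E. f x \<in> T x)"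
proof -
  interpret d_minimal_field M using assms(1,2) by unfold_locales
  have fam: "lsc_convex_family n m E T" using assms(3-9) by (rule lsc_convex_familyI)
  obtain f where f: "cont_selection n m T E f" using continuous_selection[OF fam] by blast
  have TF: "T x \<subseteq> Fn m" if "x \<in> E" for x using familyD(5)[OF fam that] by blast
  have EF: "E \<subseteq> Fn n" using dset_subset[OF familyD(1)[OF fam]] by blast
  have "definable_map M n m E f" by (rule definable_map_cont_selection[OF familyD(1)[OF fam] TF f])
  moreover have "continuous_map (subtopology (power_space n) E) (power_space m) f"
  proof (rule continuous_map_power_space[OF EF])
    show "f x \<in> Fn m" if "x \<in> E" for x using f TF[OF that] that unfolding cont_selection_def by blast
    show "cont_at n E (\<lambda>x. f x i) x" if "x \<in> E" "i < m" for x i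
      using f that unfolding cont_selection_def by blast
  qed
  moreover have "\<forall>x\<in>E. f x \<in> T x" using f unfolding cont_selection_def by blast
  ultimately show ?thesis by blast
qed

end
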